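(* Let $K$ be a field of characteristic zero and let $R$ be an affine $K$-algebra which is an integral domain of Krull dimension $1$, with a non-zero $K$-derivation $\delta$. Then $R$ is $\delta$-primitive. Consequently, $R[\theta;\delta]$ satisfies $(\diamond)$ if and only if $R$ is $\delta$-simple.
   Context: An affine $K$-algebra is a finitely generated commutative $K$-algebra. A $K$-derivation of $R$ is a $K$-linear map $\delta: R\to R$ with $\delta(ab)=\delta(a)b+a\delta(b)$. A $\delta$-ideal is an ideal $I$ of $R$ with $\delta(I)\subseteq I$; $R$ is $\delta$-simple if $0$ and $R$ are its only $\delta$-ideals; $R$ is $\delta$-primitive if it has a maximal ideal that contains no non-zero $\delta$-ideal of $R$. The differential operator ring $R[\theta;\delta]$ is the free left $R$-module with basis $1,\theta,\theta^2,\ldots$ with multiplication extending that of $R$ and determined by $\theta a = a\theta+\delta(a)$ for $a\in R$. A Noetherian ring $S$ satisfies property $(\diamond)$ if every cyclic essential extension of a simple $S$-module is Artinian; modules are left modules. *)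

theory Defs
  imports "HOL-Algebra.UnivPoly" "HOL-Algebra.Subrings" "HOL-Library.Extended_Nat"
begin

section \<open>Affine algebras, Krull dimension and derivations\<close>

definition char_zero :: "('k, 'c) ring_scheme \<Rightarrow> bool" where
  "char_zero K \<longleftrightarrow> (\<forall>n::nat. n > 0 \<longrightarrow> [n] \<cdot>\<^bsub>K\<^esub> \<one>\<^bsub>K\<^esub> \<noteq> \<zero>\<^bsub>K\<^esub>)"

text \<open>The library locale \<^locale>\<open>algebra\<close> already requires both rings to be commutative and
  unital. Finite generation: some finite set is contained in no proper subalgebra.\<close>

definition affine_algebra :: "('k, 'c) ring_scheme \<Rightarrow> ('k, 'a, 'd) module_scheme \<Rightarrow> bool" where
  "affine_algebra K R \<longleftrightarrow> algebra K R \<and>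
     (\<exists>A. finite A \<and> A \<subseteq> carrier R \<and>
        (\<forall>B. subring B R \<and> submodule B K R \<and> A \<subseteq> B \<longrightarrow> B = carrier R))"

text \<open>Supremum of the lengths of chains of prime ideals (0 for the zero ring).\<close>

definition krull_dim :: "('a, 'd) ring_scheme \<Rightarrow> enat" where
  "krull_dim R = Sup {enat n | n. \<exists>P :: nat \<Rightarrow> 'a set.
     (\<forall>i\<le>n. primeideal (P i) R) \<and> (\<forall>i<n. P i \<subset> P (Suc i))}"

definition derivation ::
    "('k, 'c) ring_scheme \<Rightarrow> ('k, 'a, 'd) module_scheme \<Rightarrow> ('a \<Rightarrow> 'a) \<Rightarrow> bool" where
  "derivation K R \<delta> \<longleftrightarrow>
     \<delta> \<in> carrier R \<rightarrow> carrier R \<and>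
     (\<forall>a\<in>carrier R. \<forall>b\<in>carrier R. \<delta> (a \<oplus>\<^bsub>R\<^esub> b) = \<delta> a \<oplus>\<^bsub>R\<^esub> \<delta> b) \<and>
     (\<forall>k\<in>carrier K. \<forall>a\<in>carrier R. \<delta> (k \<odot>\<^bsub>R\<^esub> a) = k \<odot>\<^bsub>R\<^esub> \<delta> a) \<and>
     (\<forall>a\<in>carrier R. \<forall>b\<in>carrier R.
        \<delta> (a \<otimes>\<^bsub>R\<^esub> b) = \<delta> a \<otimes>\<^bsub>R\<^esub> b \<oplus>\<^bsub>R\<^esub> a \<otimes>\<^bsub>R\<^esub> \<delta> b)"

definition delta_ideal :: "('a, 'd) ring_scheme \<Rightarrow> ('a \<Rightarrow> 'a) \<Rightarrow> 'a set \<Rightarrow> bool" where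
  "delta_ideal R \<delta> I \<longleftrightarrow> ideal I R \<and> \<delta> ` I \<subseteq> I"

definition delta_simple :: "('a, 'd) ring_scheme \<Rightarrow> ('a \<Rightarrow> 'a) \<Rightarrow> bool" where
  "delta_simple R \<delta> \<longleftrightarrow> (\<forall>I. delta_ideal R \<delta> I \<longrightarrow> I = {\<zero>\<^bsub>R\<^esub>} \<or> I = carrier R)"

definition delta_primitive :: "('a, 'd) ring_scheme \<Rightarrow> ('a \<Rightarrow> 'a) \<Rightarrow> bool" where
  "delta_primitive R \<delta> \<longleftrightarrow>
     (\<exists>M. maximalideal M R \<and> (\<forall>I. delta_ideal R \<delta> I \<and> I \<subseteq> M \<longrightarrow> I = {\<zero>\<^bsub>R\<^esub>}))"


section \<open>The differential operator ring\<close>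

text \<open>As a left \<open>R\<close>-module, \<open>R[\<theta>;\<delta>]\<close> is the module of polynomials \<^term>\<open>UP R\<close>: the function
  \<open>p\<close> stands for \<open>\<Sum>i. p i \<theta>\<^sup>i\<close> and \<^term>\<open>monom (UP R) a n\<close> for \<open>a\<theta>\<^sup>n\<close>. Only the product differs.
  By \<open>\<theta>a = a\<theta> + \<delta>(a)\<close>, left multiplication by \<open>\<theta>\<close> sends \<open>\<Sum>j. q j \<theta>\<^sup>j\<close> to
  \<open>\<Sum>j. q j \<theta>\<^sup>j\<^sup>+\<^sup>1 + \<Sum>j. \<delta>(q j) \<theta>\<^sup>j\<close>; then \<open>pq = \<Sum>i. p i (\<theta>\<^sup>i q)\<close>.\<close>

definition theta_mult :: "('a, 'd) ring_scheme \<Rightarrow> ('a \<Rightarrow> 'a) \<Rightarrow> (nat \<Rightarrow> 'a) \<Rightarrow> nat \<Rightarrow> 'a" where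
  "theta_mult R \<delta> q = (\<lambda>n. (case n of 0 \<Rightarrow> \<zero>\<^bsub>R\<^esub> | Suc m \<Rightarrow> q m) \<oplus>\<^bsub>R\<^esub> \<delta> (q n))"

definition diff_op_ring :: "('a, 'd) ring_scheme \<Rightarrow> ('a \<Rightarrow> 'a) \<Rightarrow> ('a, nat \<Rightarrow> 'a) up_ring" where
  "diff_op_ring R \<delta> = (UP R)\<lparr>mult := \<lambda>p q.
     \<Oplus>\<^bsub>UP R\<^esub>i\<in>{..deg R p}. p i \<odot>\<^bsub>UP R\<^esub> (theta_mult R \<delta> ^^ i) q\<rparr>"


text \<open>The defining properties: \<^term>\<open>diff_op_ring R \<delta>\<close> is a ring, it extends \<open>R\<close>,
  \<open>a\<theta>\<^sup>n\<close> is the product of \<open>a\<close> and \<open>\<theta>\<^sup>n\<close>, and \<open>\<theta>a = a\<theta> + \<delta>(a)\<close>.\<close>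

locale differential_ring = UP_cring R P
  for R :: "('k, 'a, 'd) module_scheme" (structure) and P (structure) +
  fixes K :: "('k, 'c) ring_scheme" and \<delta> :: "'a \<Rightarrow> 'a"
  assumes deriv: "derivation K R \<delta>"
begin

abbreviation "T \<equiv> theta_mult R \<delta>"

abbreviation "D \<equiv> diff_op_ring R \<delta>"

lemma delta_closed [simp, intro]: "a \<in> carrier R \<Longrightarrow> \<delta> a \<in> carrier R"
  using deriv by (auto simp: derivation_def)

lemma delta_add: "a \<in> carrier R \<Longrightarrow> b \<in> carrier R \<Longrightarrow> \<delta> (a \<oplus> b) = \<delta> a \<oplus> \<delta> b"
  using deriv by (simp add: derivation_def)

lemma delta_mult:
  "a \<in> carrier R \<Longrightarrow> b \<in> carrier R \<Longrightarrow> \<delta> (a \<otimes> b) = \<delta> a \<otimes> b \<oplus> a \<otimes> \<delta> b"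
  using deriv by (simp add: derivation_def)

lemma delta_zero [simp]: "\<delta> \<zero> = \<zero>"
  using delta_add[of \<zero> \<zero>] R.add.l_cancel_one[of "\<delta> \<zero>" "\<delta> \<zero>"] by simp

lemma delta_one [simp]: "\<delta> \<one> = \<zero>"
  using delta_mult[of \<one> \<one>] R.add.l_cancel_one[of "\<delta> \<one>" "\<delta> \<one>"] by simp

lemma carrier_P: "carrier P = up R"
  by (simp add: P_def UP_def)

lemma coeff_P: "p \<in> carrier P \<Longrightarrow> coeff P p = p"
  by (simp add: P_def UP_def)

lemma coeff_in_R [simp]: "p \<in> carrier P \<Longrightarrow> p n \<in> carrier R"
  by (metis coeff_P coeff_closed)

lemma T_closed [simp, intro]: "p \<in> carrier P \<Longrightarrow> T p \<in> carrier P"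
proof -
  assume p: "p \<in> carrier P"
  then obtain n where n: "bound \<zero> n p" by (auto simp: carrier_P)
  have "bound \<zero> (Suc n) (T p)"
  proof
    fix m assume "Suc n < m"
    then show "T p m = \<zero>"
      using n by (cases m) (auto simp: theta_mult_def bound_def)
  qed
  moreover have "T p m \<in> carrier R" for m
    using p by (cases m) (auto simp: theta_mult_def)
  ultimately show ?thesis by (auto simp: carrier_P)
qed

lemma Tpow_closed [simp, intro]: "p \<in> carrier P \<Longrightarrow> (T ^^ i) p \<in> carrier P"
  by (induction i) auto

lemma coeff_T: "p \<in> carrier P \<Longrightarrow>
    coeff P (T p) n = (case n of 0 \<Rightarrow> \<zero> | Suc m \<Rightarrow> coeff P p m) \<oplus> \<delta> (coeff P p n)"
  by (simp only: coeff_P[OF T_closed] coeff_P, simp add: theta_mult_def)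

lemma T_add: 
  assumes "p \<in> carrier P" "q \<in> carrier P"
  shows "T (p \<oplus>\<^bsub>P\<^esub> q) = T p \<oplus>\<^bsub>P\<^esub> T q"
proof (rule up_eqI)
  fix n
  show "coeff P (T (p \<oplus>\<^bsub>P\<^esub> q)) n = coeff P (T p \<oplus>\<^bsub>P\<^esub> T q) n"
    using assms by (auto simp: coeff_T delta_add R.add.m_ac split: nat.split)
qed (use assms in auto)

lemma T_smult: 
  assumes "a \<in> carrier R" "q \<in> carrier P"
  shows "T (a \<odot>\<^bsub>P\<^esub> q) = a \<odot>\<^bsub>P\<^esub> T q \<oplus>\<^bsub>P\<^esub> \<delta> a \<odot>\<^bsub>P\<^esub> q"
proof (rule up_eqI)
  fix n
  show "coeff P (T (a \<odot>\<^bsub>P\<^esub> q)) n = coeff P (a \<odot>\<^bsub>P\<^esub> T q \<oplus>\<^bsub>P\<^esub> \<delta> a \<odot>\<^bsub>P\<^esub> q) n"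
    using assms by (auto simp: coeff_T delta_mult R.r_distr R.add.m_ac split: nat.split)
qed (use assms in auto)

lemma Tpow_add: "p \<in> carrier P \<Longrightarrow> q \<in> carrier P \<Longrightarrow> (T ^^ i) (p \<oplus>\<^bsub>P\<^esub> q) = (T ^^ i) p \<oplus>\<^bsub>P\<^esub> (T ^^ i) q"
  by (induction i) (simp_all add: T_add)

lemma T_zero: "T \<zero>\<^bsub>P\<^esub> = \<zero>\<^bsub>P\<^esub>"
  by (rule up_eqI) (auto simp: coeff_T split: nat.split)

lemma T_finsum: "finite A \<Longrightarrow> f \<in> A \<rightarrow> carrier P \<Longrightarrow>
   T (\<Oplus>\<^bsub>P\<^esub>i\<in>A. f i) = (\<Oplus>\<^bsub>P\<^esub>i\<in>A. T (f i))"
  by (induction A rule: finite_induct) (auto simp: T_zero T_add Pi_def)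

lemma D_simps [simp]: "carrier D = carrier P" "\<one>\<^bsub>D\<^esub> = \<one>\<^bsub>P\<^esub>" "\<zero>\<^bsub>D\<^esub> = \<zero>\<^bsub>P\<^esub>"
    "x \<oplus>\<^bsub>D\<^esub> y = x \<oplus>\<^bsub>P\<^esub> y" "monom D = monom P" "coeff D = coeff P" "a \<odot>\<^bsub>D\<^esub> x = a \<odot>\<^bsub>P\<^esub> x"
  by (simp_all add: diff_op_ring_def P_def)

lemma D_mult:
  assumes "p \<in> carrier P" "q \<in> carrier P" "deg R p \<le> N"
  shows "p \<otimes>\<^bsub>D\<^esub> q = (\<Oplus>\<^bsub>P\<^esub>i\<in>{..N}. coeff P p i \<odot>\<^bsub>P\<^esub> (T ^^ i) q)"
proof -
  have "p \<otimes>\<^bsub>D\<^esub> q = (\<Oplus>\<^bsub>P\<^esub>i\<in>{..deg R p}. coeff P p i \<odot>\<^bsub>P\<^esub> (T ^^ i) q)"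
    using assms by (simp add: diff_op_ring_def P_def[symmetric] coeff_P)
  also have "\<dots> = (\<Oplus>\<^bsub>P\<^esub>i\<in>{..N}. coeff P p i \<odot>\<^bsub>P\<^esub> (T ^^ i) q)"
    using assms
    by (intro P.add.finprod_mono_neutral_cong_left) (auto simp: deg_aboveD)
  finally show ?thesis .
qed

lemma D_closed: "p \<in> carrier P \<Longrightarrow> q \<in> carrier P \<Longrightarrow> p \<otimes>\<^bsub>D\<^esub> q \<in> carrier P"
  using D_mult[OF _ _ order.refl, of p q] by (simp add: Pi_def)

lemma D_l_add:
  assumes "p \<in> carrier P" "p' \<in> carrier P" "q \<in> carrier P"
  shows "(p \<oplus>\<^bsub>P\<^esub> p') \<otimes>\<^bsub>D\<^esub> q = p \<otimes>\<^bsub>D\<^esub> q \<oplus>\<^bsub>P\<^esub> p' \<otimes>\<^bsub>D\<^esub> q"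
proof -
  define N where "N = max (deg R (p \<oplus>\<^bsub>P\<^esub> p')) (max (deg R p) (deg R p'))"
  have N: "deg R (p \<oplus>\<^bsub>P\<^esub> p') \<le> N" "deg R p \<le> N" "deg R p' \<le> N"
    by (simp_all add: N_def le_max_iff_disj)
  show ?thesis
    using assms by (simp add: D_mult[OF _ _ N(1)] D_mult[OF _ _ N(2)] D_mult[OF _ _ N(3)]
        UP_smult_l_distr P.finsum_addf Pi_def)
qed

lemma D_r_add:
  assumes "p \<in> carrier P" "q \<in> carrier P" "q' \<in> carrier P"
  shows "p \<otimes>\<^bsub>D\<^esub> (q \<oplus>\<^bsub>P\<^esub> q') = p \<otimes>\<^bsub>D\<^esub> q \<oplus>\<^bsub>P\<^esub> p \<otimes>\<^bsub>D\<^esub> q'"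
  using assms by (simp add: D_mult[OF _ _ order.refl] Tpow_add UP_smult_r_distr
      P.finsum_addf Pi_def)

lemma D_smult:
  assumes "a \<in> carrier R" "p \<in> carrier P" "q \<in> carrier P"
  shows "(a \<odot>\<^bsub>P\<^esub> p) \<otimes>\<^bsub>D\<^esub> q = a \<odot>\<^bsub>P\<^esub> (p \<otimes>\<^bsub>D\<^esub> q)"
proof -
  define N where "N = max (deg R (a \<odot>\<^bsub>P\<^esub> p)) (deg R p)"
  have N: "deg R (a \<odot>\<^bsub>P\<^esub> p) \<le> N" "deg R p \<le> N" by (simp_all add: N_def le_max_iff_disj)
  show ?thesis
    using assms by (simp add: D_mult[OF _ _ N(1)] D_mult[OF _ _ N(2)]
        finsum_smult_ldistr UP_smult_assoc1 Pi_def)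
qed

lemma D_T:
  assumes "p \<in> carrier P" "q \<in> carrier P"
  shows "T p \<otimes>\<^bsub>D\<^esub> q = T (p \<otimes>\<^bsub>D\<^esub> q)"
proof -
  define N where "N = max (deg R (T p)) (deg R p)"
  have N: "deg R (T p) \<le> Suc N" "deg R p \<le> N" "deg R p \<le> Suc N" by (simp_all add: N_def le_max_iff_disj)
  let ?c = "coeff P p" and ?q = "\<lambda>i. (T ^^ i) q"
  let ?s = "\<lambda>i. case i of 0 \<Rightarrow> \<zero>\<^bsub>P\<^esub> | Suc j \<Rightarrow> ?c j \<odot>\<^bsub>P\<^esub> ?q i"
  have "T p \<otimes>\<^bsub>D\<^esub> q = (\<Oplus>\<^bsub>P\<^esub>i\<in>{..Suc N}. ?s i \<oplus>\<^bsub>P\<^esub> \<delta> (?c i) \<odot>\<^bsub>P\<^esub> ?q i)"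
    using assms
    unfolding D_mult[OF T_closed[OF assms(1)] assms(2) N(1)]
    by (intro P.finsum_cong' refl)
       (auto simp: coeff_T UP_smult_l_distr Pi_def split: nat.split)
  also have "\<dots> = (\<Oplus>\<^bsub>P\<^esub>i\<in>{..Suc N}. ?s i) \<oplus>\<^bsub>P\<^esub> (\<Oplus>\<^bsub>P\<^esub>i\<in>{..Suc N}. \<delta> (?c i) \<odot>\<^bsub>P\<^esub> ?q i)"
    using assms by (intro P.finsum_addf) (auto split: nat.split)
  also have "(\<Oplus>\<^bsub>P\<^esub>i\<in>{..Suc N}. ?s i) = (\<Oplus>\<^bsub>P\<^esub>i\<in>{..N}. ?c i \<odot>\<^bsub>P\<^esub> T (?q i))"
    using assms by (subst P.finsum_Suc2) (auto simp: Pi_def split: nat.split)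
  also have "(\<Oplus>\<^bsub>P\<^esub>i\<in>{..Suc N}. \<delta> (?c i) \<odot>\<^bsub>P\<^esub> ?q i) = (\<Oplus>\<^bsub>P\<^esub>i\<in>{..N}. \<delta> (?c i) \<odot>\<^bsub>P\<^esub> ?q i)"
    using assms N deg_aboveD[of p "Suc N"]
    by (intro P.add.finprod_mono_neutral_cong_right) (auto simp: le_Suc_eq N_def)
  also have "(\<Oplus>\<^bsub>P\<^esub>i\<in>{..N}. ?c i \<odot>\<^bsub>P\<^esub> T (?q i)) \<oplus>\<^bsub>P\<^esub> (\<Oplus>\<^bsub>P\<^esub>i\<in>{..N}. \<delta> (?c i) \<odot>\<^bsub>P\<^esub> ?q i)
     = (\<Oplus>\<^bsub>P\<^esub>i\<in>{..N}. T (?c i \<odot>\<^bsub>P\<^esub> ?q i))"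
    using assms by (subst P.finsum_addf[symmetric]) (auto simp: T_smult)
  also have "\<dots> = T (\<Oplus>\<^bsub>P\<^esub>i\<in>{..N}. ?c i \<odot>\<^bsub>P\<^esub> ?q i)"
    using assms by (intro T_finsum[symmetric]) auto
  finally show ?thesis using assms by (simp add: D_mult[OF _ _ N(2)])
qed

lemma D_Tpow: "p \<in> carrier P \<Longrightarrow> q \<in> carrier P \<Longrightarrow> (T ^^ i) p \<otimes>\<^bsub>D\<^esub> q = (T ^^ i) (p \<otimes>\<^bsub>D\<^esub> q)"
  by (induction i) (auto simp: D_T D_closed)

lemma D_zero_l: "q \<in> carrier P \<Longrightarrow> \<zero>\<^bsub>P\<^esub> \<otimes>\<^bsub>D\<^esub> q = \<zero>\<^bsub>P\<^esub>"
  using D_smult[of \<zero> "\<zero>\<^bsub>P\<^esub>" q] by (simp add: D_closed)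

lemma D_finsum_l: "finite A \<Longrightarrow> f \<in> A \<rightarrow> carrier P \<Longrightarrow> q \<in> carrier P \<Longrightarrow>
   (\<Oplus>\<^bsub>P\<^esub>i\<in>A. f i) \<otimes>\<^bsub>D\<^esub> q = (\<Oplus>\<^bsub>P\<^esub>i\<in>A. f i \<otimes>\<^bsub>D\<^esub> q)"
  by (induction A rule: finite_induct) (auto simp: D_zero_l D_l_add D_closed Pi_def)

lemma D_assoc:
  assumes "p \<in> carrier P" "q \<in> carrier P" "r \<in> carrier P"
  shows "(p \<otimes>\<^bsub>D\<^esub> q) \<otimes>\<^bsub>D\<^esub> r = p \<otimes>\<^bsub>D\<^esub> (q \<otimes>\<^bsub>D\<^esub> r)"
proof -
  have "(p \<otimes>\<^bsub>D\<^esub> q) \<otimes>\<^bsub>D\<^esub> r = (\<Oplus>\<^bsub>P\<^esub>i\<in>{..deg R p}. coeff P p i \<odot>\<^bsub>P\<^esub> (T ^^ i) q) \<otimes>\<^bsub>D\<^esub> r"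
    using assms by (simp add: D_mult[of p q, OF _ _ order.refl])
  also have "\<dots> = (\<Oplus>\<^bsub>P\<^esub>i\<in>{..deg R p}. coeff P p i \<odot>\<^bsub>P\<^esub> (T ^^ i) (q \<otimes>\<^bsub>D\<^esub> r))"
    using assms by (subst D_finsum_l) (auto simp: D_smult D_Tpow D_closed intro!: P.finsum_cong)
  also have "\<dots> = p \<otimes>\<^bsub>D\<^esub> (q \<otimes>\<^bsub>D\<^esub> r)"
    using assms by (simp add: D_mult[OF _ _ order.refl, of p] D_closed)
  finally show ?thesis .
qed

lemma T_monom_one: "T (monom P \<one> i) = monom P \<one> (Suc i)"
  by (rule up_eqI) (auto simp: coeff_T split: nat.split)

lemma Tpow_one: "(T ^^ i) \<one>\<^bsub>P\<^esub> = monom P \<one> i"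
proof (induction i)
  case 0 show ?case by (simp add: monom_one del: One_nat_def)
next
  case (Suc i) then show ?case by (simp add: T_monom_one)
qed

lemma D_one_r: "p \<in> carrier P \<Longrightarrow> p \<otimes>\<^bsub>D\<^esub> \<one>\<^bsub>P\<^esub> = p"
  using monom_mult_smult[symmetric, of _ \<one>] up_repr[of p]
  by (subst D_mult[OF _ _ order.refl]) (auto simp: Tpow_one cong: P.finsum_cong)

lemma D_monom:
  assumes "a \<in> carrier R" "q \<in> carrier P"
  shows "monom P a i \<otimes>\<^bsub>D\<^esub> q = a \<odot>\<^bsub>P\<^esub> (T ^^ i) q"
proof -
  have "monom P a i \<otimes>\<^bsub>D\<^esub> q = (\<Oplus>\<^bsub>P\<^esub>j\<in>{..i}. coeff P (monom P a i) j \<odot>\<^bsub>P\<^esub> (T ^^ j) q)"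
    using assms by (intro D_mult) (auto simp: deg_monom_le)
  also have "\<dots> = (\<Oplus>\<^bsub>P\<^esub>j\<in>{..i}. if i = j then a \<odot>\<^bsub>P\<^esub> (T ^^ j) q else \<zero>\<^bsub>P\<^esub>)"
    using assms by (intro P.finsum_cong' refl) auto
  also have "\<dots> = a \<odot>\<^bsub>P\<^esub> (T ^^ i) q"
    using assms P.finsum_singleton[of i "{..i}" "\<lambda>j. a \<odot>\<^bsub>P\<^esub> (T ^^ j) q"] by auto
  finally show ?thesis .
qed

lemma diff_op_ring_is_ring: "ring D"
proof (rule ringI)
  show "abelian_group D"
  proof (rule abelian_groupI)
    fix x assume "x \<in> carrier D"
    then show "\<exists>y\<in>carrier D. y \<oplus>\<^bsub>D\<^esub> x = \<zero>\<^bsub>D\<^esub>"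
      by (auto intro!: bexI[of _ "\<ominus>\<^bsub>P\<^esub> x"] simp: P.l_neg)
  qed (auto simp: P.add.m_ac)
  show "monoid D"
    by (rule monoidI)
       (auto simp: D_closed D_assoc D_one_r D_monom[of \<one> _ 0, simplified])
qed (auto simp: D_l_add D_r_add)

theorem theta_commutation:
  assumes "a \<in> carrier R"
  shows "monom D \<one> 1 \<otimes>\<^bsub>D\<^esub> monom D a 0 = monom D a 0 \<otimes>\<^bsub>D\<^esub> monom D \<one> 1 \<oplus>\<^bsub>D\<^esub> monom D (\<delta> a) 0"
  using assms
  by (intro up_eqI) (auto simp: D_monom coeff_T split: nat.split)

theorem monom_mult_const:
  assumes "a \<in> carrier R" "b \<in> carrier R"
  shows "monom D a 0 \<otimes>\<^bsub>D\<^esub> monom D b n = monom D (a \<otimes> b) n"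
  using assms by (intro up_eqI) (auto simp: D_monom)

theorem monom_eq_const_mult_theta_pow:
  assumes "a \<in> carrier R"
  shows "monom D a n = monom D a 0 \<otimes>\<^bsub>D\<^esub> (monom D \<one> 1 [^]\<^bsub>D\<^esub> n)"
proof -
  interpret D: ring D by (rule diff_op_ring_is_ring)
  have "monom P \<one> n = monom P \<one> 1 [^]\<^bsub>D\<^esub> n"
  proof (induction n)
    case (Suc n)
    have "monom P \<one> 1 [^]\<^bsub>D\<^esub> Suc n = monom P \<one> 1 \<otimes>\<^bsub>D\<^esub> monom P \<one> n"
      using Suc D.nat_pow_Suc2[of "monom P \<one> 1" n] by simp
    also have "\<dots> = monom P \<one> (Suc n)" using D_monom[of \<one> "monom P \<one> n" 1]
      by (simp add: T_monom_one)
    finally show ?case by simp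
  qed auto
  then show ?thesis using assms monom_mult_const[of a \<one> n] by simp
qed

end


section \<open>Left modules\<close>

text \<open>As the library's \<^locale>\<open>module\<close>, but over a ring that need not be commutative. The multiplicative
  fields of the record \<open>M\<close> play no role.\<close>

locale left_module = R?: ring R + M?: abelian_group M
  for R :: "('s, 'c) ring_scheme" and M :: "('s, 'm, 'd) module_scheme" (structure) +
  assumes smult_closed [simp, intro]:
      "\<lbrakk>a \<in> carrier R; x \<in> carrier M\<rbrakk> \<Longrightarrow> a \<odot>\<^bsub>M\<^esub> x \<in> carrier M"
    and smult_l_distr:
      "\<lbrakk>a \<in> carrier R; b \<in> carrier R; x \<in> carrier M\<rbrakk> \<Longrightarrow>
       (a \<oplus>\<^bsub>R\<^esub> b) \<odot>\<^bsub>M\<^esub> x = a \<odot>\<^bsub>M\<^esub> x \<oplus>\<^bsub>M\<^esub> b \<odot>\<^bsub>M\<^esub> x"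
    and smult_r_distr:
      "\<lbrakk>a \<in> carrier R; x \<in> carrier M; y \<in> carrier M\<rbrakk> \<Longrightarrow>
       a \<odot>\<^bsub>M\<^esub> (x \<oplus>\<^bsub>M\<^esub> y) = a \<odot>\<^bsub>M\<^esub> x \<oplus>\<^bsub>M\<^esub> a \<odot>\<^bsub>M\<^esub> y"
    and smult_assoc:
      "\<lbrakk>a \<in> carrier R; b \<in> carrier R; x \<in> carrier M\<rbrakk> \<Longrightarrow>
       (a \<otimes>\<^bsub>R\<^esub> b) \<odot>\<^bsub>M\<^esub> x = a \<odot>\<^bsub>M\<^esub> (b \<odot>\<^bsub>M\<^esub> x)"
    and smult_one [simp]:
      "x \<in> carrier M \<Longrightarrow> \<one>\<^bsub>R\<^esub> \<odot>\<^bsub>M\<^esub> x = x"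

definition simple_module :: "('s, 'c) ring_scheme \<Rightarrow> ('s, 'm, 'd) module_scheme \<Rightarrow> bool" where
  "simple_module S M \<longleftrightarrow> left_module S M \<and> carrier M \<noteq> {\<zero>\<^bsub>M\<^esub>} \<and>
     (\<forall>W. submodule W S M \<longrightarrow> W = {\<zero>\<^bsub>M\<^esub>} \<or> W = carrier M)"

definition cyclic_module :: "('s, 'c) ring_scheme \<Rightarrow> ('s, 'm, 'd) module_scheme \<Rightarrow> bool" where
  "cyclic_module S M \<longleftrightarrow> left_module S M \<and>
     (\<exists>x\<in>carrier M. carrier M = {s \<odot>\<^bsub>M\<^esub> x | s. s \<in> carrier S})"

definition artinian_module :: "('s, 'c) ring_scheme \<Rightarrow> ('s, 'm, 'd) module_scheme \<Rightarrow> bool" where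
  "artinian_module S M \<longleftrightarrow> left_module S M \<and>
     (\<forall>W :: nat \<Rightarrow> 'm set. (\<forall>i. submodule (W i) S M) \<and> (\<forall>i. W (Suc i) \<subseteq> W i) \<longrightarrow>
        (\<exists>n. \<forall>i\<ge>n. W i = W n))"

definition essential_submodule ::
    "('s, 'c) ring_scheme \<Rightarrow> ('s, 'm, 'd) module_scheme \<Rightarrow> 'm set \<Rightarrow> bool" where
  "essential_submodule S M V \<longleftrightarrow> submodule V S M \<and>
     (\<forall>W. submodule W S M \<and> W \<noteq> {\<zero>\<^bsub>M\<^esub>} \<longrightarrow> V \<inter> W \<noteq> {\<zero>\<^bsub>M\<^esub>})"

definition essential_extension_of_simple ::
    "('s, 'c) ring_scheme \<Rightarrow> ('s, 'm, 'd) module_scheme \<Rightarrow> bool" where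
  "essential_extension_of_simple S M \<longleftrightarrow> left_module S M \<and>
     (\<exists>V. essential_submodule S M V \<and> simple_module S (M\<lparr>carrier := V\<rparr>))"

text \<open>Property \<open>(\<diamond>)\<close>. A cyclic module over \<open>S\<close> is isomorphic to one whose elements are cosets of
  a left ideal of \<open>S\<close>, so it suffices to quantify over modules whose elements are sets of elements of
  \<open>S\<close>; the lemma \<open>diamond_all_types\<close> below shows that the property then holds for modules on every
  type. The property is used only for Noetherian \<open>S\<close>; being Noetherian is not part of it.\<close>

definition diamond :: "('s, 'c) ring_scheme \<Rightarrow> bool" where
  "diamond S \<longleftrightarrow> (\<forall>M :: ('s, 's set) module.
     cyclic_module S M \<and> essential_extension_of_simple S M \<longrightarrow> artinian_module S M)"

lemma (in left_module) smult_l_null: "x \<in> carrier M \<Longrightarrow> \<zero>\<^bsub>R\<^esub> \<odot>\<^bsub>M\<^esub> x = \<zero>\<^bsub>M\<^esub>"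
  using smult_l_distr[of "\<zero>\<^bsub>R\<^esub>" "\<zero>\<^bsub>R\<^esub>" x]
    M.add.l_cancel_one[of "\<zero>\<^bsub>R\<^esub> \<odot>\<^bsub>M\<^esub> x" "\<zero>\<^bsub>R\<^esub> \<odot>\<^bsub>M\<^esub> x"] by simp

lemma (in left_module) smult_minus_one:
  assumes "x \<in> carrier M"
  shows "(\<ominus>\<^bsub>R\<^esub> \<one>\<^bsub>R\<^esub>) \<odot>\<^bsub>M\<^esub> x = \<ominus>\<^bsub>M\<^esub> x"
proof -
  have "(\<ominus>\<^bsub>R\<^esub> \<one>\<^bsub>R\<^esub>) \<odot>\<^bsub>M\<^esub> x \<oplus>\<^bsub>M\<^esub> x = (\<ominus>\<^bsub>R\<^esub> \<one>\<^bsub>R\<^esub> \<oplus>\<^bsub>R\<^esub> \<one>\<^bsub>R\<^esub>) \<odot>\<^bsub>M\<^esub> x"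
    using assms by (subst smult_l_distr) auto
  also have "\<dots> = \<zero>\<^bsub>M\<^esub>"
    using assms by (simp add: R.l_neg smult_l_null)
  finally show ?thesis
    using assms M.minus_equality by force
qed

lemma (in left_module) submodule_iff:
  "submodule W R M \<longleftrightarrow> W \<subseteq> carrier M \<and> \<zero>\<^bsub>M\<^esub> \<in> W \<and> (\<forall>x\<in>W. \<forall>y\<in>W. x \<oplus>\<^bsub>M\<^esub> y \<in> W) \<and>
     (\<forall>s\<in>carrier R. \<forall>x\<in>W. s \<odot>\<^bsub>M\<^esub> x \<in> W)"
proof
  assume "submodule W R M"
  then interpret submodule W R M .
  show "W \<subseteq> carrier M \<and> \<zero>\<^bsub>M\<^esub> \<in> W \<and> (\<forall>x\<in>W. \<forall>y\<in>W. x \<oplus>\<^bsub>M\<^esub> y \<in> W) \<and>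
     (\<forall>s\<in>carrier R. \<forall>x\<in>W. s \<odot>\<^bsub>M\<^esub> x \<in> W)"
    using subset m_closed one_closed smult_closed by auto
next
  assume W: "W \<subseteq> carrier M \<and> \<zero>\<^bsub>M\<^esub> \<in> W \<and> (\<forall>x\<in>W. \<forall>y\<in>W. x \<oplus>\<^bsub>M\<^esub> y \<in> W) \<and>
     (\<forall>s\<in>carrier R. \<forall>x\<in>W. s \<odot>\<^bsub>M\<^esub> x \<in> W)"
  have "\<ominus>\<^bsub>M\<^esub> x \<in> W" if "x \<in> W" for x
  proof -
    have "(\<ominus>\<^bsub>R\<^esub> \<one>\<^bsub>R\<^esub>) \<odot>\<^bsub>M\<^esub> x \<in> W" using W that by blast
    moreover have "x \<in> carrier M" using W that by blast
    ultimately show ?thesis by (simp add: smult_minus_one)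
  qed
  then show "submodule W R M"
    using W by unfold_locales (auto simp: a_inv_def)
qed

lemma (in left_module) submodule_left_module:
  assumes "submodule W R M"
  shows "left_module R (M\<lparr>carrier := W\<rparr>)"
proof -
  have W: "W \<subseteq> carrier M" "\<zero>\<^bsub>M\<^esub> \<in> W" "\<And>x y. x \<in> W \<Longrightarrow> y \<in> W \<Longrightarrow> x \<oplus>\<^bsub>M\<^esub> y \<in> W"
    "\<And>s x. s \<in> carrier R \<Longrightarrow> x \<in> W \<Longrightarrow> s \<odot>\<^bsub>M\<^esub> x \<in> W"
    using assms by (auto simp: submodule_iff)
  have "abelian_group (M\<lparr>carrier := W\<rparr>)"
  proof (rule abelian_groupI)
    fix x assume "x \<in> carrier (M\<lparr>carrier := W\<rparr>)"
    then show "\<exists>y\<in>carrier (M\<lparr>carrier := W\<rparr>). y \<oplus>\<^bsub>M\<lparr>carrier := W\<rparr>\<^esub> x = \<zero>\<^bsub>M\<lparr>carrier := W\<rparr>\<^esub>"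
      using W W(4)[of "\<ominus>\<^bsub>R\<^esub> \<one>\<^bsub>R\<^esub>" x]
      by (auto intro!: bexI[of _ "\<ominus>\<^bsub>M\<^esub> x"] simp: smult_minus_one subset_iff M.l_neg)
  qed (use W in \<open>auto simp: subset_iff M.add.m_ac\<close>)
  then show ?thesis
    using W R.ring_axioms
    by (intro left_module.intro left_module_axioms.intro)
       (auto simp: subset_iff smult_l_distr smult_r_distr smult_assoc)
qed

lemma (in left_module) submodule_of_submodule_iff:
  assumes "submodule V R M"
  shows "submodule W R (M\<lparr>carrier := V\<rparr>) \<longleftrightarrow> W \<subseteq> V \<and> submodule W R M"
proof -
  interpret V: left_module R "M\<lparr>carrier := V\<rparr>"
    by (rule submodule_left_module[OF assms])
  show ?thesis
    using assms unfolding V.submodule_iff submodule_iff by auto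
qed

lemma (in left_module) simple_submodule_iff:
  assumes "submodule V R M"
  shows "simple_module R (M\<lparr>carrier := V\<rparr>) \<longleftrightarrow> V \<noteq> {\<zero>\<^bsub>M\<^esub>} \<and>
     (\<forall>W. W \<subseteq> V \<and> submodule W R M \<longrightarrow> W = {\<zero>\<^bsub>M\<^esub>} \<or> W = V)"
  using submodule_left_module[OF assms] submodule_of_submodule_iff[OF assms]
  by (simp add: simple_module_def)

definition transport_module ::
    "('m \<Rightarrow> 'n) \<Rightarrow> ('s, 'm, 'd) module_scheme \<Rightarrow> ('s, 'n) module" where
  "transport_module f M = (let g = the_inv_into (carrier M) f in
     \<lparr>carrier = f ` carrier M, mult = undefined, one = undefined, zero = f \<zero>\<^bsub>M\<^esub>,
      add = \<lambda>x y. f (g x \<oplus>\<^bsub>M\<^esub> g y), smult = \<lambda>s x. f (s \<odot>\<^bsub>M\<^esub> g x)\<rparr>)"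

context left_module
begin

context
  fixes f :: "'m \<Rightarrow> 'n" and N :: "('s, 'n) module"
  assumes inj: "inj_on f (carrier M)" and N: "N = transport_module f M"
begin

lemma transport_simps [simp]:
  "carrier N = f ` carrier M" "\<zero>\<^bsub>N\<^esub> = f \<zero>\<^bsub>M\<^esub>"
  "x \<in> carrier M \<Longrightarrow> y \<in> carrier M \<Longrightarrow> f x \<oplus>\<^bsub>N\<^esub> f y = f (x \<oplus>\<^bsub>M\<^esub> y)"
  "x \<in> carrier M \<Longrightarrow> s \<odot>\<^bsub>N\<^esub> f x = f (s \<odot>\<^bsub>M\<^esub> x)"
  by (simp_all add: N transport_module_def Let_def the_inv_into_f_f[OF inj])

lemma transport_left_module: "left_module R N"
proof -
  have "abelian_group N"
  proof (rule abelian_groupI)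
    fix x assume "x \<in> carrier N"
    then obtain x' where "x = f x'" "x' \<in> carrier M" by auto
    then show "\<exists>y\<in>carrier N. y \<oplus>\<^bsub>N\<^esub> x = \<zero>\<^bsub>N\<^esub>"
      by (auto intro!: bexI[of _ "\<ominus>\<^bsub>M\<^esub> x'"] simp: M.l_neg)
  qed (auto simp: M.add.m_ac)
  then show ?thesis
    using R.ring_axioms
    by (intro left_module.intro left_module_axioms.intro)
       (auto simp: smult_l_distr smult_r_distr smult_assoc)
qed

lemma transport_image_eq_iff:
  "V \<subseteq> carrier M \<Longrightarrow> W \<subseteq> carrier M \<Longrightarrow> f ` V = f ` W \<longleftrightarrow> V = W"
  by (rule inj_on_image_eq_iff[OF inj])

lemma transport_submodule:
  assumes "W \<subseteq> carrier M"
  shows "submodule (f ` W) R N \<longleftrightarrow> submodule W R M"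
proof -
  interpret N: left_module R N by (rule transport_left_module)
  have mem: "f x \<in> f ` W \<longleftrightarrow> x \<in> W" if "x \<in> carrier M" for x
    using that assms inj by (auto dest: inj_onD)
  show ?thesis
    unfolding N.submodule_iff submodule_iff using assms
    by (auto simp: mem subset_iff image_iff[of _ f "carrier M"])
qed

lemma transport_submoduleE:
  assumes "submodule W' R N"
  obtains W where "W \<subseteq> carrier M" "W' = f ` W" "submodule W R M"
proof -
  interpret N: left_module R N by (rule transport_left_module)
  have "W' \<subseteq> f ` carrier M" using assms by (simp add: N.submodule_iff)
  then obtain W where "W \<subseteq> carrier M" "W' = f ` W" by (auto simp: subset_image_iff)
  then show ?thesis using that transport_submodule assms by blast
qed

lemma transport_zero_iff: "W \<subseteq> carrier M \<Longrightarrow> f ` W = {f \<zero>\<^bsub>M\<^esub>} \<longleftrightarrow> W = {\<zero>\<^bsub>M\<^esub>}"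
  using transport_image_eq_iff[of W "{\<zero>\<^bsub>M\<^esub>}"] by simp

lemma transport_cyclic:
  assumes "cyclic_module R M"
  shows "cyclic_module R N"
proof -
  obtain x where x: "x \<in> carrier M" "carrier M = {s \<odot>\<^bsub>M\<^esub> x | s. s \<in> carrier R}"
    using assms by (auto simp: cyclic_module_def)
  have "f ` carrier M = {s \<odot>\<^bsub>N\<^esub> f x | s. s \<in> carrier R}"
    using x(1) by (subst x(2)) auto
  then show ?thesis
    using x(1) transport_left_module unfolding cyclic_module_def transport_simps(1) by blast
qed

lemma transport_essential_extension:
  assumes "essential_extension_of_simple R M"
  shows "essential_extension_of_simple R N"
proof -
  interpret N: left_module R N by (rule transport_left_module)
  obtain V where V: "submodule V R M" "simple_module R (M\<lparr>carrier := V\<rparr>)"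
    and ess: "\<And>W. submodule W R M \<Longrightarrow> W \<noteq> {\<zero>\<^bsub>M\<^esub>} \<Longrightarrow> V \<inter> W \<noteq> {\<zero>\<^bsub>M\<^esub>}"
    using assms by (auto simp: essential_extension_of_simple_def essential_submodule_def)
  have VM: "V \<subseteq> carrier M" using V(1) by (simp add: submodule_iff)
  have V': "submodule (f ` V) R N" using V(1) VM by (simp add: transport_submodule)
  have "simple_module R (N\<lparr>carrier := f ` V\<rparr>)"
    unfolding N.simple_submodule_iff[OF V']
  proof (intro conjI allI impI)
    show "f ` V \<noteq> {\<zero>\<^bsub>N\<^esub>}"
      using V VM by (simp add: simple_submodule_iff transport_zero_iff)
    fix W' assume W': "W' \<subseteq> f ` V \<and> submodule W' R N"
    then obtain W where W: "W \<subseteq> carrier M" "W' = f ` W" "submodule W R M"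
      using transport_submoduleE by blast
    have "W \<subseteq> V"
    proof
      fix w assume "w \<in> W"
      then have "w \<in> carrier M" "f w \<in> f ` V" using W W' by auto
      then show "w \<in> V" using inj_on_image_mem_iff[OF inj _ VM] by blast
    qed
    then show "W' = {\<zero>\<^bsub>N\<^esub>} \<or> W' = f ` V"
      using W V by (auto simp: simple_submodule_iff)
  qed
  moreover have "f ` V \<inter> W' \<noteq> {\<zero>\<^bsub>N\<^esub>}" if W': "submodule W' R N" "W' \<noteq> {\<zero>\<^bsub>N\<^esub>}" for W'
  proof -
    obtain W where W: "W \<subseteq> carrier M" "W' = f ` W" "submodule W R M"
      using transport_submoduleE W'(1) by blast
    then have "V \<inter> W \<noteq> {\<zero>\<^bsub>M\<^esub>}" using ess W'(2) by auto
    then have "f ` (V \<inter> W) \<noteq> {f \<zero>\<^bsub>M\<^esub>}" using W(1) by (subst transport_zero_iff) auto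
    moreover have "f ` (V \<inter> W) = f ` V \<inter> W'"
      using W VM inj by (simp add: inj_on_image_Int)
    ultimately show ?thesis by simp
  qed
  ultimately show ?thesis
    using V' N.left_module_axioms
    by (auto simp: essential_extension_of_simple_def essential_submodule_def)
qed

lemma transport_artinian:
  assumes "artinian_module R N"
  shows "artinian_module R M"
  unfolding artinian_module_def
proof (intro conjI allI impI)
  show "left_module R M" by (rule left_module_axioms)
  fix W :: "nat \<Rightarrow> 'm set"
  assume W: "(\<forall>i. submodule (W i) R M) \<and> (\<forall>i. W (Suc i) \<subseteq> W i)"
  then have WM: "W i \<subseteq> carrier M" for i by (auto simp: submodule_iff)
  have "(\<forall>i. submodule (f ` W i) R N) \<and> (\<forall>i. f ` W (Suc i) \<subseteq> f ` W i)"
    using W WM by (simp add: transport_submodule image_mono)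
  then have "\<exists>n. \<forall>i\<ge>n. f ` W i = f ` W n"
    using assms unfolding artinian_module_def by (elim conjE allE[of _ "\<lambda>i. f ` W i"]) auto
  then show "\<exists>n. \<forall>i\<ge>n. W i = W n"
    using transport_image_eq_iff[OF WM WM] by simp
qed

end

end

text \<open>The type of the module elements in the definition of \<^const>\<open>diamond\<close> is immaterial.\<close>

theorem diamond_all_types:
  fixes M :: "('s, 'm, 'd) module_scheme"
  assumes "diamond S" and "cyclic_module S M" and "essential_extension_of_simple S M"
  shows "artinian_module S M"
proof -
  interpret left_module S M using assms(2) by (simp add: cyclic_module_def)
  obtain x where x: "x \<in> carrier M" "carrier M = {s \<odot>\<^bsub>M\<^esub> x | s. s \<in> carrier S}"
    using assms(2) by (auto simp: cyclic_module_def)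
  define f where "f = (\<lambda>y. {s \<in> carrier S. s \<odot>\<^bsub>M\<^esub> x = y})"
  have inj: "inj_on f (carrier M)"
  proof (rule inj_onI)
    fix y z assume y: "y \<in> carrier M" and eq: "f y = f z"
    obtain s where "s \<in> carrier S" "y = s \<odot>\<^bsub>M\<^esub> x" using y x(2) by auto
    then have "s \<in> f y" by (simp add: f_def)
    then show "y = z" unfolding eq using \<open>y = s \<odot>\<^bsub>M\<^esub> x\<close> by (simp add: f_def)
  qed
  have "artinian_module S (transport_module f M)"
    using assms(1) transport_cyclic[OF inj refl assms(2)]
      transport_essential_extension[OF inj refl assms(3)]
    by (simp add: diamond_def)
  then show ?thesis by (rule transport_artinian[OF inj refl])
qed

end

theory Submission
  imports Defs "HOL-Algebra.Ring_Divisibility" "HOL-Algebra.Ideal_Product" "HOL-Algebra.Finite_Extensions"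
begin

text \<open>Write \<open>S = R[\<theta>;\<delta>]\<close>.

  \<^bold>\<open>Primitivity.\<close> Choose \<open>a\<close> with \<open>\<delta> a \<noteq> 0\<close>. Descending along a finite set of generators, only finitely
  many of the elements \<open>a - n\<close> with \<open>n \<in> \<nat>\<close> divide a power of \<open>\<delta> a\<close>; for any other \<open>n\<close> some prime, hence
  maximal, ideal \<open>M\<close> contains \<open>a - n\<close> but not \<open>\<delta> (a - n) = \<delta> a\<close>, and no non-zero \<open>\<delta>\<close>-ideal lies in \<open>M\<close>.

  \<^bold>\<open>\<open>(\<diamond>)\<close> implies \<open>\<delta>\<close>-simple.\<close> For this \<open>M\<close> the left ideal \<open>SM\<close> is maximal and
  \<open>S/SM\<theta>\<close> is an essential extension of \<open>S\<theta>/SM\<theta> \<cong> S/SM\<close>: a left ideal violating this would meet \<open>R\<close> in a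
  \<open>\<delta>\<close>-ideal inside \<open>M\<close>. The quotient \<open>S/S\<theta> \<cong> R\<close> is not Artinian if \<open>R\<close> has a proper non-zero
  \<open>\<delta>\<close>-ideal \<open>J\<close>, because of the powers of \<open>J\<close>.

  \<^bold>\<open>\<open>\<delta>\<close>-simple implies \<open>(\<diamond>)\<close>.\<close> Every proper cyclic module \<open>S/L\<close> is Artinian: in a
  descending chain of left ideals above \<open>L\<close> the ideals of leading coefficients stabilize, since \<open>R/I\<close> is
  Artinian for \<open>I \<noteq> 0\<close>, and so do the least degrees. Two left ideals agreeing in both respects differ by
  a module with a non-zero annihilator in \<open>R\<close>; the annihilator is a \<open>\<delta>\<close>-ideal, so they are equal. And
  \<open>S\<close> itself has no simple left ideal.\<close>

section \<open>Noetherian rings\<close>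

text \<open>That \<open>a - n\<close> divides a power of \<open>c\<close> means that every prime
  containing \<open>a - n\<close> contains \<open>c\<close>. The finiteness of such \<open>n\<close>
  passes from a subring \<open>B\<close> to \<open>B[y]\<close> as soon as each non-zero
  \<open>c\<close> in \<open>B[y]\<close> can be traded for one non-zero \<open>b\<close> in
  \<open>B\<close>. So the argument involves neither normality of \<open>R\<close> nor finiteness
  over a polynomial ring, and the intermediate rings need not be stable under \<delta>. Within it
  the derivation acts only at the bottom: in characteristic zero \<delta> a \<noteq> 0 makes
  \<open>a\<close> transcendental, so \<open>K[a]\<close> is a polynomial ring. The natural numbers
  supply infinitely many constants whose non-zero differences are units.

  For the operators everything rests on \<open>\<theta> a - a \<theta> = \<delta>(a)\<close>. It
  makes the annihilator of a quotient of left ideals a \<delta>-ideal, and the coefficient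
  \<open>n\<close> in \<open>\<theta>^n a = a \<theta>^n + n \<delta>(a) \<theta>^(n-1) +
  ...\<close> is where characteristic zero is used again.\<close>

lemma (in cring) ideal_iff:
  "ideal I R \<longleftrightarrow> I \<subseteq> carrier R \<and> \<zero> \<in> I \<and> (\<forall>x\<in>I. \<forall>y\<in>I. x \<oplus> y \<in> I) \<and>
     (\<forall>r\<in>carrier R. \<forall>x\<in>I. r \<otimes> x \<in> I)"
proof
  assume "ideal I R"
  then interpret ideal I R .
  show "I \<subseteq> carrier R \<and> \<zero> \<in> I \<and> (\<forall>x\<in>I. \<forall>y\<in>I. x \<oplus> y \<in> I) \<and> (\<forall>r\<in>carrier R. \<forall>x\<in>I. r \<otimes> x \<in> I)"
    using I_l_closed a_subset by auto
next
  assume I: "I \<subseteq> carrier R \<and> \<zero> \<in> I \<and> (\<forall>x\<in>I. \<forall>y\<in>I. x \<oplus> y \<in> I) \<and> (\<forall>r\<in>carrier R. \<forall>x\<in>I. r \<otimes> x \<in> I)"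
  have neg: "\<ominus> x \<in> I" if "x \<in> I" for x
  proof -
    have "(\<ominus> \<one>) \<otimes> x \<in> I" "x \<in> carrier R" using I that by auto
    then show ?thesis by (simp add: l_minus)
  qed
  show "ideal I R"
  proof (rule idealI[OF ring_axioms])
    show "subgroup I (add_monoid R)"
      by unfold_locales (use I neg in \<open>auto simp flip: a_inv_def\<close>)
    fix a x assume a: "a \<in> I" and x: "x \<in> carrier R"
    then have ac: "a \<in> carrier R" using I by auto
    show "x \<otimes> a \<in> I" using I a x by blast
    then show "a \<otimes> x \<in> I" using m_comm[OF ac x] by simp
  qed
qed

lemma (in ideal) add_mem: "x \<in> I \<Longrightarrow> y \<in> I \<Longrightarrow> x \<oplus> y \<in> I"
  by (rule additive_subgroup.a_closed[OF is_additive_subgroup])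

lemma (in ideal) minus_mem: "x \<in> I \<Longrightarrow> y \<in> I \<Longrightarrow> x \<ominus> y \<in> I"
  by (simp add: a_minus_def add_mem)

definition ideal_plus :: "('a, 'd) ring_scheme \<Rightarrow> 'a set \<Rightarrow> 'a \<Rightarrow> 'a set" where
  "ideal_plus R I a = {i \<oplus>\<^bsub>R\<^esub> r \<otimes>\<^bsub>R\<^esub> a | i r. i \<in> I \<and> r \<in> carrier R}"

lemma (in cring) ideal_plus_ideal:
  assumes I: "ideal I R" and a: "a \<in> carrier R"
  shows "ideal (ideal_plus R I a) R"
proof -
  interpret ideal I R by fact
  note I' = I[unfolded ideal_iff]
  show ?thesis
    unfolding ideal_iff
  proof (intro conjI ballI)
    show "ideal_plus R I a \<subseteq> carrier R" using Icarr a by (auto simp: ideal_plus_def)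
    show "\<zero> \<in> ideal_plus R I a"
      unfolding ideal_plus_def using a by (auto intro!: exI[of _ \<zero>])
  next
    fix x y assume "x \<in> ideal_plus R I a" "y \<in> ideal_plus R I a"
    then obtain i r j s where h: "i \<in> I" "j \<in> I" "r \<in> carrier R" "s \<in> carrier R"
      "x = i \<oplus> r \<otimes> a" "y = j \<oplus> s \<otimes> a" by (auto simp: ideal_plus_def)
    have "x \<oplus> y = (i \<oplus> j) \<oplus> (r \<oplus> s) \<otimes> a" using h a Icarr[OF h(1)] Icarr[OF h(2)] by algebra
    then show "x \<oplus> y \<in> ideal_plus R I a" unfolding ideal_plus_def using h by blast
  next
    fix t x assume t: "t \<in> carrier R" and "x \<in> ideal_plus R I a"
    then obtain i r where h: "i \<in> I" "r \<in> carrier R" "x = i \<oplus> r \<otimes> a" by (auto simp: ideal_plus_def)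
    have "t \<otimes> x = t \<otimes> i \<oplus> (t \<otimes> r) \<otimes> a" using h a t Icarr[OF h(1)] by algebra
    then show "t \<otimes> x \<in> ideal_plus R I a" unfolding ideal_plus_def using h t I_l_closed by blast
  qed
qed

lemma (in cring) ideal_plus_incl:
  assumes I: "ideal I R" and a: "a \<in> carrier R"
  shows "I \<subseteq> ideal_plus R I a" "a \<in> ideal_plus R I a"
proof -
  interpret ideal I R by fact
  show "I \<subseteq> ideal_plus R I a"
  proof
    fix i assume "i \<in> I"
    then show "i \<in> ideal_plus R I a"
      unfolding ideal_plus_def using a Icarr[of i]
      by (intro CollectI exI[of _ i] exI[of _ \<zero>]) auto
  qed
  show "a \<in> ideal_plus R I a"
    unfolding ideal_plus_def using a by (intro CollectI exI[of _ \<zero>] exI[of _ \<one>]) auto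
qed

lemma ideal_plus_mono: "I \<subseteq> J \<Longrightarrow> ideal_plus R I a \<subseteq> ideal_plus R J a"
  unfolding ideal_plus_def by blast

text \<open>Noetherian induction for ideals, applied to hypothetical counterexamples and to ideals
  avoiding a set. The upper bound for Zorn's lemma is the union of the chain, which in a Noetherian
  ring already belongs to the chain.\<close>

lemma (in noetherian_ring) maximal_ideal_with_property:
  assumes "ideal I R" "Q I"
  obtains M where "ideal M R" "Q M" "\<And>J. ideal J R \<Longrightarrow> Q J \<Longrightarrow> M \<subseteq> J \<Longrightarrow> J = M"
proof -
  let ?F = "{I. ideal I R \<and> Q I}"
  have "\<exists>M\<in>?F. \<forall>Z\<in>?F. M \<subseteq> Z \<longrightarrow> Z = M"
  proof (rule subset_Zorn)
    fix C assume C: "subset.chain ?F C"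
    show "\<exists>U\<in>?F. \<forall>Z\<in>C. Z \<subseteq> U"
    proof (cases "C = {}")
      case True then show ?thesis using assms by auto
    next
      case False
      have "subset.chain {I. ideal I R} C" using C unfolding pred_on.chain_def by auto
      then have "\<Union>C \<in> C" using ideal_chain_is_trivial False by blast
      then show ?thesis using C unfolding pred_on.chain_def by (meson Union_upper subsetD)
    qed
  qed
  then show thesis using that by blast
qed

text \<open>An ideal maximal among those that contain \<open>I\<close> and avoid \<open>T\<close> is
  prime: for \<open>a\<close> and \<open>b\<close> outside it both enlarged ideals meet
  \<open>T\<close>, and the product of the two elements found lies in \<open>T\<close>, yet also in
  the ideal if \<open>a b\<close> does.\<close>

lemma noetherian_prime_avoidance:
  fixes R (structure)
  assumes "cring R" "noetherian_ring R" "ideal I R" and T: "\<one>\<^bsub>R\<^esub> \<in> T" "T \<subseteq> carrier R"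
    "\<And>s t. s \<in> T \<Longrightarrow> t \<in> T \<Longrightarrow> s \<otimes>\<^bsub>R\<^esub> t \<in> T" and disj: "I \<inter> T = {}"
  obtains P where "primeideal P R" "I \<subseteq> P" "P \<inter> T = {}"
proof -
  interpret cring R by fact
  interpret N: noetherian_ring R by fact
  obtain M where M: "ideal M R" "I \<subseteq> M" "M \<inter> T = {}"
    and max: "\<And>J. ideal J R \<Longrightarrow> M \<subseteq> J \<Longrightarrow> J \<inter> T = {} \<Longrightarrow> J = M"
    using N.maximal_ideal_with_property[of I "\<lambda>J. I \<subseteq> J \<and> J \<inter> T = {}", OF assms(3)] disj
    by (metis order.refl order.trans)
  interpret M: ideal M R by fact
  have meet: "\<exists>m\<in>M. \<exists>r\<in>carrier R. m \<oplus> r \<otimes> a \<in> T" if a: "a \<in> carrier R" "a \<notin> M" for a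
  proof -
    have "ideal_plus R M a \<inter> T \<noteq> {}"
      using max[OF ideal_plus_ideal[OF M(1) a(1)]] ideal_plus_incl[OF M(1) a(1)] a(2) by blast
    then show ?thesis by (auto simp: ideal_plus_def)
  qed
  have "primeideal M R"
  proof (rule primeidealI[OF M(1) is_cring])
    show "carrier R \<noteq> M" using T M by auto
    fix a b assume ab: "a \<in> carrier R" "b \<in> carrier R" "a \<otimes> b \<in> M"
    show "a \<in> M \<or> b \<in> M"
    proof (rule ccontr)
      assume "\<not> (a \<in> M \<or> b \<in> M)"
      then obtain m r n s where h: "m \<in> M" "r \<in> carrier R" "m \<oplus> r \<otimes> a \<in> T"
        "n \<in> M" "s \<in> carrier R" "n \<oplus> s \<otimes> b \<in> T" using meet ab by metis
      have "(m \<oplus> r \<otimes> a) \<otimes> (n \<oplus> s \<otimes> b) = (n \<oplus> s \<otimes> b) \<otimes> m \<oplus> ((r \<otimes> a) \<otimes> n \<oplus> (r \<otimes> s) \<otimes> (a \<otimes> b))"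
        using h ab M.Icarr[OF h(1)] M.Icarr[OF h(4)] by algebra
      moreover have "(n \<oplus> s \<otimes> b) \<otimes> m \<in> M" "(r \<otimes> a) \<otimes> n \<in> M" "(r \<otimes> s) \<otimes> (a \<otimes> b) \<in> M"
        using h ab M.Icarr[OF h(4)] M.I_l_closed by auto
      ultimately have "(m \<oplus> r \<otimes> a) \<otimes> (n \<oplus> s \<otimes> b) \<in> M"
        using M.add_mem by simp
      then show False using T(3)[OF h(3) h(6)] M(3) by blast
    qed
  qed
  then show thesis using that M by blast
qed

text \<open>Noetherian induction on \<open>I\<close>. A non-prime \<open>I\<close> contains some \<open>ab\<close> with \<open>a, b \<notin> I\<close>; the chain is then
  controlled by its images in \<open>R/(I + Ra)\<close> and in \<open>R/(I : a) \<cong> (I + Ra)/I\<close>.\<close>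

lemma (in noetherian_domain) dcc_above_nonzero_ideal:
  assumes dim: "\<And>P. primeideal P R \<Longrightarrow> P \<noteq> {\<zero>} \<Longrightarrow> maximalideal P R"
    and I: "ideal I R" "I \<noteq> {\<zero>}"
    and W: "\<And>i::nat. ideal (W i) R" "\<And>i. W (Suc i) \<subseteq> W i" "\<And>i. I \<subseteq> W i"
  shows "\<exists>n. \<forall>i\<ge>n. W i = W n"
proof -
  define dcc where "dcc I \<longleftrightarrow> (\<forall>W. (\<forall>i::nat. ideal (W i) R) \<and> (\<forall>i. W (Suc i) \<subseteq> W i) \<and> (\<forall>i. I \<subseteq> W i)
     \<longrightarrow> (\<exists>n. \<forall>i\<ge>n. W i = W n))" for I
  have "dcc I"
  proof (rule ccontr)
    assume "\<not> dcc I"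
    then obtain I where I: "ideal I R" "I \<noteq> {\<zero>}" "\<not> dcc I"
      and max: "\<And>J. ideal J R \<Longrightarrow> J \<noteq> {\<zero>} \<Longrightarrow> \<not> dcc J \<Longrightarrow> I \<subseteq> J \<Longrightarrow> J = I"
      using maximal_ideal_with_property[of I "\<lambda>J. J \<noteq> {\<zero>} \<and> \<not> dcc J", OF I(1)] I(2) by metis
    interpret I: ideal I R by fact
    have I0: "\<not> J \<subseteq> {\<zero>}" if "I \<subseteq> J" for J using I(2) that I.zero_closed by auto
    have bigger: "dcc J" if "ideal J R" "I \<subset> J" for J
      using max[of J] that I0[of J] by blast
    \<comment> \<open>Settles the case of a maximal \<open>I\<close>: above it only \<open>I\<close>
      and \<open>R\<close> occur, and a descending sequence with two comparable values is eventually
      constant.\<close>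
    have triv: "\<exists>n. \<forall>i\<ge>n. W i = W n"
      if anti: "\<And>i. W (Suc i) \<subseteq> W i" and two: "\<And>i. W i = A \<or> W i = B" and AB: "A \<subseteq> B"
      for W :: "nat \<Rightarrow> 'a set" and A B
    proof (cases "\<exists>n. W n = A")
      case True
      then obtain n where n: "W n = A" by auto
      have "W i = A" if "i \<ge> n" for i
        using that
      proof (induct i rule: dec_induct)
        case (step i)
        then have "W (Suc i) \<subseteq> A" using anti[of i] by simp
        then show ?case using two[of "Suc i"] AB by auto
      qed (rule n)
      then show ?thesis using n by auto
    next
      case False
      then have "W i = B" for i using two[of i] by auto
      then show ?thesis by simp
    qed
    have "primeideal I R"
    proof (rule ccontr)
      assume "\<not> primeideal I R"
      moreover have "carrier R \<noteq> I"
      proof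
        assume "carrier R = I"
        then have eq: "V = I" if "ideal V R" "I \<subseteq> V" for V
          using ideal.Icarr[OF that(1)] that(2) by blast
        have "dcc I" unfolding dcc_def
        proof (intro allI impI exI[of _ 0], elim conjE)
          fix W :: "nat \<Rightarrow> 'a set" and i
          assume "\<forall>i. ideal (W i) R" "\<forall>i. I \<subseteq> W i"
          then show "W i = W 0" using eq[of "W i"] eq[of "W 0"] by simp
        qed
        then show False using I(3) by blast
      qed
      ultimately obtain a b where ab: "a \<in> carrier R" "b \<in> carrier R" "a \<otimes> b \<in> I" "a \<notin> I" "b \<notin> I"
        using primeidealI[OF I(1) is_cring] by blast
      define J where "J = {r \<in> carrier R. r \<otimes> a \<in> I}"
      have res_ideal: "ideal {r \<in> carrier R. r \<otimes> a \<in> V} R" if "ideal V R" for V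
      proof -
        interpret V: ideal V R by fact
        show ?thesis unfolding ideal_iff using ab(1) V.I_l_closed by (auto simp: l_distr m_assoc)
      qed
      have "b \<in> J" using ab by (simp add: J_def m_comm)
      moreover have "I \<subseteq> J" using I.Icarr I.I_r_closed ab by (auto simp: J_def)
      ultimately have J: "dcc J" using bigger[of J] res_ideal[OF I(1)] ab unfolding J_def by blast
      have Ia: "dcc (ideal_plus R I a)"
        using bigger ideal_plus_ideal[OF I(1) ab(1)] ideal_plus_incl[OF I(1) ab(1)] ab(4) by blast
      have "dcc I" unfolding dcc_def
      proof (intro allI impI, elim conjE)
        fix W :: "nat \<Rightarrow> 'a set"
        assume W: "\<forall>i. ideal (W i) R" "\<forall>i. W (Suc i) \<subseteq> W i" "\<forall>i. I \<subseteq> W i"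
        define U where "U i = {r \<in> carrier R. r \<otimes> a \<in> W i}" for i
        have "ideal (U i) R" "U (Suc i) \<subseteq> U i" "J \<subseteq> U i" for i
          using W res_ideal[of "W i"] by (auto simp: U_def J_def)
        then obtain n1 where n1: "\<And>i. i \<ge> n1 \<Longrightarrow> U i = U n1" using J unfolding dcc_def by meson
        define V where "V i = ideal_plus R (W i) a" for i
        have "ideal (V i) R" "V (Suc i) \<subseteq> V i" "ideal_plus R I a \<subseteq> V i" for i
          using W ideal_plus_ideal[of "W i" a] ab ideal_plus_mono unfolding V_def by metis+
        then obtain n2 where n2: "\<And>i. i \<ge> n2 \<Longrightarrow> V i = V n2" using Ia unfolding dcc_def by meson
        let ?n = "max n1 n2"
        have anti: "W i \<subseteq> W ?n" if "i \<ge> ?n" for i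
          using lift_Suc_antimono_le[of W ?n i] W(2) that by blast
        have "W ?n \<subseteq> W i" if i: "i \<ge> ?n" for i
        proof
          fix x assume x: "x \<in> W ?n"
          interpret Wn: ideal "W ?n" R using W by blast
          interpret Wi: ideal "W i" R using W by blast
          \<comment> \<open>The modular law for \<open>W i\<close>, \<open>W ?n\<close> and
            \<open>R a\<close>: equal sums with \<open>R a\<close> and equal quotients by
            \<open>a\<close> force the larger ideal into the smaller one.\<close>
          have "x \<in> V ?n" using x ideal_plus_incl(1)[of "W ?n" a] W ab unfolding V_def by blast
          then have "x \<in> V i" using n2[of i] n2[of ?n] i by simp
          then obtain w r where wr: "w \<in> W i" "r \<in> carrier R" "x = w \<oplus> r \<otimes> a"
            by (auto simp: V_def ideal_plus_def)
          have "w \<in> W ?n" using anti[OF i] wr by blast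
          moreover have "r \<otimes> a = x \<ominus> w" using wr Wi.Icarr[OF wr(1)] ab by algebra
          ultimately have "r \<otimes> a \<in> W ?n" using x Wn.minus_mem by simp
          then have "r \<in> U ?n" using wr by (simp add: U_def)
          then have "r \<in> U i" using n1[of i] n1[of ?n] i by simp
          then show "x \<in> W i" using wr by (simp add: U_def)
        qed
        then show "\<exists>n. \<forall>i\<ge>n. W i = W n" using anti by (intro exI[of _ ?n]) blast
      qed
      then show False using I(3) by blast
    qed
    then have "maximalideal I R" using dim I by blast
    then have two: "V = I \<or> V = carrier R" if "ideal V R" "I \<subseteq> V" for V
      using maximalideal.I_maximal that ideal.Icarr[OF that(1)] by (metis subsetI)
    have "dcc I" unfolding dcc_def
    proof (intro allI impI, elim conjE)
      fix W :: "nat \<Rightarrow> 'a set"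
      assume W: "\<forall>i. ideal (W i) R" "\<forall>i. W (Suc i) \<subseteq> W i" "\<forall>i. I \<subseteq> W i"
      show "\<exists>n. \<forall>i\<ge>n. W i = W n"
        by (rule triv[of _ I "carrier R"]) (use W two I.a_subset in auto)
    qed
    then show False using I(3) by blast
  qed
  then show ?thesis unfolding dcc_def using W by metis
qed

text \<open>Generators of \<open>I\<close> are eliminated one at a time while keeping some
  \<open>e\<close> congruent to 1 modulo \<open>J\<close> with \<open>e I\<close> inside the ideal
  of the remaining ones. In the end \<open>e I = 0\<close>; as \<open>J\<close> is proper,
  \<open>e\<close> is not zero, and in a domain \<open>I\<close> vanishes.\<close>

lemma (in noetherian_domain) nakayama:
  assumes I: "ideal I R" and J: "ideal J R" "J \<noteq> carrier R" and IJ: "I \<subseteq> I \<cdot> J"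
  shows "I = {\<zero>}"
proof -
  interpret I: ideal I R by fact
  interpret J: ideal J R by fact
  obtain G where G: "G \<subseteq> carrier R" "finite G" "I = Idl G" using finetely_gen[OF I] by auto
  have Idl_insert: "Idl (insert g G) \<subseteq> ideal_plus R (Idl G) g"
    if "g \<in> carrier R" "G \<subseteq> carrier R" for g G
  proof (rule genideal_minimal)
    note id = genideal_ideal[OF that(2)]
    show "ideal (ideal_plus R (Idl G) g) R" by (rule ideal_plus_ideal[OF id that(1)])
    show "insert g G \<subseteq> ideal_plus R (Idl G) g"
      using ideal_plus_incl[OF id that(1)] genideal_self[OF that(2)] by auto
  qed
  have main: "\<exists>e\<in>carrier R. \<one> \<ominus> e \<in> J \<and> (\<forall>x\<in>I. e \<otimes> x = \<zero>)"
    if "finite G" "G \<subseteq> I" "e \<in> carrier R" "\<one> \<ominus> e \<in> J" "\<forall>x\<in>I. e \<otimes> x \<in> Idl G" for G e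
    using that
  proof (induct G arbitrary: e)
    case empty
    have "Idl {} \<subseteq> {\<zero>}" by (rule genideal_minimal) (auto simp: zeroideal)
    then show ?case using empty by blast
  next
    case (insert g G)
    have gc: "g \<in> carrier R" "G \<subseteq> carrier R" using insert I.Icarr by auto
    interpret G: ideal "Idl G" R using genideal_ideal gc by blast
    \<comment> \<open>A factor from \<open>J\<close> puts the coefficient of \<open>g\<close> into
      \<open>J\<close>. Applied to \<open>g\<close> itself, which lies in \<open>I J\<close>, this
      places \<open>(e - j) g\<close> in the ideal generated by \<open>G\<close>, and
      \<open>(e - j) e\<close> is the next multiplier.\<close>
    have step: "\<exists>j\<in>J. \<exists>h\<in>Idl G. e \<otimes> x = h \<oplus> j \<otimes> g" if "x \<in> I \<cdot> J" for x
      using that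
    proof (induct x rule: ideal_prod.induct)
      case (prod i j)
      have "e \<otimes> i \<in> ideal_plus R (Idl G) g" using insert prod Idl_insert gc by blast
      then obtain h r where h: "h \<in> Idl G" "r \<in> carrier R" "e \<otimes> i = h \<oplus> r \<otimes> g"
        by (auto simp: ideal_plus_def)
      have c: "i \<in> carrier R" "j \<in> carrier R" "h \<in> carrier R" using prod I.Icarr J.Icarr h G.Icarr by auto
      have "e \<otimes> (i \<otimes> j) = (e \<otimes> i) \<otimes> j" using c insert by algebra
      also have "\<dots> = j \<otimes> h \<oplus> (r \<otimes> j) \<otimes> g" unfolding h(3) using c h gc by algebra
      finally show ?case using c h prod J.I_l_closed G.I_l_closed by blast
    next
      case (sum s t)
      obtain j h j' h' where hh: "j \<in> J" "h \<in> Idl G" "e \<otimes> s = h \<oplus> j \<otimes> g" "j' \<in> J" "h' \<in> Idl G" "e \<otimes> t = h' \<oplus> j' \<otimes> g"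
        using sum by blast
      have c: "s \<in> carrier R" "t \<in> carrier R" using sum ideal_prod_in_carrier[OF I J(1)] by auto
      have "e \<otimes> (s \<oplus> t) = (h \<oplus> h') \<oplus> (j \<oplus> j') \<otimes> g"
        using hh c insert gc G.Icarr[OF hh(2)] G.Icarr[OF hh(5)] J.Icarr[OF hh(1)] J.Icarr[OF hh(4)]
        by (simp add: r_distr l_distr a_ac)
      then show ?case using hh by blast
    qed
    have "g \<in> I \<cdot> J" using insert.prems(1) IJ by auto
    from step[OF this] obtain j h where jh: "j \<in> J" "h \<in> Idl G" "e \<otimes> g = h \<oplus> j \<otimes> g"
      by blast
    have c: "j \<in> carrier R" "h \<in> carrier R" "e \<in> carrier R" using jh J.Icarr G.Icarr insert by auto
    define e' where "e' = (e \<ominus> j) \<otimes> e"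
    have eg: "(e \<ominus> j) \<otimes> g = h"
    proof -
      have "(e \<ominus> j) \<otimes> g = e \<otimes> g \<ominus> j \<otimes> g" using c gc by algebra
      also have "\<dots> = h" unfolding jh(3) using c gc by algebra
      finally show ?thesis .
    qed
    show ?case
    proof (rule insert.hyps(3)[of e'])
      show "e' \<in> carrier R" using c by (simp add: e'_def)
      have "\<one> \<ominus> e' = (\<one> \<ominus> e) \<oplus> (e \<otimes> (\<one> \<ominus> e) \<oplus> e \<otimes> j)" using c unfolding e'_def by algebra
      then show "\<one> \<ominus> e' \<in> J" using insert jh c J.I_l_closed by simp
      show "\<forall>x\<in>I. e' \<otimes> x \<in> Idl G"
      proof
        fix x assume x: "x \<in> I"
        have "e \<otimes> x \<in> ideal_plus R (Idl G) g" using insert x Idl_insert gc by blast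
        then obtain u r where u: "u \<in> Idl G" "r \<in> carrier R" "e \<otimes> x = u \<oplus> r \<otimes> g"
          by (auto simp: ideal_plus_def)
        have "e' \<otimes> x = (e \<ominus> j) \<otimes> (e \<otimes> x)" using c I.Icarr[OF x] unfolding e'_def by algebra
        also have "\<dots> = (e \<ominus> j) \<otimes> u \<oplus> r \<otimes> ((e \<ominus> j) \<otimes> g)" unfolding u(3) using c u gc G.Icarr[OF u(1)] by algebra
        also have "\<dots> \<in> Idl G" unfolding eg using u jh c by (intro G.add_mem G.I_l_closed) auto
        finally show "e' \<otimes> x \<in> Idl G" .
      qed
    qed (use insert in auto)
  qed
  have "\<exists>e\<in>carrier R. \<one> \<ominus> e \<in> J \<and> (\<forall>x\<in>I. e \<otimes> x = \<zero>)"
    using main[OF G(2), of \<one>] G genideal_self[OF G(1)] I.Icarr by (simp add: a_minus_def r_neg)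
  then obtain e where e: "e \<in> carrier R" "\<one> \<ominus> e \<in> J" "\<forall>x\<in>I. e \<otimes> x = \<zero>" by blast
  have "e \<noteq> \<zero>"
  proof
    assume "e = \<zero>"
    then have "\<one> \<in> J" using e(2) by (simp add: a_minus_def)
    then show False using J.one_imp_carrier J(2) by blast
  qed
  then have "\<forall>x\<in>I. x = \<zero>" using e integral I.Icarr by blast
  then show ?thesis using I.zero_closed by blast
qed

section \<open>Noetherian rings in terms of ascending sequences of ideals\<close>

lemma (in noetherian_ring) ideal_sequence_stabilizes:
  assumes "\<And>n::nat. ideal (I n) R" "\<And>n. I n \<subseteq> I (Suc n)"
  shows "\<exists>N. \<forall>n\<ge>N. I n = I N"
proof -
  obtain M where M: "ideal M R" "\<exists>n. M = I n" and max: "\<And>J. ideal J R \<Longrightarrow> \<exists>n. J = I n \<Longrightarrow> M \<subseteq> J \<Longrightarrow> J = M"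
    using maximal_ideal_with_property[of "I 0" "\<lambda>J. \<exists>n. J = I n", OF assms(1)] by blast
  obtain N where N: "M = I N" using M(2) by blast
  have stab: "I n = I N" if "n \<ge> N" for n
  proof -
    have "I N \<subseteq> I n" by (rule lift_Suc_mono_le[of I N n, OF assms(2) that])
    then show ?thesis using max[of "I n"] assms(1)[of n] N by metis
  qed
  show ?thesis by (intro exI[of _ N] allI impI) (rule stab)
qed

lemma (in ring) noetherian_ring_if_sequences_stabilize:
  assumes "\<And>I. (\<And>n::nat. ideal (I n) R) \<Longrightarrow> (\<And>n. I n \<subseteq> I (Suc n)) \<Longrightarrow> \<exists>N. \<forall>n\<ge>N. I n = I N"
  shows "noetherian_ring R"
proof (rule trivial_ideal_chain_imp_noetherian)
  fix C assume C: "C \<noteq> {}" "subset.chain {I. ideal I R} C"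
  show "\<Union>C \<in> C"
  proof (rule ccontr)
    assume notin: "\<Union>C \<notin> C"
    have "\<exists>J. J \<in> C \<and> I \<subset> J" if I: "I \<in> C" for I
    proof (rule ccontr)
      assume "\<not> (\<exists>J. J \<in> C \<and> I \<subset> J)"
      then have "J \<subseteq> I" if "J \<in> C" for J
        using C(2) I that unfolding subset_chain_def by (metis psubsetI subset_refl)
      then have "\<Union>C = I" using I by blast
      then show False using notin I by simp
    qed
    moreover have "\<exists>I. I \<in> C" using C(1) by blast
    ultimately have "\<exists>f. \<forall>n::nat. f n \<in> C \<and> f n \<subset> f (Suc n)"
      by (intro dependent_nat_choice) auto
    then obtain f :: "nat \<Rightarrow> 'a set" where "\<forall>n. f n \<in> C \<and> f n \<subset> f (Suc n)"
      by (elim exE)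
    then have f: "\<And>n. f n \<in> C" "\<And>n. f n \<subset> f (Suc n)" by simp_all
    have "ideal (f n) R" for n using f(1)[of n] C(2) unfolding subset_chain_def by auto
    moreover have "f n \<subseteq> f (Suc n)" for n using f(2)[of n] by simp
    ultimately have "\<exists>N. \<forall>n\<ge>N. f n = f N" by (rule assms)
    then obtain N where N: "\<forall>n\<ge>N. f n = f N" by (elim exE)
    have "f (Suc N) = f N" using N[rule_format, of "Suc N"] by simp
    then show False using f(2)[of N] by simp
  qed
qed

section \<open>Adjoining one element to a subring\<close>

text \<open>The elements that have an expression in \<open>x\<close> over \<open>B\<close> of degree
  less than \<open>n\<close>. As \<open>x\<close> may be algebraic over \<open>B\<close>,
  expressions are not unique: this is a filtration of \<open>B[x]\<close>, and degrees and leading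
  coefficients belong to expressions only. The strict bound leaves only 0 at level 0, where the
  inductions start.\<close>

primrec pow_span :: "('a, 'd) ring_scheme \<Rightarrow> 'a set \<Rightarrow> 'a \<Rightarrow> nat \<Rightarrow> 'a set" where
  "pow_span R B x 0 = {\<zero>\<^bsub>R\<^esub>}"
| "pow_span R B x (Suc n) = {y \<oplus>\<^bsub>R\<^esub> b \<otimes>\<^bsub>R\<^esub> x [^]\<^bsub>R\<^esub> n | y b. y \<in> pow_span R B x n \<and> b \<in> B}"

locale adjoin = domain R for R (structure) +
  fixes B :: "'a set" and x :: 'a
  assumes B: "subring B R" and x [simp, intro]: "x \<in> carrier R"
begin

abbreviation F :: "nat \<Rightarrow> 'a set" where "F \<equiv> pow_span R B x"

abbreviation C :: "'a set" where "C \<equiv> simple_extension B x"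

lemmas Bc [simp] = subsetD[OF subringE(1)[OF B]]
lemmas B_closed [simp] = subringE(2,3,5,6,7)[OF B]

lemma B_minus [simp]: "a \<in> B \<Longrightarrow> b \<in> B \<Longrightarrow> a \<ominus> b \<in> B"
  by (simp add: a_minus_def)

lemma B_pow [simp]: "a \<in> B \<Longrightarrow> a [^] (n::nat) \<in> B"
  by (induct n) auto

lemma xpow [simp]: "x [^] (n::nat) \<in> carrier R" by simp

lemma C_subring: "subring C R" by (rule simple_extension_is_subring[OF B x])

lemmas Cc [simp] = subsetD[OF subringE(1)[OF C_subring]]
lemmas C_closed [simp] = subringE(2,3,5,6,7)[OF C_subring]

lemma C_minus [simp]: "a \<in> C \<Longrightarrow> b \<in> C \<Longrightarrow> a \<ominus> b \<in> C"
  by (simp add: a_minus_def)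

lemma C_pow [simp]: "a \<in> C \<Longrightarrow> a [^] (n::nat) \<in> C"
  by (induct n) auto

lemma B_C [simp]: "b \<in> B \<Longrightarrow> b \<in> C" using simple_extension_incl[OF subringE(1)[OF B] x] by auto

lemma x_C [simp]: "x \<in> C" by (rule simple_extension_mem[OF B x])

lemma F_Suc_I: "y \<in> F n \<Longrightarrow> b \<in> B \<Longrightarrow> y \<oplus> b \<otimes> x [^] n \<in> F (Suc n)"
  by auto

lemma F_Suc_E:
  assumes "z \<in> F (Suc n)"
  obtains y b where "y \<in> F n" "b \<in> B" "z = y \<oplus> b \<otimes> x [^] n"
  using assms by auto

declare pow_span.simps(2) [simp del]

lemma F_C: "y \<in> F n \<Longrightarrow> y \<in> C"
  by (induct n arbitrary: y) (auto elim!: F_Suc_E)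

lemma Fc [simp]: "y \<in> F n \<Longrightarrow> y \<in> carrier R"
  using F_C by auto

lemma F_zero [simp]: "\<zero> \<in> F n"
proof (induct n)
  case (Suc n) then show ?case using F_Suc_I[OF Suc, of \<zero>] by simp
qed simp

lemma F_mono_Suc: "y \<in> F n \<Longrightarrow> y \<in> F (Suc n)"
  using F_Suc_I[of y n \<zero>] by simp

lemma F_mono: "y \<in> F n \<Longrightarrow> n \<le> m \<Longrightarrow> y \<in> F m"
  by (induct m) (auto simp: le_Suc_eq intro: F_mono_Suc)

lemma F_monom: "b \<in> B \<Longrightarrow> n < m \<Longrightarrow> b \<otimes> x [^] n \<in> F m"
  using F_mono[OF F_Suc_I[OF F_zero], of b n m] by simp

lemma F_const: "b \<in> B \<Longrightarrow> b \<in> F (Suc n)"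
  using F_monom[of b 0 "Suc n"] by simp

lemma F_add: "y \<in> F n \<Longrightarrow> z \<in> F n \<Longrightarrow> y \<oplus> z \<in> F n"
proof (induct n arbitrary: y z)
  case (Suc n)
  obtain y' b z' c where h: "y' \<in> F n" "b \<in> B" "y = y' \<oplus> b \<otimes> x [^] n" "z' \<in> F n" "c \<in> B" "z = z' \<oplus> c \<otimes> x [^] n"
    using Suc.prems by (metis F_Suc_E)
  have "y \<oplus> z = (y' \<oplus> z') \<oplus> (b \<oplus> c) \<otimes> x [^] n"
    using h by (simp add: l_distr a_ac)
  then show ?case using F_Suc_I[OF Suc.hyps[OF h(1,4)], of "b \<oplus> c"] h by simp
qed auto

lemma F_smult: "b \<in> B \<Longrightarrow> y \<in> F n \<Longrightarrow> b \<otimes> y \<in> F n"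
proof (induct n arbitrary: y)
  case (Suc n)
  obtain y' c where h: "y' \<in> F n" "c \<in> B" "y = y' \<oplus> c \<otimes> x [^] n"
    using Suc.prems by (metis F_Suc_E)
  have "b \<otimes> y = b \<otimes> y' \<oplus> (b \<otimes> c) \<otimes> x [^] n"
    using h Suc.prems by (simp add: r_distr m_assoc)
  then show ?case using F_Suc_I[OF Suc.hyps[OF Suc.prems(1) h(1)], of "b \<otimes> c"] h Suc.prems by simp
qed auto

lemma F_neg: "y \<in> F n \<Longrightarrow> \<ominus> y \<in> F n"
  using F_smult[of "\<ominus> \<one>" y n] by (simp add: l_minus)

lemma F_minus: "y \<in> F n \<Longrightarrow> z \<in> F n \<Longrightarrow> y \<ominus> z \<in> F n"
  by (simp add: a_minus_def F_add F_neg)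

lemma F_shift: "y \<in> F n \<Longrightarrow> x \<otimes> y \<in> F (Suc n)"
proof (induct n arbitrary: y)
  case 0 then show ?case using F_mono_Suc[of \<zero> 0] by simp
next
  case (Suc n)
  obtain y' c where h: "y' \<in> F n" "c \<in> B" "y = y' \<oplus> c \<otimes> x [^] n"
    using Suc.prems by (metis F_Suc_E)
  have "x \<otimes> y = x \<otimes> y' \<oplus> c \<otimes> x [^] Suc n"
    using h nat_pow_Suc2[of x n] by (simp add: r_distr m_lcomm del: nat_pow_Suc)
  then show ?case using F_Suc_I[OF Suc.hyps[OF h(1)] h(2)] by (simp del: nat_pow_Suc)
qed

lemma F_shift_pow: "y \<in> F n \<Longrightarrow> x [^] k \<otimes> y \<in> F (k + n)"
proof (induct k)
  case (Suc k)
  have "x [^] Suc k \<otimes> y = x \<otimes> (x [^] k \<otimes> y)"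
    using Suc.prems nat_pow_Suc2[of x k] by (simp add: m_assoc del: nat_pow_Suc)
  then show ?case using F_shift[OF Suc.hyps[OF Suc.prems]] by simp
qed simp

lemma F_mult: "y \<in> F m \<Longrightarrow> z \<in> F n \<Longrightarrow> y \<otimes> z \<in> F (m + n)"
proof (induct m arbitrary: y)
  case (Suc m)
  obtain y' c where h: "y' \<in> F m" "c \<in> B" "y = y' \<oplus> c \<otimes> x [^] m"
    using Suc.prems by (metis F_Suc_E)
  have "y \<otimes> z = y' \<otimes> z \<oplus> c \<otimes> (x [^] m \<otimes> z)"
    using h Suc.prems by (simp add: l_distr m_assoc)
  moreover have "y' \<otimes> z \<in> F (Suc m + n)"
    using F_mono_Suc[OF Suc.hyps[OF h(1) Suc.prems(2)]] by simp
  moreover have "c \<otimes> (x [^] m \<otimes> z) \<in> F (Suc m + n)"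
    using F_mono_Suc[OF F_smult[OF h(2) F_shift_pow[OF Suc.prems(2), of m]]] by simp
  ultimately show ?case using F_add by simp
qed auto

lemma C_F:
  assumes "z \<in> C" obtains n where "z \<in> F n"
proof -
  have "\<exists>n. z \<in> F n" using assms
  proof (induct z rule: simple_extension.induct)
    case zero then show ?case using F_zero by blast
  next
    case (lin k1 k2)
    then obtain n where n: "k1 \<in> F n" by blast
    then have "k1 \<otimes> x = x \<otimes> k1" by (simp add: m_comm)
    then have "k1 \<otimes> x \<oplus> k2 \<in> F (Suc n)"
      using F_add[OF F_shift[OF n] F_const[OF lin(3)]] by simp
    then show ?case by blast
  qed
  then show thesis using that by blast
qed

lemma leading_term_F:
  assumes "z \<in> F n" "z \<noteq> \<zero>"
  obtains r u y where "r < n" "u \<in> B" "u \<noteq> \<zero>" "y \<in> F r" "z = u \<otimes> x [^] r \<oplus> y"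
proof -
  have "\<exists>r u y. r < n \<and> u \<in> B \<and> u \<noteq> \<zero> \<and> y \<in> F r \<and> z = u \<otimes> x [^] r \<oplus> y"
    using assms
  proof (induct n arbitrary: z)
    case (Suc n)
    obtain y u where h: "y \<in> F n" "u \<in> B" "z = y \<oplus> u \<otimes> x [^] n" using Suc.prems by (metis F_Suc_E)
    show ?case
    proof (cases "u = \<zero>")
      case True
      then have "z = y" using h by simp
      then show ?thesis using Suc.hyps[of z] h(1) Suc.prems(2) less_SucI by metis
    next
      case False
      then show ?thesis using h by (metis Bc Fc a_comm m_closed xpow lessI)
    qed
  qed simp
  then show thesis using that by blast
qed

lemma leading_term:
  assumes "z \<in> C" "z \<noteq> \<zero>"
  obtains r u y where "u \<in> B" "u \<noteq> \<zero>" "y \<in> F r" "z = u \<otimes> x [^] r \<oplus> y"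
  using C_F[OF assms(1)] leading_term_F[OF _ assms(2)] by metis

lemma F_lead_mult:
  assumes "u \<in> B" "y \<in> F i" "v \<in> B" "z \<in> F j"
  shows "\<exists>w\<in>F (i + j). (u \<otimes> x [^] i \<oplus> y) \<otimes> (v \<otimes> x [^] j \<oplus> z) = (u \<otimes> v) \<otimes> x [^] (i + j) \<oplus> w"
proof -
  define w where "w = u \<otimes> (x [^] i \<otimes> z) \<oplus> (v \<otimes> (x [^] j \<otimes> y) \<oplus> y \<otimes> z)"
  have "w \<in> F (i + j)"
    unfolding w_def using assms F_shift_pow[of z j i] F_shift_pow[of y i j] F_mult[of y i z j]
    by (simp add: F_add F_smult add.commute)
  moreover have "(u \<otimes> x [^] i \<oplus> y) \<otimes> (v \<otimes> x [^] j \<oplus> z) = (u \<otimes> v) \<otimes> (x [^] i \<otimes> x [^] j) \<oplus> w"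
  proof -
    have c: "u \<in> carrier R" "v \<in> carrier R" "y \<in> carrier R" "z \<in> carrier R" "x [^] i \<in> carrier R" "x [^] j \<in> carrier R"
      using assms by auto
    then show ?thesis unfolding w_def by algebra
  qed
  ultimately show ?thesis by (auto simp: nat_pow_mult)
qed

lemma F_Suc_low:
  assumes "z \<in> F (Suc n)" obtains b w where "b \<in> B" "w \<in> F n" "z = b \<oplus> x \<otimes> w"
proof -
  have "\<exists>b\<in>B. \<exists>w\<in>F n. z = b \<oplus> x \<otimes> w" using assms
  proof (induct n arbitrary: z)
    case 0
    then obtain b where "b \<in> B" "z = b" by (auto elim!: F_Suc_E)
    then show ?case by (intro bexI[of _ z] bexI[of _ \<zero>]) auto
  next
    case (Suc n)
    obtain y u where h: "y \<in> F (Suc n)" "u \<in> B" "z = y \<oplus> u \<otimes> x [^] Suc n" using Suc.prems by (metis F_Suc_E)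
    obtain b w where bw: "b \<in> B" "w \<in> F n" "y = b \<oplus> x \<otimes> w" using Suc.hyps[OF h(1)] by blast
    have c: "b \<in> carrier R" "w \<in> carrier R" "u \<in> carrier R" "x [^] n \<in> carrier R" using bw h by auto
    have "z = b \<oplus> x \<otimes> (w \<oplus> u \<otimes> x [^] n)"
      unfolding h(3) bw(3) nat_pow_Suc using c x by algebra
    then show ?case using bw(1) F_Suc_I[OF bw(2) h(2)] by blast
  qed
  then show thesis using that by blast
qed

subsection \<open>Hilbert's basis theorem\<close>

lemma adjoin_cring: "subring A R \<Longrightarrow> cring (R\<lparr>carrier := A\<rparr>)"
  using subring_is_domain by (simp add: domain.axioms(1))

lemma ideal_sub_iff:
  assumes "subring A R"
  shows "ideal I (R\<lparr>carrier := A\<rparr>) \<longleftrightarrow> I \<subseteq> A \<and> \<zero> \<in> I \<and> (\<forall>x\<in>I. \<forall>y\<in>I. x \<oplus> y \<in> I) \<and>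
     (\<forall>r\<in>A. \<forall>x\<in>I. r \<otimes> x \<in> I)"
  using cring.ideal_iff[OF adjoin_cring[OF assms], of I] by simp

text \<open>\<open>J n k\<close> gathers the coefficients at \<open>x^n\<close> in expressions of
  degree at most \<open>n\<close> for elements of \<open>I k\<close>. It grows in \<open>n\<close>,
  through multiplication by \<open>x\<close>, and in \<open>k\<close>. The diagonal handles all
  large \<open>n\<close> at once, which leaves finitely many rows to be stabilized
  separately.\<close>

lemma noetherian_adjoin:
  assumes noeth: "noetherian_ring (R\<lparr>carrier := B\<rparr>)"
  shows "noetherian_ring (R\<lparr>carrier := C\<rparr>)"
proof -
  interpret CR: cring "R\<lparr>carrier := C\<rparr>" by (rule adjoin_cring[OF C_subring])
  interpret BR: noetherian_ring "R\<lparr>carrier := B\<rparr>" by fact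
  show ?thesis
  proof (rule CR.noetherian_ring_if_sequences_stabilize)
    fix I :: "nat \<Rightarrow> 'a set"
    assume id: "\<And>n. ideal (I n) (R\<lparr>carrier := C\<rparr>)" and inc: "\<And>n. I n \<subseteq> I (Suc n)"
    note I = id[unfolded ideal_sub_iff[OF C_subring]]
    have I_mono: "I n \<subseteq> I m" if "n \<le> m" for n m using lift_Suc_mono_le[of I, OF inc that] .
    have I_sub: "I n \<subseteq> C" and I_zero: "\<zero> \<in> I n" for n using I[of n] by blast+
    have I_add: "a \<oplus> b \<in> I n" if "a \<in> I n" "b \<in> I n" for a b n using I[of n] that by blast
    have I_mult: "r \<otimes> a \<in> I n" if "r \<in> C" "a \<in> I n" for r a n using I[of n] that by blast
    define J where "J n k = {b \<in> B. \<exists>y\<in>F n. y \<oplus> b \<otimes> x [^] n \<in> I k}" for n k :: nat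
    have J_ideal: "ideal (J n k) (R\<lparr>carrier := B\<rparr>)" for n k
      unfolding ideal_sub_iff[OF B]
    proof (intro conjI ballI)
      show "J n k \<subseteq> B" by (auto simp: J_def)
      show "\<zero> \<in> J n k" unfolding J_def using I_zero[of k] by (auto intro!: bexI[of _ \<zero>])
    next
      fix a b assume "a \<in> J n k" "b \<in> J n k"
      then obtain y z where h: "a \<in> B" "b \<in> B" "y \<in> F n" "z \<in> F n" "y \<oplus> a \<otimes> x [^] n \<in> I k" "z \<oplus> b \<otimes> x [^] n \<in> I k"
        by (auto simp: J_def)
      have "(y \<oplus> z) \<oplus> (a \<oplus> b) \<otimes> x [^] n = (y \<oplus> a \<otimes> x [^] n) \<oplus> (z \<oplus> b \<otimes> x [^] n)"
        using h by (simp add: l_distr a_ac)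
      then have "(y \<oplus> z) \<oplus> (a \<oplus> b) \<otimes> x [^] n \<in> I k" using h I_add by simp
      then show "a \<oplus> b \<in> J n k" unfolding J_def using h F_add[OF h(3,4)] by auto
    next
      fix r b assume r: "r \<in> B" and "b \<in> J n k"
      then obtain y where h: "b \<in> B" "y \<in> F n" "y \<oplus> b \<otimes> x [^] n \<in> I k"
        by (auto simp: J_def)
      have "(r \<otimes> y) \<oplus> (r \<otimes> b) \<otimes> x [^] n = r \<otimes> (y \<oplus> b \<otimes> x [^] n)"
        using h r by (simp add: r_distr m_assoc)
      then have "(r \<otimes> y) \<oplus> (r \<otimes> b) \<otimes> x [^] n \<in> I k" using h r I_mult by simp
      then show "r \<otimes> b \<in> J n k" unfolding J_def using h r F_smult[OF r h(2)] by auto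
    qed
    have J_Suc1: "J n k \<subseteq> J (Suc n) k" for n k
    proof
      fix b assume "b \<in> J n k"
      then obtain y where h: "b \<in> B" "y \<in> F n" "y \<oplus> b \<otimes> x [^] n \<in> I k" by (auto simp: J_def)
      have "x \<otimes> y \<oplus> b \<otimes> x [^] Suc n = x \<otimes> (y \<oplus> b \<otimes> x [^] n)"
        using h nat_pow_Suc2[of x n] by (simp add: r_distr m_lcomm del: nat_pow_Suc)
      then have "x \<otimes> y \<oplus> b \<otimes> x [^] Suc n \<in> I k" using I_mult h by simp
      then show "b \<in> J (Suc n) k" unfolding J_def using h F_shift[OF h(2)] by auto
    qed
    have J_mono1: "J n k \<subseteq> J m k" if "n \<le> m" for n m k
      using lift_Suc_mono_le[of "\<lambda>n. J n k", OF J_Suc1 that] .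
    have J_mono2: "J n k \<subseteq> J n l" if "k \<le> l" for n k l
      unfolding J_def using I_mono[OF that] by blast
    have J_mono: "J n k \<subseteq> J m l" if "n \<le> m" "k \<le> l" for n m k l
      using J_mono1[OF that(1)] J_mono2[OF that(2)] by blast
    have "\<exists>N. \<forall>k\<ge>N. J k k = J N N"
      by (rule BR.ideal_sequence_stabilizes[of "\<lambda>k. J k k"]) (rule J_ideal, rule J_mono, auto)
    then obtain N where N: "\<forall>k\<ge>N. J k k = J N N" by (elim exE)
    have "\<forall>n. \<exists>K. \<forall>k\<ge>K. J n k = J n K"
      by (intro allI BR.ideal_sequence_stabilizes J_ideal J_mono2) simp
    from choice[OF this] obtain \<kappa> where "\<forall>n. \<forall>k\<ge>\<kappa> n. J n k = J n (\<kappa> n)" by (elim exE)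
    then have \<kappa>: "\<And>n k. k \<ge> \<kappa> n \<Longrightarrow> J n k = J n (\<kappa> n)" by blast
    \<comment> \<open>Beyond \<open>K\<close> no \<open>J n k\<close> grows: the rows below
      \<open>N\<close> have stopped by their own bounds \<kappa>, and every other one lies in a
      diagonal term, hence in \<open>J N N\<close>.\<close>
    define K where "K = Max (insert N (\<kappa> ` {..<N}))"
    have K: "N \<le> K" "\<And>n. n < N \<Longrightarrow> \<kappa> n \<le> K" unfolding K_def by (auto intro: Max_ge)
    have J_stable: "J n k \<subseteq> J n K" if "k \<ge> K" for n k
    proof (cases "n < N")
      case True
      then show ?thesis using \<kappa>[of n k] \<kappa>[of n K] K that by (metis order.trans subset_refl)
    next
      case False
      have "J n k \<subseteq> J (max n k) (max n k)" by (rule J_mono) auto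
      also have "\<dots> = J N N" using N[rule_format, of "max n k"] False by simp
      also have "\<dots> \<subseteq> J n K" using False K by (intro J_mono) auto
      finally show ?thesis .
    qed
    have "I k = I K" if k: "k \<ge> K" for k
    proof
      show "I K \<subseteq> I k" using I_mono[OF k] .
      \<comment> \<open>An element of \<open>I K\<close> with the same top coefficient is
        subtracted; the difference is still in \<open>I k\<close> and has an expression of smaller
        degree.\<close>
      have "z \<in> I K" if "z \<in> I k" "z \<in> F n" for z n
        using that
      proof (induct n arbitrary: z)
        case 0 then show ?case using I_zero by simp
      next
        case (Suc n)
        obtain y b where h: "y \<in> F n" "b \<in> B" "z = y \<oplus> b \<otimes> x [^] n" using Suc.prems by (metis F_Suc_E)
        have "b \<in> J n K" using J_stable[OF k, of n] h Suc.prems unfolding J_def by blast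
        then obtain y' where y': "y' \<in> F n" "y' \<oplus> b \<otimes> x [^] n \<in> I K" by (auto simp: J_def)
        let ?z = "y' \<oplus> b \<otimes> x [^] n"
        have zc: "?z \<in> I k" using y'(2) I_mono[OF k] by blast
        have "\<ominus> \<one> \<otimes> ?z \<in> I k" by (rule I_mult[OF _ zc]) simp
        then have "z \<oplus> \<ominus> \<one> \<otimes> ?z \<in> I k" using I_add Suc.prems by blast
        moreover have eq: "z \<oplus> \<ominus> \<one> \<otimes> ?z = y \<ominus> y'"
        proof -
          have "y \<in> carrier R" "y' \<in> carrier R" "b \<otimes> x [^] n \<in> carrier R" using h y' by auto
          then show ?thesis unfolding h(3) by algebra
        qed
        ultimately have "y \<ominus> y' \<in> I K" using Suc.hyps F_minus[OF h(1) y'(1)] by simp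
        then have "(y \<ominus> y') \<oplus> ?z \<in> I K" using y'(2) I_add by blast
        moreover have "(y \<ominus> y') \<oplus> ?z = z"
        proof -
          have "y \<in> carrier R" "y' \<in> carrier R" "b \<otimes> x [^] n \<in> carrier R" using h y' by auto
          then show ?thesis unfolding h(3) by algebra
        qed
        ultimately show ?case by simp
      qed
      then show "I k \<subseteq> I K" using I_sub C_F by (metis subsetD subsetI)
    qed
    note stab = this
    show "\<exists>N. \<forall>n\<ge>N. I n = I N" by (intro exI[of _ K] allI impI) (rule stab)
  qed
qed

end

lemma (in domain) nat_pow_nonzero: "a \<in> carrier R \<Longrightarrow> a \<noteq> \<zero> \<Longrightarrow> a [^] (n::nat) \<noteq> \<zero>"
  by (induct n) (auto simp: integral_iff)

context adjoin
begin

subsection \<open>Divisors of powers in an extension\<close>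

text \<open>The least such \<open>m\<close> is the degree of \<open>x\<close> over the fraction
  field of \<open>B\<close>; if there is none, \<open>x\<close> is transcendental. The leading
  coefficient is merely non-zero, so the divisions below have to multiply by its powers.\<close>

definition rel :: "nat \<Rightarrow> bool" where
  "rel m \<longleftrightarrow> (\<exists>e\<in>B. e \<noteq> \<zero> \<and> (\<exists>y\<in>F m. e \<otimes> x [^] m \<oplus> y = \<zero>))"

lemma rel_if_diff:
  assumes "u \<in> B" "u \<noteq> \<zero>" "y \<in> F i" "z \<in> F i" "u \<otimes> x [^] i \<oplus> y = z"
  shows "rel i"
proof -
  have "u \<otimes> x [^] i \<oplus> (y \<ominus> z) = \<zero>"
  proof -
    have c: "u \<otimes> x [^] i \<in> carrier R" "y \<in> carrier R" using assms by auto
    show ?thesis unfolding assms(5)[symmetric] using c by algebra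
  qed
  then show ?thesis unfolding rel_def using assms F_minus by blast
qed

text \<open>Two expressions with different top terms would differ by a relation, so for
  transcendental \<open>x\<close> the leading term belongs to the element.\<close>

lemma lead_unique:
  assumes norel: "\<And>m. \<not> rel m"
    and u: "u \<in> B" "u \<noteq> \<zero>" "y \<in> F i" and v: "v \<in> B" "v \<noteq> \<zero>" "z \<in> F j"
    and eq: "u \<otimes> x [^] i \<oplus> y = v \<otimes> x [^] j \<oplus> z"
  shows "i = j \<and> u = v"
proof -
  have lt: "\<not> j < i" if h: "u \<in> B" "u \<noteq> \<zero>" "y \<in> F i" "v \<in> B" "z \<in> F j"
    "u \<otimes> x [^] i \<oplus> y = v \<otimes> x [^] j \<oplus> z" for u v y z i j
  proof
    assume "j < i"
    then have "v \<otimes> x [^] j \<oplus> z \<in> F i" using h F_add F_monom F_mono by (meson less_imp_le)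
    then show False using rel_if_diff[OF h(1,2,3) _ h(6)] norel by blast
  qed
  have ij: "i = j" using lt[OF u v(1,3) eq] lt[OF v u(1,3) eq[symmetric]] by simp
  have "u = v"
  proof (rule ccontr)
    assume "u \<noteq> v"
    then have ne: "u \<ominus> v \<noteq> \<zero>" using u v by (simp add: r_right_minus_eq)
    have "(u \<ominus> v) \<otimes> x [^] i \<oplus> y = z"
    proof -
      have c: "u \<in> carrier R" "v \<in> carrier R" "x [^] i \<in> carrier R" "y \<in> carrier R" "z \<in> carrier R" using u v by auto
      have "(u \<ominus> v) \<otimes> x [^] i \<oplus> y = (u \<otimes> x [^] i \<oplus> y) \<ominus> v \<otimes> x [^] i" using c by algebra
      also have "\<dots> = z" unfolding eq ij[symmetric] using c by algebra
      finally show ?thesis .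
    qed
    then show False using rel_if_diff[of "u \<ominus> v" y i z] ne u v ij norel by simp
  qed
  then show ?thesis using ij by simp
qed

lemma lead_pow:
  assumes "u \<in> B" "y \<in> F r"
  shows "\<exists>w\<in>F (r * k). (u \<otimes> x [^] r \<oplus> y) [^] k = u [^] k \<otimes> x [^] (r * k) \<oplus> w"
proof (induct k)
  case 0 then show ?case by (intro bexI[of _ \<zero>]) auto
next
  case (Suc k)
  then obtain w where w: "w \<in> F (r * k)" "(u \<otimes> x [^] r \<oplus> y) [^] k = u [^] k \<otimes> x [^] (r * k) \<oplus> w" by blast
  show ?case
    using F_lead_mult[OF B_pow[OF assms(1)] w(1) assms, of k]
    by (simp add: w(2) add.commute)
qed

text \<open>\<open>b\<close> is the leading coefficient of \<open>c\<close>. As \<open>p\<close> has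
  degree 0 in \<open>x\<close>, comparing leading coefficients in \<open>p v = c^k\<close> shows
  that \<open>p\<close> times that of \<open>v\<close> is \<open>b^k\<close>.\<close>

lemma divides_power_transcendental:
  assumes norel: "\<And>m. \<not> rel m" and c: "c \<in> C" "c \<noteq> \<zero>"
  shows "\<exists>b\<in>B. b \<noteq> \<zero> \<and> (\<forall>p\<in>B. \<forall>k::nat. (\<exists>v\<in>C. p \<otimes> v = c [^] k) \<longrightarrow> (\<exists>l::nat. \<exists>w\<in>B. p \<otimes> w = b [^] l))"
proof -
  obtain r u y where u: "u \<in> B" "u \<noteq> \<zero>" "y \<in> F r" "c = u \<otimes> x [^] r \<oplus> y"
    using leading_term[OF c] .
  have "\<exists>l::nat. \<exists>w\<in>B. p \<otimes> w = u [^] l" if p: "p \<in> B" and v: "v \<in> C" "p \<otimes> v = c [^] k" for p v and k :: nat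
  proof -
    have ck: "c [^] k \<noteq> \<zero>" using c nat_pow_nonzero[of c k] by simp
    then have p0: "p \<noteq> \<zero>" and v0: "v \<noteq> \<zero>" using v p by auto
    obtain s t z where t: "t \<in> B" "t \<noteq> \<zero>" "z \<in> F s" "v = t \<otimes> x [^] s \<oplus> z"
      using leading_term[OF v(1) v0] .
    obtain w where w: "w \<in> F (r * k)" "c [^] k = u [^] k \<otimes> x [^] (r * k) \<oplus> w"
      using lead_pow[OF u(1,3), of k] u(4) by auto
    have "p \<otimes> v = (p \<otimes> t) \<otimes> x [^] s \<oplus> p \<otimes> z"
      unfolding t(4) using p t by (simp add: r_distr m_assoc)
    then have "(p \<otimes> t) \<otimes> x [^] s \<oplus> p \<otimes> z = u [^] k \<otimes> x [^] (r * k) \<oplus> w" using v w by simp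
    moreover have "p \<otimes> t \<noteq> \<zero>" using p p0 t by (simp add: integral_iff)
    moreover have "u [^] k \<noteq> \<zero>" using u nat_pow_nonzero[of u k] by simp
    ultimately have "p \<otimes> t = u [^] k"
      using lead_unique[OF norel, of "p \<otimes> t" "p \<otimes> z" s "u [^] k" w "r * k"] p t u w F_smult by simp
    then show ?thesis using t(1) by blast
  qed
  then show ?thesis using u by blast
qed

text \<open>While the degree is at least \<open>m\<close>, multiplication by \<open>e\<close> allows
  the top term to be rewritten through \<open>e x^m = -y\<close>.\<close>

lemma F_reduce:
  assumes e: "e \<in> B" "y \<in> F m" "e \<otimes> x [^] m \<oplus> y = \<zero>" and z: "z \<in> F n"
  shows "\<exists>N::nat. e [^] N \<otimes> z \<in> F m"
  using z
proof (induct n arbitrary: z)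
  case 0 then show ?case by (intro exI[of _ 0]) auto
next
  case (Suc n)
  show ?case
  proof (cases "Suc n \<le> m")
    case True then show ?thesis using Suc.prems F_mono by (intro exI[of _ 0]) auto
  next
    case False
    then have mn: "m \<le> n" by simp
    obtain y' b where h: "y' \<in> F n" "b \<in> B" "z = y' \<oplus> b \<otimes> x [^] n" using Suc.prems by (metis F_Suc_E)
    have xn: "x [^] n = x [^] (n - m) \<otimes> x [^] m" using mn by (simp add: nat_pow_mult)
    have "e \<otimes> z = e \<otimes> y' \<ominus> b \<otimes> (x [^] (n - m) \<otimes> y)"
    proof -
      have c: "e \<in> carrier R" "y' \<in> carrier R" "b \<in> carrier R" "x [^] (n - m) \<in> carrier R" "x [^] m \<in> carrier R" "y \<in> carrier R"
        using e h by auto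
      have "e \<otimes> z = e \<otimes> y' \<ominus> b \<otimes> (x [^] (n - m) \<otimes> y) \<oplus> (b \<otimes> x [^] (n - m)) \<otimes> (e \<otimes> x [^] m \<oplus> y)"
        unfolding h(3) xn using c by algebra
      then show ?thesis unfolding e(3) using c by simp
    qed
    moreover have "x [^] (n - m) \<otimes> y \<in> F n" using F_shift_pow[OF e(2), of "n - m"] mn by simp
    ultimately have "e \<otimes> z \<in> F n" using e h F_smult F_minus by simp
    then obtain N :: nat where "e [^] N \<otimes> (e \<otimes> z) \<in> F m" using Suc.hyps by blast
    then have "e [^] Suc N \<otimes> z \<in> F m" using e Suc.prems by (simp add: m_assoc)
    then show ?thesis by blast
  qed
qed

text \<open>Pseudo-division by \<open>h\<close>. The degree bound on the quotient \<open>q\<close>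
  is kept because \<open>q\<close> later becomes the lower part of a new relation.\<close>

lemma F_pdiv:
  assumes h: "h = u \<otimes> x [^] k \<oplus> y" "u \<in> B" "y \<in> F k" and z: "z \<in> F (k + n)"
  shows "\<exists>t::nat. \<exists>q\<in>F n. u [^] t \<otimes> z \<ominus> q \<otimes> h \<in> F k"
  using z
proof (induct n arbitrary: z)
  case 0 then show ?case using h by (intro exI[of _ 0] bexI[of _ \<zero>]) (auto simp: a_minus_def)
next
  case (Suc n)
  obtain y' b where z: "y' \<in> F (k + n)" "b \<in> B" "z = y' \<oplus> b \<otimes> x [^] (k + n)"
    using Suc.prems by (metis F_Suc_E add_Suc_right)
  have c: "u \<in> carrier R" "y \<in> carrier R" "y' \<in> carrier R" "b \<in> carrier R" "x [^] n \<in> carrier R" "x [^] k \<in> carrier R"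
    using h z by auto
  have hc: "h \<in> carrier R" using c h by simp
  let ?z = "u \<otimes> z \<ominus> (b \<otimes> x [^] n) \<otimes> h"
  have "?z = u \<otimes> y' \<ominus> b \<otimes> (x [^] n \<otimes> y)"
    unfolding z(3) h(1) nat_pow_mult[OF x, symmetric] using c by algebra
  moreover have "x [^] n \<otimes> y \<in> F (k + n)" using F_shift_pow[OF h(3), of n] by (simp add: add.commute)
  ultimately have "?z \<in> F (k + n)" using z h F_smult F_minus by simp
  then obtain t :: nat and q where q: "q \<in> F n" "u [^] t \<otimes> ?z \<ominus> q \<otimes> h \<in> F k" using Suc.hyps by blast
  have "u [^] Suc t \<otimes> z \<ominus> (q \<oplus> (u [^] t \<otimes> b) \<otimes> x [^] n) \<otimes> h = u [^] t \<otimes> ?z \<ominus> q \<otimes> h"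
  proof -
    have "u [^] t \<in> carrier R" "q \<in> carrier R" "z \<in> carrier R" using c q Suc.prems by auto
    then show ?thesis unfolding nat_pow_Suc using c hc by algebra
  qed
  moreover have "q \<oplus> (u [^] t \<otimes> b) \<otimes> x [^] n \<in> F (Suc n)"
    using F_Suc_I[OF q(1), of "u [^] t \<otimes> b"] h z by simp
  ultimately show ?case using q(2) by metis
qed

text \<open>The multiple of \<open>c\<close> of least degree in \<open>x\<close> lies in \<open>B\<close>: otherwise pseudo-division of the minimal
  relation of \<open>x\<close> by it would give a relation of lower degree.\<close>

lemma nonzero_multiple_in_base:
  assumes rel: "rel m" and min: "\<And>j. j < m \<Longrightarrow> \<not> rel j" and c: "c \<in> C" "c \<noteq> \<zero>"
  shows "\<exists>t\<in>C. c \<otimes> t \<in> B \<and> c \<otimes> t \<noteq> \<zero>"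
proof -
  obtain e ye where e: "e \<in> B" "e \<noteq> \<zero>" "ye \<in> F m" "e \<otimes> x [^] m \<oplus> ye = \<zero>"
    using rel unfolding rel_def by blast
  let ?P = "\<lambda>k. \<exists>t\<in>C. c \<otimes> t \<in> F (Suc k) \<and> c \<otimes> t \<noteq> \<zero>"
  obtain n where n: "c \<in> F n" using C_F[OF c(1)] .
  have "c \<otimes> \<one> \<in> F (Suc n)" "c \<otimes> \<one> \<noteq> \<zero>" using F_mono_Suc[OF n] c by auto
  then have "?P n" using C_closed(2) by blast
  define k where "k = (LEAST k. ?P k)"
  have Pk: "?P k" unfolding k_def by (rule LeastI[of ?P, OF \<open>?P n\<close>])
  have least: "k \<le> j" if "?P j" for j unfolding k_def by (rule Least_le[of ?P, OF that])
  have low: "z = \<zero>" if "k \<noteq> 0" "z \<in> F k" "z = c \<otimes> t" "t \<in> C" for z t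
  proof (rule ccontr)
    assume "z \<noteq> \<zero>"
    then have "?P (k - 1)" using that by auto
    then show False using least[of "k - 1"] that(1) by simp
  qed
  obtain t where t: "t \<in> C" "c \<otimes> t \<in> F (Suc k)" "c \<otimes> t \<noteq> \<zero>" using Pk by blast
  define h where "h = c \<otimes> t"
  have "k = 0"
  proof (rule ccontr)
    assume k0: "k \<noteq> 0"
    \<comment> \<open>Reducing \<open>h\<close> modulo the minimal relation gives a non-zero
      multiple of \<open>c\<close> of degree below \<open>m\<close>, hence
      \<open>k < m\<close>.\<close>
    obtain N :: nat where N: "e [^] N \<otimes> h \<in> F m" using F_reduce[OF e(1,3,4) t(2)] unfolding h_def by blast
    have "e [^] N \<otimes> h = c \<otimes> (e [^] N \<otimes> t)" unfolding h_def using e t c by (simp add: m_lcomm)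
    moreover have "e [^] N \<otimes> h \<noteq> \<zero>"
      using e t nat_pow_nonzero[of e N] c by (simp add: integral_iff h_def)
    moreover have "e [^] N \<otimes> t \<in> C" using e t by simp
    moreover from calculation have "m \<noteq> 0" using N by (intro notI) simp
    ultimately have "m \<noteq> 0" "?P (m - 1)" using N by (auto intro!: bexI[of _ "e [^] N \<otimes> t"])
    then have km: "k < m" using least[of "m - 1"] by simp
    obtain y u where y: "y \<in> F k" "u \<in> B" "h = y \<oplus> u \<otimes> x [^] k" using t(2) unfolding h_def by (metis F_Suc_E)
    have hu: "h = u \<otimes> x [^] k \<oplus> y" using y by (simp add: a_comm)
    have u0: "u \<noteq> \<zero>"
    proof
      assume "u = \<zero>"
      then have "h \<in> F k" using y by simp
      then show False using low[OF k0, of h t] t h_def by simp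
    qed
    have xm: "x [^] m = x [^] (m - k) \<otimes> x [^] k" using km by (simp add: nat_pow_mult)
    have cc: "u \<in> carrier R" "e \<in> carrier R" "ye \<in> carrier R" "y \<in> carrier R" "x [^] (m - k) \<in> carrier R" "x [^] k \<in> carrier R" "h \<in> carrier R"
      using y e t c by (auto simp: h_def)
    \<comment> \<open>The top terms of \<open>u\<close> times the minimal relation and of
      \<open>e x^(m-k) h\<close> cancel. Since the relation is zero, \<open>z\<close> is a multiple
      of \<open>h\<close>, and its degree is below \<open>m\<close>.\<close>
    define z where "z = u \<otimes> ye \<ominus> e \<otimes> (x [^] (m - k) \<otimes> y)"
    have "x [^] (m - k) \<otimes> y \<in> F m" using F_shift_pow[OF y(1), of "m - k"] km by simp
    then have z: "z \<in> F (k + (m - k))" unfolding z_def using y e km by (simp add: F_minus F_smult)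
    have zh: "z = \<ominus> (e \<otimes> x [^] (m - k)) \<otimes> h"
    proof -
      have "z = u \<otimes> (e \<otimes> x [^] m \<oplus> ye) \<ominus> (e \<otimes> x [^] (m - k)) \<otimes> h"
        unfolding z_def xm hu using cc(1-6) by algebra
      then show ?thesis unfolding e(4) using cc by algebra
    qed
    obtain s :: nat and q where q: "q \<in> F (m - k)" "u [^] s \<otimes> z \<ominus> q \<otimes> h \<in> F k"
      using F_pdiv[OF hu y(2,1) z] by blast
    have qc: "q \<in> carrier R" "u [^] s \<in> carrier R" using q cc by auto
    \<comment> \<open>The remainder is a multiple of \<open>c\<close> of degree below
      \<open>k\<close>, so it vanishes. Cancelling \<open>h\<close> then gives a relation of degree
      \<open>m - k\<close>, whose leading coefficient \<open>u^s e\<close> is untouched by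
      \<open>q\<close>.\<close>
    have "u [^] s \<otimes> z \<ominus> q \<otimes> h = c \<otimes> (\<ominus> ((u [^] s \<otimes> e) \<otimes> x [^] (m - k) \<oplus> q) \<otimes> t)"
      unfolding zh h_def using qc cc(2,5) c t Cc by algebra
    moreover have "\<ominus> ((u [^] s \<otimes> e) \<otimes> x [^] (m - k) \<oplus> q) \<otimes> t \<in> C"
      using q y e t F_C by simp
    ultimately have "u [^] s \<otimes> z \<ominus> q \<otimes> h = \<zero>" using low[OF k0 q(2)] by blast
    moreover have "u [^] s \<otimes> z \<ominus> q \<otimes> h = \<ominus> (((u [^] s \<otimes> e) \<otimes> x [^] (m - k) \<oplus> q) \<otimes> h)"
      unfolding zh using qc cc(2,5,7) by algebra
    ultimately have "((u [^] s \<otimes> e) \<otimes> x [^] (m - k) \<oplus> q) \<otimes> h = \<zero>"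
      using qc cc by (metis (no_types, lifting) add.inv_eq_1_iff a_inv_def a_closed m_closed)
    moreover have "h \<noteq> \<zero>" using t by (simp add: h_def)
    ultimately have "(u [^] s \<otimes> e) \<otimes> x [^] (m - k) \<oplus> q = \<zero>" using qc cc by (simp add: integral_iff)
    moreover have "u [^] s \<otimes> e \<noteq> \<zero>" using u0 e y nat_pow_nonzero[of u s] by (simp add: integral_iff)
    moreover have "u [^] s \<otimes> e \<in> B" using y e by simp
    ultimately have "rel (m - k)" unfolding rel_def using q(1) by blast
    then show False using min[of "m - k"] k0 km by simp
  qed
  then have "c \<otimes> t \<in> B" using t(2) by (auto elim!: F_Suc_E)
  then show ?thesis using t by blast
qed

text \<open>With \<open>b = c t\<close> in \<open>B\<close>, the equation \<open>p v = c^k\<close>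
  gives \<open>p (v t^k) = b^k\<close>. Multiplying by \<open>e^N\<close> brings
  \<open>v t^k\<close> to degree below \<open>m\<close>, where constant coefficients may be
  compared, and \<open>p\<close> divides \<open>e^N b^k\<close>. Since \<open>N\<close> depends on
  \<open>v\<close>, the element that works for all \<open>p\<close> and \<open>k\<close> is
  \<open>e b\<close>.\<close>

lemma divides_power_algebraic:
  assumes rel: "rel m" and min: "\<And>j. j < m \<Longrightarrow> \<not> rel j" and c: "c \<in> C" "c \<noteq> \<zero>"
  shows "\<exists>b\<in>B. b \<noteq> \<zero> \<and> (\<forall>p\<in>B. \<forall>k::nat. (\<exists>v\<in>C. p \<otimes> v = c [^] k) \<longrightarrow> (\<exists>l::nat. \<exists>w\<in>B. p \<otimes> w = b [^] l))"
proof -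
  obtain e ye where e: "e \<in> B" "e \<noteq> \<zero>" "ye \<in> F m" "e \<otimes> x [^] m \<oplus> ye = \<zero>"
    using rel unfolding rel_def by blast
  obtain t where t: "t \<in> C" "c \<otimes> t \<in> B" "c \<otimes> t \<noteq> \<zero>" using nonzero_multiple_in_base[OF assms] by blast
  define b where "b = c \<otimes> t"
  have m0: "m \<noteq> 0" using e by (intro notI) auto
  \<comment> \<open>By minimality of \<open>m\<close> the powers of \<open>x\<close> below
    \<open>m\<close> are linearly independent over \<open>B\<close>; the constant coefficient is all
    that is extracted.\<close>
  have indep: "\<beta> = \<zero>" if \<beta>: "\<beta> \<in> B" "w \<in> F (m - 1)" "\<beta> \<oplus> x \<otimes> w = \<zero>" for \<beta> w
  proof (cases "w = \<zero>")
    case True then show ?thesis using \<beta> by simp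
  next
    case False
    obtain r u y where u: "r < m - 1" "u \<in> B" "u \<noteq> \<zero>" "y \<in> F r" "w = u \<otimes> x [^] r \<oplus> y"
      using leading_term_F[OF \<beta>(2) False] .
    have "u \<otimes> x [^] Suc r \<oplus> (\<beta> \<oplus> x \<otimes> y) = \<beta> \<oplus> x \<otimes> w"
      unfolding nat_pow_Suc u(5) using u(2,4) \<beta>(1) by (simp add: r_distr m_ac a_ac)
    moreover have "\<beta> \<oplus> x \<otimes> y \<in> F (Suc r)" using F_add[OF F_const[OF \<beta>(1)] F_shift[OF u(4)]] .
    ultimately have "rel (Suc r)" unfolding rel_def using u \<beta>(3) by metis
    then show ?thesis using min[of "Suc r"] u(1) by simp
  qed
  have "\<exists>l::nat. \<exists>w\<in>B. p \<otimes> w = (e \<otimes> b) [^] l" if p: "p \<in> B" and v: "v \<in> C" "p \<otimes> v = c [^] k" for p v and k :: nat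
  proof -
    define v' where "v' = v \<otimes> t [^] k"
    have v'C: "v' \<in> C" using v t by (simp add: v'_def)
    have pv': "p \<otimes> v' = b [^] k"
      using v t p c by (simp add: v'_def b_def nat_pow_distrib flip: m_assoc)
    obtain n where "v' \<in> F n" using C_F[OF v'C] .
    then obtain N :: nat where N: "e [^] N \<otimes> v' \<in> F m" using F_reduce[OF e(1,3,4)] by blast
    then have "e [^] N \<otimes> v' \<in> F (Suc (m - 1))" using m0 by simp
    then obtain \<beta> w where w: "\<beta> \<in> B" "w \<in> F (m - 1)" "e [^] N \<otimes> v' = \<beta> \<oplus> x \<otimes> w"
      by (rule F_Suc_low)
    have cc: "p \<in> carrier R" "\<beta> \<in> carrier R" "w \<in> carrier R" "v' \<in> carrier R" "e [^] N \<in> carrier R" "b [^] k \<in> carrier R"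
      using p w v'C e t by (auto simp: b_def)
    have bB: "b \<in> B" using t by (simp add: b_def)
    have "(p \<otimes> \<beta> \<ominus> e [^] N \<otimes> b [^] k) \<oplus> x \<otimes> (p \<otimes> w) = p \<otimes> (\<beta> \<oplus> x \<otimes> w) \<ominus> e [^] N \<otimes> b [^] k"
      using cc x by algebra
    also have "\<dots> = \<zero>"
      unfolding w(3)[symmetric] pv'[symmetric] using cc x by algebra
    finally have "p \<otimes> \<beta> \<ominus> e [^] N \<otimes> b [^] k = \<zero>"
      using indep[of "p \<otimes> \<beta> \<ominus> e [^] N \<otimes> b [^] k" "p \<otimes> w"] p w e bB F_smult by simp
    then have p\<beta>: "p \<otimes> \<beta> = e [^] N \<otimes> b [^] k" using cc by (simp add: r_right_minus_eq)
    have "p \<otimes> (\<beta> \<otimes> (e [^] k \<otimes> b [^] N)) = (p \<otimes> \<beta>) \<otimes> (e [^] k \<otimes> b [^] N)"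
      using cc e bB by (simp add: m_assoc)
    also have "\<dots> = (e [^] N \<otimes> e [^] k) \<otimes> (b [^] N \<otimes> b [^] k)"
      unfolding p\<beta> using e bB by (simp add: m_ac)
    also have "\<dots> = (e \<otimes> b) [^] (N + k)"
      using e bB by (simp add: nat_pow_mult nat_pow_distrib)
    finally show ?thesis using w(1) e bB by (intro exI bexI[of _ "\<beta> \<otimes> (e [^] k \<otimes> b [^] N)"]) auto
  qed
  moreover have "e \<otimes> b \<in> B" "e \<otimes> b \<noteq> \<zero>" using e t by (auto simp: b_def integral_iff)
  ultimately show ?thesis by blast
qed

text \<open>The order of quantifiers matters: \<open>b\<close> depends on \<open>c\<close> alone, so
  finiteness of a set of divisors of powers of \<open>b\<close> carries over to
  \<open>c\<close>.\<close>

theorem divides_power_descends: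
  assumes c: "c \<in> C" "c \<noteq> \<zero>"
  obtains b where "b \<in> B" "b \<noteq> \<zero>"
    "\<And>p v k. p \<in> B \<Longrightarrow> v \<in> C \<Longrightarrow> p \<otimes> v = c [^] (k::nat) \<Longrightarrow> \<exists>l::nat. \<exists>w\<in>B. p \<otimes> w = b [^] l"
proof (cases "\<exists>m. rel m")
  case True
  then have "rel (LEAST m. rel m)" "\<And>j. j < (LEAST m. rel m) \<Longrightarrow> \<not> rel j"
    using LeastI_ex not_less_Least by auto
  from divides_power_algebraic[OF this c] show thesis using that by blast
next
  case False
  then show thesis using divides_power_transcendental[OF _ c] that by blast
qed

end

section \<open>Derivations, and polynomials over a field of constants\<close>

locale ring_derivation = cring R for R (structure) +
  fixes \<delta> :: "'a \<Rightarrow> 'a"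
  assumes \<delta>_closed [simp, intro]: "a \<in> carrier R \<Longrightarrow> \<delta> a \<in> carrier R"
    and \<delta>_add: "a \<in> carrier R \<Longrightarrow> b \<in> carrier R \<Longrightarrow> \<delta> (a \<oplus> b) = \<delta> a \<oplus> \<delta> b"
    and \<delta>_mult: "a \<in> carrier R \<Longrightarrow> b \<in> carrier R \<Longrightarrow> \<delta> (a \<otimes> b) = \<delta> a \<otimes> b \<oplus> a \<otimes> \<delta> b"
begin

abbreviation \<nu> :: "nat \<Rightarrow> 'a" where "\<nu> n \<equiv> [n] \<cdot> \<one>"

lemma \<nu>_Suc: "\<nu> (Suc n) = \<nu> n \<oplus> \<one>" by simp

lemma \<delta>_zero [simp]: "\<delta> \<zero> = \<zero>"
  using \<delta>_add[of \<zero> \<zero>] add.l_cancel_one[of "\<delta> \<zero>" "\<delta> \<zero>"] by simp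

lemma \<delta>_one [simp]: "\<delta> \<one> = \<zero>"
  using \<delta>_mult[of \<one> \<one>] add.l_cancel_one[of "\<delta> \<one>" "\<delta> \<one>"] by simp

lemma \<delta>_nat [simp]: "\<delta> (\<nu> n) = \<zero>"
  by (induct n) (simp_all add: \<delta>_add)

lemma \<delta>_neg: "a \<in> carrier R \<Longrightarrow> \<delta> (\<ominus> a) = \<ominus> \<delta> a"
  using \<delta>_add[of "\<ominus> a" a] minus_equality[of "\<delta> (\<ominus> a)" "\<delta> a"] by (simp add: l_neg)

lemma \<delta>_minus: "a \<in> carrier R \<Longrightarrow> b \<in> carrier R \<Longrightarrow> \<delta> (a \<ominus> b) = \<delta> a \<ominus> \<delta> b"
  by (simp add: a_minus_def \<delta>_add \<delta>_neg)

lemma \<delta>_pow: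
  assumes x: "x \<in> carrier R"
  shows "\<delta> (x [^] Suc n) = \<nu> (Suc n) \<otimes> x [^] n \<otimes> \<delta> x"
proof (induct n)
  case 0 then show ?case using x by simp
next
  case (Suc n)
  have c: "x [^] n \<in> carrier R" "\<nu> (Suc n) \<in> carrier R" "\<delta> x \<in> carrier R" using x by (simp_all del: add.nat_pow_Suc)
  have "\<delta> (x [^] Suc (Suc n)) = \<delta> (x [^] Suc n) \<otimes> x \<oplus> x [^] Suc n \<otimes> \<delta> x"
    using \<delta>_mult[of "x [^] Suc n" x] x by (simp del: add.nat_pow_Suc)
  also have "\<dots> = (\<nu> (Suc n) \<oplus> \<one>) \<otimes> x [^] Suc n \<otimes> \<delta> x"
    unfolding Suc unfolding nat_pow_Suc using c x by algebra
  finally show ?case by (simp only: \<nu>_Suc[of "Suc n"])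
qed

end

text \<open>In this situation \<open>x\<close> is transcendental over \<open>B\<close>, by
  \<open>no_relation\<close>, so \<open>F n\<close> is the space of polynomials of degree less than
  \<open>n\<close>.\<close>

locale adjoin_derivation = adjoin R B x + ring_derivation R \<delta>
  for R (structure) and B :: "'a set" and x :: 'a and \<delta> :: "'a \<Rightarrow> 'a" +
  assumes B_field: "subfield B R"
    and char0: "\<And>n::nat. n > 0 \<Longrightarrow> [n] \<cdot> \<one> \<noteq> \<zero>"
    and \<delta>_B [simp]: "\<And>b. b \<in> B \<Longrightarrow> \<delta> b = \<zero>"
    and \<delta>_x: "\<delta> x \<noteq> \<zero>"
begin

lemma \<nu>_B [simp]: "\<nu> n \<in> B"
  by (induct n) auto

lemma \<nu>_neq:
  assumes "m \<noteq> n" shows "\<nu> m \<ominus> \<nu> n \<noteq> \<zero>"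
proof -
  have lt: "\<nu> m \<noteq> \<nu> n" if "m < n" for m n
  proof
    assume "\<nu> m = \<nu> n"
    moreover have "\<nu> n = \<nu> m \<oplus> \<nu> (n - m)" using that add.nat_pow_mult[of \<one> m "n - m"] by simp
    ultimately have "\<nu> (n - m) = \<zero>" using add.l_cancel_one[of "\<nu> m" "\<nu> (n - m)"] by simp
    then show False using char0[of "n - m"] that by simp
  qed
  then have "\<nu> m \<noteq> \<nu> n" using lt assms by (metis nat_neq_iff)
  then show ?thesis by (simp add: r_right_minus_eq)
qed

text \<open>Here \<open>z\<close> is the formal derivative of \<open>y\<close> with respect to
  \<open>x\<close>, hence the drop in degree.\<close>

lemma \<delta>_F:
  assumes "y \<in> F (Suc n)" shows "\<exists>z\<in>F n. \<delta> y = z \<otimes> \<delta> x"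
  using assms
proof (induct n arbitrary: y)
  case 0
  then obtain b where "b \<in> B" "y = b" by (auto elim!: F_Suc_E)
  then show ?case by simp
next
  case (Suc n)
  obtain y' b where h: "y' \<in> F (Suc n)" "b \<in> B" "y = y' \<oplus> b \<otimes> x [^] Suc n" using Suc.prems by (metis F_Suc_E)
  obtain z where z: "z \<in> F n" "\<delta> y' = z \<otimes> \<delta> x" using Suc.hyps[OF h(1)] by blast
  have c: "x [^] n \<in> carrier R" "\<nu> (Suc n) \<in> carrier R" "\<delta> x \<in> carrier R" "b \<in> carrier R" "z \<in> carrier R" "y' \<in> carrier R"
    using h z by (simp_all del: add.nat_pow_Suc)
  have "\<delta> y = \<delta> y' \<oplus> b \<otimes> \<delta> (x [^] Suc n)"
    unfolding h(3) using c \<delta>_mult[of b "x [^] Suc n"] h(2)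
    by (subst \<delta>_add) (simp_all del: add.nat_pow_Suc nat_pow_Suc)
  also have "\<dots> = (z \<oplus> (b \<otimes> \<nu> (Suc n)) \<otimes> x [^] n) \<otimes> \<delta> x"
    unfolding z(2) \<delta>_pow[OF x] using c by algebra
  finally show ?case using F_Suc_I[OF z(1), of "b \<otimes> \<nu> (Suc n)"] h(2) \<nu>_B[of "Suc n"]
    by (metis B_closed(4))
qed

text \<open>Applying \<delta> to a relation of degree \<open>n + 1\<close> and cancelling \<delta> x
  leaves one of degree \<open>n\<close> with leading coefficient \<open>(n + 1) u\<close>.
  Characteristic zero carries the vanishing back to \<open>u\<close>.\<close>

lemma no_relation:
  assumes "u \<in> B" "y \<in> F n" "u \<otimes> x [^] n \<oplus> y = \<zero>" shows "u = \<zero>"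
  using assms
proof (induct n arbitrary: u y)
  case 0 then show ?case by simp
next
  case (Suc n)
  obtain z where z: "z \<in> F n" "\<delta> y = z \<otimes> \<delta> x" using \<delta>_F[OF Suc.prems(2)] by blast
  have c: "x [^] n \<in> carrier R" "\<nu> (Suc n) \<in> carrier R" "\<delta> x \<in> carrier R" "u \<in> carrier R" "z \<in> carrier R" "y \<in> carrier R"
    using Suc.prems z by (simp_all del: add.nat_pow_Suc)
  have "\<zero> = \<delta> (u \<otimes> x [^] Suc n \<oplus> y)" unfolding Suc.prems(3) using \<delta>_B[OF B_closed(1)] by simp
  also have "\<dots> = u \<otimes> \<delta> (x [^] Suc n) \<oplus> \<delta> y"
    using c \<delta>_mult[of u "x [^] Suc n"] Suc.prems(1)
    by (subst \<delta>_add) (simp_all del: add.nat_pow_Suc nat_pow_Suc)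
  also have "\<dots> = ((u \<otimes> \<nu> (Suc n)) \<otimes> x [^] n \<oplus> z) \<otimes> \<delta> x"
    unfolding z(2) \<delta>_pow[OF x] using c by algebra
  finally have "(u \<otimes> \<nu> (Suc n)) \<otimes> x [^] n \<oplus> z = \<zero>"
    using c \<delta>_x integral[of "(u \<otimes> \<nu> (Suc n)) \<otimes> x [^] n \<oplus> z" "\<delta> x"] by (simp del: add.nat_pow_Suc)
  then have "u \<otimes> \<nu> (Suc n) = \<zero>" using Suc.hyps[OF _ z(1)] Suc.prems(1) \<nu>_B[of "Suc n"] B_closed(4) by metis
  then show ?case using c char0[of "Suc n"] integral by blast
qed

text \<open>The factor \<open>x - l\<close> is monic, so it raises the degree by exactly one: the
  leading coefficient of \<open>s\<close> survives in the product, and a product of too small a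
  degree would give a relation.\<close>

lemma linear_multiple_degree:
  assumes s: "s \<in> C" "s \<noteq> \<zero>" and l: "l \<in> B" and p: "(x \<ominus> l) \<otimes> s \<in> F (Suc j)"
  shows "s \<in> F j"
proof -
  obtain r u y where u: "u \<in> B" "u \<noteq> \<zero>" "y \<in> F r" "s = u \<otimes> x [^] r \<oplus> y" using leading_term[OF s] .
  have c: "u \<in> carrier R" "x [^] r \<in> carrier R" "y \<in> carrier R" "l \<in> carrier R" using u l by auto
  have "r < j"
  proof (rule ccontr)
    assume "\<not> r < j"
    then have P: "(x \<ominus> l) \<otimes> s \<in> F (Suc r)" using F_mono[OF p, of "Suc r"] by simp
    have sF: "s \<in> F (Suc r)" unfolding u(4) using F_Suc_I[OF u(3,1)] c by (simp add: a_comm)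
    have "u \<otimes> x [^] Suc r \<oplus> (x \<otimes> y \<ominus> l \<otimes> s \<ominus> (x \<ominus> l) \<otimes> s) = \<zero>"
      unfolding u(4) nat_pow_Suc using c x by algebra
    moreover have "x \<otimes> y \<ominus> l \<otimes> s \<ominus> (x \<ominus> l) \<otimes> s \<in> F (Suc r)"
      by (intro F_minus F_shift F_smult u l sF P)
    ultimately show False using no_relation u(1,2) by blast
  qed
  then show ?thesis unfolding u(4) using F_monom[OF u(1)] F_mono[OF u(3), of j] by (intro F_add) auto
qed

lemma remainder:
  assumes "c \<in> F j" "l \<in> B"
  shows "\<exists>w\<in>C. \<exists>\<mu>\<in>B. c = (x \<ominus> l) \<otimes> w \<oplus> \<mu>"
  using assms(1)
proof (induct j arbitrary: c)
  case 0 then show ?case using assms(2) by (intro bexI[of _ \<zero>]) auto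
next
  case (Suc j)
  obtain b w where w: "b \<in> B" "w \<in> F j" "c = b \<oplus> x \<otimes> w" using F_Suc_low[OF Suc.prems] .
  obtain w' \<mu> where w': "w' \<in> C" "\<mu> \<in> B" "w = (x \<ominus> l) \<otimes> w' \<oplus> \<mu>" using Suc.hyps[OF w(2)] by blast
  have cc: "b \<in> carrier R" "w' \<in> carrier R" "\<mu> \<in> carrier R" "l \<in> carrier R" using w w' assms by auto
  have "c = (x \<ominus> l) \<otimes> (w \<oplus> l \<otimes> w') \<oplus> (b \<oplus> l \<otimes> \<mu>)"
    unfolding w(3) w'(3) using cc x by algebra
  moreover have "w \<oplus> l \<otimes> w' \<in> C" "b \<oplus> l \<otimes> \<mu> \<in> B" using w w' assms F_C by auto
  ultimately show ?case by blast
qed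

text \<open>If \<open>c = (x - m) v\<close>, any other divisor \<open>x - n\<close> differs from
  \<open>x - m\<close> by an invertible constant, so it divides \<open>v\<close>, whose degree is
  smaller.\<close>

lemma finite_linear_divisors:
  assumes "c \<in> F j" "c \<noteq> \<zero>"
  shows "finite {n::nat. \<exists>v\<in>C. (x \<ominus> \<nu> n) \<otimes> v = c}"
  using assms
proof (induct j arbitrary: c)
  case 0 then show ?case by simp
next
  case (Suc j)
  let ?S = "\<lambda>c. {n::nat. \<exists>v\<in>C. (x \<ominus> \<nu> n) \<otimes> v = c}"
  show ?case
  proof (cases "?S c = {}")
    case True then show ?thesis by (metis finite.emptyI)
  next
    case False
    then obtain m v where v: "v \<in> C" "(x \<ominus> \<nu> m) \<otimes> v = c" by blast
    have v0: "v \<noteq> \<zero>" using v Suc.prems by auto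
    have "v \<in> F j" using linear_multiple_degree[OF v(1) v0 \<nu>_B, of m j] v(2) Suc.prems(1) by simp
    then have fin: "finite (?S v)" using Suc.hyps v0 by blast
    have "?S c \<subseteq> insert m (?S v)"
    proof
      fix n assume "n \<in> ?S c"
      then obtain w where w: "w \<in> C" "(x \<ominus> \<nu> n) \<otimes> w = c" by blast
      show "n \<in> insert m (?S v)"
      proof (cases "n = m")
        case False
        define d where "d = \<nu> n \<ominus> \<nu> m"
        have d: "d \<in> B" "d \<noteq> \<zero>" using \<nu>_neq[OF False] by (auto simp: d_def)
        then obtain i where i: "i \<in> B" "i \<otimes> d = \<one>"
          using subfield_m_inv[OF B_field, of d] by auto
        have cc: "\<nu> n \<in> carrier R" "\<nu> m \<in> carrier R" "v \<in> carrier R" "w \<in> carrier R" "i \<in> carrier R" "d \<in> carrier R"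
          using v w i d by auto
        have "d \<otimes> v = (x \<ominus> \<nu> m) \<otimes> v \<ominus> (x \<ominus> \<nu> n) \<otimes> v" unfolding d_def using cc(1-3) x by algebra
        also have "\<dots> = (x \<ominus> \<nu> n) \<otimes> w \<ominus> (x \<ominus> \<nu> n) \<otimes> v" using v w by simp
        also have "\<dots> = (x \<ominus> \<nu> n) \<otimes> (w \<ominus> v)" using cc x by algebra
        finally have dv: "d \<otimes> v = (x \<ominus> \<nu> n) \<otimes> (w \<ominus> v)" .
        have "(x \<ominus> \<nu> n) \<otimes> (i \<otimes> (w \<ominus> v)) = i \<otimes> (d \<otimes> v)" unfolding dv using cc x by algebra
        also have "\<dots> = (i \<otimes> d) \<otimes> v" using cc by (simp add: m_assoc)
        finally have "(x \<ominus> \<nu> n) \<otimes> (i \<otimes> (w \<ominus> v)) = v" unfolding i(2) using cc by simp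
        then show ?thesis using i v w by auto
      qed simp
    qed
    then show ?thesis using fin finite_subset by blast
  qed
qed

text \<open>An \<open>x - n\<close> that divides \<open>c^k\<close> divides \<open>c\<close>: if
  \<mu> is the constant remainder of \<open>c\<close>, then \<open>c^k\<close> has remainder
  \<open>\<mu>^k\<close>, and a non-zero constant is no multiple of \<open>x - n\<close>.\<close>

theorem finite_linear_divisors_of_powers:
  assumes c: "c \<in> C" "c \<noteq> \<zero>"
  shows "finite {n::nat. \<exists>k::nat. \<exists>v\<in>C. (x \<ominus> \<nu> n) \<otimes> v = c [^] k}"
proof -
  obtain j where j: "c \<in> F j" using C_F[OF c(1)] .
  have "{n::nat. \<exists>k::nat. \<exists>v\<in>C. (x \<ominus> \<nu> n) \<otimes> v = c [^] k} \<subseteq> {n. \<exists>v\<in>C. (x \<ominus> \<nu> n) \<otimes> v = c}"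
  proof clarify
    fix n and k :: nat and v
    assume v: "v \<in> C" "(x \<ominus> \<nu> n) \<otimes> v = c [^] k"
    obtain w \<mu> where w: "w \<in> C" "\<mu> \<in> B" "c = (x \<ominus> \<nu> n) \<otimes> w \<oplus> \<mu>" using remainder[OF j \<nu>_B] by blast
    let ?p = "x \<ominus> \<nu> n"
    have p: "?p \<in> C" "?p \<in> carrier R" by auto
    have pow: "\<exists>z\<in>C. c [^] k = ?p \<otimes> z \<oplus> \<mu> [^] k" for k :: nat
    proof (induct k)
      case 0 then show ?case by (intro bexI[of _ \<zero>]) auto
    next
      case (Suc k)
      then obtain z where z: "z \<in> C" "c [^] k = ?p \<otimes> z \<oplus> \<mu> [^] k" by blast
      have cc: "z \<in> carrier R" "w \<in> carrier R" "\<mu> \<in> carrier R" "\<mu> [^] k \<in> carrier R" "c \<in> carrier R" using z w c by auto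
      have "c [^] Suc k = c [^] k \<otimes> c" by simp
      also have "\<dots> = ?p \<otimes> (z \<otimes> c) \<oplus> \<mu> [^] k \<otimes> c"
        unfolding z(2) using cc p(2) by (simp add: l_distr m_assoc)
      also have "\<mu> [^] k \<otimes> c = ?p \<otimes> (\<mu> [^] k \<otimes> w) \<oplus> \<mu> [^] Suc k"
        using cc p(2) arg_cong[OF w(3), of "\<lambda>t. \<mu> [^] k \<otimes> t"] by (simp add: r_distr m_lcomm)
      also have "?p \<otimes> (z \<otimes> c) \<oplus> \<dots> = ?p \<otimes> (z \<otimes> c \<oplus> \<mu> [^] k \<otimes> w) \<oplus> \<mu> [^] Suc k"
        using cc p(2) by (simp add: r_distr a_assoc)
      finally show ?case using z w c by (intro bexI[of _ "z \<otimes> c \<oplus> \<mu> [^] k \<otimes> w"]) auto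
    qed
    have "\<mu> = \<zero>"
    proof (rule ccontr)
      assume \<mu>0: "\<mu> \<noteq> \<zero>"
      obtain z where z: "z \<in> C" "c [^] k = ?p \<otimes> z \<oplus> \<mu> [^] k" using pow by blast
      have \<mu>k: "\<mu> [^] k \<in> carrier R" "\<mu> [^] k \<noteq> \<zero>" "\<mu> [^] k \<in> B" using w \<mu>0 by (auto simp: nat_pow_nonzero)
      have "?p \<otimes> (v \<ominus> z) = ?p \<otimes> v \<ominus> ?p \<otimes> z" using p v z Cc by algebra
      also have "\<dots> = \<mu> [^] k" unfolding v(2) z(2) using p z \<mu>k Cc[OF z(1)] by algebra
      finally have eq: "?p \<otimes> (v \<ominus> z) = \<mu> [^] k" .
      then have "v \<ominus> z \<noteq> \<zero>" using \<mu>k p by auto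
      then have "v \<ominus> z \<in> F 0" using linear_multiple_degree[of "v \<ominus> z" "\<nu> n" 0] v z eq F_const[OF \<mu>k(3), of 0] by simp
      then show False using \<open>v \<ominus> z \<noteq> \<zero>\<close> by simp
    qed
    then show "\<exists>v\<in>C. (x \<ominus> \<nu> n) \<otimes> v = c" using w by auto
  qed
  then show ?thesis using finite_linear_divisors[OF j c(2)] finite_subset by blast
qed

end

section \<open>Primitivity with respect to the derivation\<close>

lemma (in field) noetherian_field: "noetherian_ring R"
proof (rule noetherian_ringI)
  fix I assume "ideal I R"
  then consider "I = {\<zero>}" | "I = carrier R" using all_ideals by blast
  then show "\<exists>A\<subseteq>carrier R. finite A \<and> I = Idl A"
  proof cases
    case 1 then show ?thesis using genideal_zero by (intro exI[of _ "{\<zero>}"]) simp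
  next
    case 2 then show ?thesis using genideal_one by (intro exI[of _ "{\<one>}"]) simp
  qed
qed

text \<open>The element \<open>a\<close> is adjoined first, since \<delta> makes it transcendental
  over the field of constants \<open>B\<^sub>0\<close>. The Noetherian property and the finiteness
  for every non-zero \<open>c\<close> then pass together from each subring to the next.\<close>

lemma finitely_generated_tower:
  fixes R (structure)
  assumes "domain R" "ring_derivation R \<delta>" and B0: "subfield B\<^sub>0 R" "\<And>b. b \<in> B\<^sub>0 \<Longrightarrow> \<delta> b = \<zero>"
    and char0: "\<And>n::nat. n > 0 \<Longrightarrow> [n] \<cdot> \<one> \<noteq> \<zero>"
    and a: "a \<in> carrier R" "\<delta> a \<noteq> \<zero>" and A: "finite A" "A \<subseteq> carrier R"
  shows "\<exists>B. subring B R \<and> B\<^sub>0 \<subseteq> B \<and> a \<in> B \<and> A \<subseteq> B \<and> noetherian_ring (R\<lparr>carrier := B\<rparr>) \<and>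
    (\<forall>c\<in>B. c \<noteq> \<zero> \<longrightarrow> finite {n::nat. \<exists>k::nat. \<exists>v\<in>B. (a \<ominus> [n] \<cdot> \<one>) \<otimes> v = c [^] k})"
proof -
  interpret domain R by fact
  have sub0: "subring B\<^sub>0 R" using B0(1) by (rule subfieldE(1))
  show ?thesis using A
  proof (induct A rule: finite_induct)
    case empty
    interpret ad: adjoin_derivation R B\<^sub>0 a \<delta>
      by (intro adjoin_derivation.intro adjoin.intro adjoin_axioms.intro adjoin_derivation_axioms.intro)
        (use assms sub0 in auto)
    have "field (R\<lparr>carrier := B\<^sub>0\<rparr>)" using B0(1) by (rule subfield_iff(2))
    then have "noetherian_ring (R\<lparr>carrier := ad.C\<rparr>)"
      by (intro ad.noetherian_adjoin field.noetherian_field)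
    then show ?case using ad.C_subring ad.B_C ad.x_C ad.finite_linear_divisors_of_powers
      by (intro exI[of _ ad.C]) auto
  next
    case (insert y A)
    then obtain B where B: "subring B R" "B\<^sub>0 \<subseteq> B" "a \<in> B" "A \<subseteq> B" "noetherian_ring (R\<lparr>carrier := B\<rparr>)"
      and fin: "\<And>c. c \<in> B \<Longrightarrow> c \<noteq> \<zero> \<Longrightarrow> finite {n::nat. \<exists>k::nat. \<exists>v\<in>B. (a \<ominus> [n] \<cdot> \<one>) \<otimes> v = c [^] k}"
      by auto
    interpret ad: adjoin R B y
      by (intro adjoin.intro adjoin_axioms.intro) (use assms B insert in auto)
    have nat: "[n] \<cdot> \<one> \<in> B" for n :: nat by (induct n) auto
    have "finite {n::nat. \<exists>k::nat. \<exists>v\<in>ad.C. (a \<ominus> [n] \<cdot> \<one>) \<otimes> v = c [^] k}"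
      if c: "c \<in> ad.C" "c \<noteq> \<zero>" for c
    proof -
      obtain b where b: "b \<in> B" "b \<noteq> \<zero>"
        "\<And>p v k. p \<in> B \<Longrightarrow> v \<in> ad.C \<Longrightarrow> p \<otimes> v = c [^] (k::nat) \<Longrightarrow> \<exists>l::nat. \<exists>w\<in>B. p \<otimes> w = b [^] l"
        by (rule ad.divides_power_descends[OF c]) blast
      have "{n::nat. \<exists>k::nat. \<exists>v\<in>ad.C. (a \<ominus> [n] \<cdot> \<one>) \<otimes> v = c [^] k}
        \<subseteq> {n::nat. \<exists>k::nat. \<exists>v\<in>B. (a \<ominus> [n] \<cdot> \<one>) \<otimes> v = b [^] k}"
      proof clarify
        fix n k :: nat and v assume "v \<in> ad.C" "(a \<ominus> [n] \<cdot> \<one>) \<otimes> v = c [^] k"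
        moreover have "a \<ominus> [n] \<cdot> \<one> \<in> B" by (rule ad.B_minus[OF B(3) nat])
        ultimately show "\<exists>k::nat. \<exists>v\<in>B. (a \<ominus> [n] \<cdot> \<one>) \<otimes> v = b [^] k"
          using b(3) by blast
      qed
      then show ?thesis using fin[OF b(1,2)] finite_subset by blast
    qed
    moreover have "insert y A \<subseteq> ad.C" "B\<^sub>0 \<subseteq> ad.C" "a \<in> ad.C" using B ad.B_C ad.x_C by auto
    ultimately show ?case using ad.C_subring ad.noetherian_adjoin[OF B(5)] by (intro exI[of _ ad.C]) auto
  qed
qed

text \<open>If a non-zero \<open>\<delta>\<close>-ideal \<open>I\<close> lay in the prime \<open>P\<close> below, \<open>P\<close> would be minimal over \<open>I\<close>, so that
  \<open>s m\<^sup>k \<in> I\<close> for some \<open>s \<notin> P\<close>; applying \<open>\<delta>\<close> lowers the least such \<open>k\<close>, since \<open>\<delta> m = \<delta> a \<notin> P\<close>.\<close>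

lemma delta_primitive_if_finite:
  fixes R (structure)
  assumes "domain R" "noetherian_ring R" "ring_derivation R \<delta>"
    and dim: "\<And>P. primeideal P R \<Longrightarrow> P \<noteq> {\<zero>} \<Longrightarrow> maximalideal P R"
    and unit: "\<And>n::nat. n > 0 \<Longrightarrow> [n] \<cdot> \<one> \<in> Units R"
    and a: "a \<in> carrier R" "\<delta> a \<noteq> \<zero>"
    and fin: "finite {n::nat. \<exists>k::nat. \<exists>v\<in>carrier R. (a \<ominus> [n] \<cdot> \<one>) \<otimes> v = \<delta> a [^] k}"
  shows "\<exists>P. maximalideal P R \<and> P \<noteq> {\<zero>} \<and> (\<forall>I. delta_ideal R \<delta> I \<and> I \<subseteq> P \<longrightarrow> I = {\<zero>})"
proof -
  interpret domain R by fact
  interpret d: ring_derivation R \<delta> by fact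
  obtain n where n: "n \<notin> {n::nat. \<exists>k::nat. \<exists>v\<in>carrier R. (a \<ominus> [n] \<cdot> \<one>) \<otimes> v = \<delta> a [^] k}"
    using ex_new_if_finite[OF infinite_UNIV_nat fin] by blast
  define m where "m = a \<ominus> d.\<nu> n"
  define t where "t = \<delta> a"
  have t: "t \<in> carrier R" "t \<noteq> \<zero>" and m: "m \<in> carrier R" using a by (auto simp: t_def m_def)
  have dm: "\<delta> m = t" using a by (simp add: m_def t_def d.\<delta>_minus) (simp add: a_minus_def)
  have m0: "m \<noteq> \<zero>" using dm t by auto
  \<comment> \<open>By the choice of \<open>n\<close> no power of \<delta> a is a multiple of
    \<open>m\<close>, so a prime above \<open>m\<close> can avoid all these powers.\<close>
  have "PIdl m \<inter> range (\<lambda>k::nat. t [^] k) = {}"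
    using n m by (auto simp: cgenideal_def m_def t_def m_comm) (metis m_comm m m_def)
  moreover have "\<one> \<in> range (\<lambda>k::nat. t [^] k)" by (rule range_eqI[of _ _ 0]) simp
  moreover have "range (\<lambda>k::nat. t [^] k) \<subseteq> carrier R" using t by auto
  moreover have "y \<otimes> z \<in> range (\<lambda>k::nat. t [^] k)"
    if yz: "y \<in> range (\<lambda>k::nat. t [^] k)" "z \<in> range (\<lambda>k::nat. t [^] k)" for y z
  proof -
    obtain k l :: nat where "y = t [^] k" "z = t [^] l" using yz by blast
    then have "y \<otimes> z = t [^] (k + l)" using t by (simp add: nat_pow_mult)
    then show ?thesis by blast
  qed
  ultimately obtain P where P: "primeideal P R" "PIdl m \<subseteq> P" "P \<inter> range (\<lambda>k::nat. t [^] k) = {}"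
    using noetherian_prime_avoidance[OF is_cring assms(2) cgenideal_ideal[OF m], of "range (\<lambda>k::nat. t [^] k)"]
    by blast
  interpret P: primeideal P R by fact
  have mP: "m \<in> P" using P(2) cgenideal_self[OF m] by blast
  have tP: "t \<notin> P" using P(3) t(1) by (metis IntI empty_iff nat_pow_eone rangeI)
  have P0: "P \<noteq> {\<zero>}" using mP m0 by auto
  have Pmax: "maximalideal P R" using dim[OF P(1) P0] .
  have "I = {\<zero>}" if I: "delta_ideal R \<delta> I" "I \<subseteq> P" for I
  proof (rule ccontr)
    assume I0: "I \<noteq> {\<zero>}"
    have id: "ideal I R" and dI: "\<And>y. y \<in> I \<Longrightarrow> \<delta> y \<in> I" using I(1) by (auto simp: delta_ideal_def)
    interpret I: ideal I R by fact
    \<comment> \<open>If \<open>I\<close> missed \<open>S\<close>, some prime over \<open>I\<close>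
      missing \<open>S\<close> would lie inside \<open>P\<close> without containing
      \<open>m\<close>. In dimension one it would be maximal and hence equal to
      \<open>P\<close>.\<close>
    define S where "S = {s \<otimes> m [^] k | s k. s \<in> carrier R \<and> s \<notin> P \<and> k \<in> (UNIV :: nat set)}"
    have one: "\<one> \<notin> P" using P.I_notcarr P.one_imp_carrier by blast
    have "I \<inter> S \<noteq> {}"
    proof
      assume disj: "I \<inter> S = {}"
      have "\<one> \<in> S" unfolding S_def using one by (auto intro!: exI[of _ \<one>] exI[of _ "0::nat"])
      moreover have "S \<subseteq> carrier R" using m by (auto simp: S_def)
      moreover have "y \<otimes> z \<in> S" if yz: "y \<in> S" "z \<in> S" for y z
      proof -
        obtain s k s' k' where h: "s \<in> carrier R" "s \<notin> P" "s' \<in> carrier R" "s' \<notin> P"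
          "y = s \<otimes> m [^] (k::nat)" "z = s' \<otimes> m [^] (k'::nat)" using yz by (auto simp: S_def)
        have "y \<otimes> z = (s \<otimes> s') \<otimes> (m [^] k \<otimes> m [^] k')" unfolding h(5,6) using h m by (simp add: m_ac)
        then have "y \<otimes> z = (s \<otimes> s') \<otimes> m [^] (k + k')" using m by (simp add: nat_pow_mult)
        moreover have "s \<otimes> s' \<notin> P" using h P.I_prime by blast
        ultimately show ?thesis unfolding S_def using h by blast
      qed
      ultimately obtain Q where Q: "primeideal Q R" "I \<subseteq> Q" "Q \<inter> S = {}"
        using noetherian_prime_avoidance[OF is_cring assms(2) id, of S] disj by blast
      interpret Q: primeideal Q R by fact
      have "Q \<subseteq> P"
      proof
        fix y assume y: "y \<in> Q"
        show "y \<in> P"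
        proof (rule ccontr)
          assume "y \<notin> P"
          then have "y \<otimes> m [^] (0::nat) \<in> S" unfolding S_def using Q.Icarr[OF y] by blast
          then show False using y Q.Icarr[OF y] Q(3) by auto
        qed
      qed
      moreover have "Q \<noteq> {\<zero>}" using Q(2) I0 I.zero_closed by blast
      then have "maximalideal Q R" using dim Q(1) by blast
      ultimately have "Q = P" using maximalideal.I_maximal[OF _ P.is_ideal] P.a_subset P.I_notcarr by metis
      moreover have "\<one> \<otimes> m [^] (1::nat) \<in> S" unfolding S_def using one by blast
      ultimately show False using Q(3) mP m by auto
    qed
    then have ex: "\<exists>k::nat. \<exists>s\<in>carrier R. s \<notin> P \<and> s \<otimes> m [^] k \<in> I" by (auto simp: S_def)
    define k where "k = (LEAST k::nat. \<exists>s\<in>carrier R. s \<notin> P \<and> s \<otimes> m [^] k \<in> I)"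
    obtain s where s: "s \<in> carrier R" "s \<notin> P" "s \<otimes> m [^] k \<in> I" using LeastI_ex[OF ex] unfolding k_def by blast
    have least: "k \<le> j" if "s' \<in> carrier R" "s' \<notin> P" "s' \<otimes> m [^] j \<in> I" for j s'
      unfolding k_def using that by (intro Least_le) blast
    show False
    proof (cases k)
      case 0
      then show False using s I(2) by auto
    next
      case (Suc j)
      have c: "m [^] j \<in> carrier R" "d.\<nu> (Suc j) \<in> carrier R" "\<delta> s \<in> carrier R"
        using m s(1) by (simp_all del: add.nat_pow_Suc)
      have "\<delta> (s \<otimes> m [^] Suc j) = \<delta> s \<otimes> m [^] Suc j \<oplus> s \<otimes> (d.\<nu> (Suc j) \<otimes> m [^] j \<otimes> t)"
        using d.\<delta>_mult[OF s(1), of "m [^] Suc j"] d.\<delta>_pow[OF m, of j] m dm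
        by (simp del: add.nat_pow_Suc nat_pow_Suc)
      \<comment> \<open>Subtracting \<delta> s times the element cancels the term in which \<delta>
        acts on \<open>s\<close>. What remains is \<open>m^j\<close> times a product of elements
        outside the prime \<open>P\<close>; the integer factor is outside because it is a
        unit.\<close>
      then have "s \<otimes> \<delta> (s \<otimes> m [^] Suc j) \<ominus> \<delta> s \<otimes> (s \<otimes> m [^] Suc j)
          = (s \<otimes> s \<otimes> d.\<nu> (Suc j) \<otimes> t) \<otimes> m [^] j"
        unfolding nat_pow_Suc using c s(1) m t by algebra
      moreover have sI: "s \<otimes> m [^] Suc j \<in> I" using s(3) Suc by simp
      have "s \<otimes> \<delta> (s \<otimes> m [^] Suc j) \<ominus> \<delta> s \<otimes> (s \<otimes> m [^] Suc j) \<in> I"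
        by (rule I.minus_mem[OF I.I_l_closed[OF dI[OF sI] s(1)] I.I_l_closed[OF sI c(3)]])
      ultimately have "(s \<otimes> s \<otimes> d.\<nu> (Suc j) \<otimes> t) \<otimes> m [^] j \<in> I" by simp
      moreover have "d.\<nu> (Suc j) \<notin> P"
        using unit[of "Suc j"] P.I_notcarr P.one_imp_carrier P.I_l_closed
        by (metis Units_closed Units_inv_closed Units_l_inv zero_less_Suc)
      then have "s \<otimes> s \<otimes> d.\<nu> (Suc j) \<otimes> t \<notin> P"
        using P.I_prime s tP t c by (metis m_closed)
      ultimately show False using least[of "s \<otimes> s \<otimes> d.\<nu> (Suc j) \<otimes> t" j] s c t Suc by (simp del: add.nat_pow_Suc)
    qed
  qed
  then show ?thesis using Pmax P0 by blast
qed

section \<open>Left ideals and cyclic modules\<close>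

definition left_ideal :: "('s, 'c) ring_scheme \<Rightarrow> 's set \<Rightarrow> bool" where
  "left_ideal S L \<longleftrightarrow> L \<subseteq> carrier S \<and> \<zero>\<^bsub>S\<^esub> \<in> L \<and> (\<forall>x\<in>L. \<forall>y\<in>L. x \<oplus>\<^bsub>S\<^esub> y \<in> L) \<and>
     (\<forall>s\<in>carrier S. \<forall>x\<in>L. s \<otimes>\<^bsub>S\<^esub> x \<in> L)"

lemma (in left_module) left_ideal_transporter:
  assumes "submodule W R M" "x \<in> carrier M"
  shows "left_ideal R {s \<in> carrier R. s \<odot>\<^bsub>M\<^esub> x \<in> W}"
  using assms unfolding submodule_iff left_ideal_def
  by (auto simp: smult_l_null smult_l_distr smult_assoc)

lemma (in left_module) zero_submodule: "submodule {\<zero>\<^bsub>M\<^esub>} R M"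
proof -
  have "s \<odot>\<^bsub>M\<^esub> \<zero>\<^bsub>M\<^esub> = \<zero>\<^bsub>M\<^esub>" if "s \<in> carrier R" for s
    using smult_r_distr[OF that M.zero_closed M.zero_closed] that
      M.add.l_cancel_one[of "s \<odot>\<^bsub>M\<^esub> \<zero>\<^bsub>M\<^esub>" "s \<odot>\<^bsub>M\<^esub> \<zero>\<^bsub>M\<^esub>"] by simp
  then show ?thesis by (simp add: submodule_iff)
qed

text \<open>Through \<open>s \<mapsto> s x\<close> the submodules of a module generated by
  \<open>x\<close> correspond to the left ideals above the annihilator of \<open>x\<close>.\<close>

lemma (in left_module) artinian_if_dcc:
  assumes x: "x \<in> carrier M" "carrier M = {s \<odot>\<^bsub>M\<^esub> x | s. s \<in> carrier R}"
    and dcc: "\<And>W. (\<And>i::nat. left_ideal R (W i)) \<Longrightarrow> (\<And>i. W (Suc i) \<subseteq> W i) \<Longrightarrow>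
      (\<And>i. {s \<in> carrier R. s \<odot>\<^bsub>M\<^esub> x = \<zero>\<^bsub>M\<^esub>} \<subseteq> W i) \<Longrightarrow> \<exists>n. \<forall>i\<ge>n. W i = W n"
  shows "artinian_module R M"
  unfolding artinian_module_def
proof (intro conjI allI impI)
  show "left_module R M" by (rule left_module_axioms)
  fix W :: "nat \<Rightarrow> 'm set"
  assume W: "(\<forall>i. submodule (W i) R M) \<and> (\<forall>i. W (Suc i) \<subseteq> W i)"
  define L where "L i = {s \<in> carrier R. s \<odot>\<^bsub>M\<^esub> x \<in> W i}" for i
  have W_sub: "W i \<subseteq> carrier M" "\<zero>\<^bsub>M\<^esub> \<in> W i" for i using W by (auto simp: submodule_iff)
  have "\<exists>n. \<forall>i\<ge>n. L i = L n"
  proof (rule dcc)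
    fix i
    show "left_ideal R (L i)" unfolding L_def using W x(1) by (intro left_ideal_transporter) auto
    show "L (Suc i) \<subseteq> L i" using W by (auto simp: L_def)
    show "{s \<in> carrier R. s \<odot>\<^bsub>M\<^esub> x = \<zero>\<^bsub>M\<^esub>} \<subseteq> L i" using W_sub by (auto simp: L_def)
  qed
  then obtain n where n: "\<forall>i\<ge>n. L i = L n" by blast
  have img: "W i = (\<lambda>s. s \<odot>\<^bsub>M\<^esub> x) ` L i" for i
  proof
    show "(\<lambda>s. s \<odot>\<^bsub>M\<^esub> x) ` L i \<subseteq> W i" by (auto simp: L_def)
    show "W i \<subseteq> (\<lambda>s. s \<odot>\<^bsub>M\<^esub> x) ` L i"
    proof
      fix w assume w: "w \<in> W i"
      then have "w \<in> carrier M" using W_sub by blast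
      then obtain s where "s \<in> carrier R" "w = s \<odot>\<^bsub>M\<^esub> x" using x(2) by auto
      then show "w \<in> (\<lambda>s. s \<odot>\<^bsub>M\<^esub> x) ` L i" using w by (auto simp: L_def)
    qed
  qed
  have "W i = W n" if "i \<ge> n" for i
    unfolding img[of i] img[of n] using n[rule_format, OF that] by (rule arg_cong)
  note stab = this
  show "\<exists>n. \<forall>i\<ge>n. W i = W n" by (intro exI[of _ n] allI impI) (rule stab)
qed

section \<open>Cyclic modules as quotients of the ring by left ideals\<close>

definition quot_coset :: "('s, 'c) ring_scheme \<Rightarrow> 's set \<Rightarrow> 's \<Rightarrow> 's set" where
  "quot_coset S L s = {t \<in> carrier S. t \<ominus>\<^bsub>S\<^esub> s \<in> L}"

text \<open>Realised with cosets because \<open>diamond\<close> ranges over modules whose elements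
  are sets of ring elements. The operations pick representatives; \<open>Q_simps\<close> shows the
  choice to be immaterial.\<close>

definition quot_module :: "('s, 'c) ring_scheme \<Rightarrow> 's set \<Rightarrow> ('s, 's set) module" where
  "quot_module S L = (let c = quot_coset S L; rep = (\<lambda>Z. SOME s. s \<in> carrier S \<and> c s = Z) in
     \<lparr>carrier = c ` carrier S, monoid.mult = undefined, one = undefined, zero = c \<zero>\<^bsub>S\<^esub>,
      add = \<lambda>Z Y. c (rep Z \<oplus>\<^bsub>S\<^esub> rep Y), smult = \<lambda>s Z. c (s \<otimes>\<^bsub>S\<^esub> rep Z)\<rparr>)"

locale left_quotient = ring S for S (structure) +
  fixes L :: "'a set"
  assumes L: "left_ideal S L"
begin

abbreviation c :: "'a \<Rightarrow> 'a set" where "c \<equiv> quot_coset S L"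
abbreviation Q :: "('a, 'a set) module" where "Q \<equiv> quot_module S L"

lemma Lc [simp]: "x \<in> L \<Longrightarrow> x \<in> carrier S" using L by (auto simp: left_ideal_def)
lemma L_zero [simp]: "\<zero> \<in> L" using L by (auto simp: left_ideal_def)
lemma L_add: "x \<in> L \<Longrightarrow> y \<in> L \<Longrightarrow> x \<oplus> y \<in> L" using L by (auto simp: left_ideal_def)
lemma L_mult: "s \<in> carrier S \<Longrightarrow> x \<in> L \<Longrightarrow> s \<otimes> x \<in> L" using L by (auto simp: left_ideal_def)
lemma L_neg: "x \<in> L \<Longrightarrow> \<ominus> x \<in> L" using L_mult[of "\<ominus> \<one>" x] by (simp add: l_minus)

lemma coset_eq_iff:
  assumes "s \<in> carrier S" "t \<in> carrier S" shows "c s = c t \<longleftrightarrow> s \<ominus> t \<in> L"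
proof
  assume "c s = c t"
  moreover have "s \<in> c s" using assms by (simp add: quot_coset_def a_minus_def r_neg)
  ultimately show "s \<ominus> t \<in> L" by (simp add: quot_coset_def)
next
  assume st: "s \<ominus> t \<in> L"
  have ts: "t \<ominus> s \<in> L"
    using L_neg[OF st] assms by (simp add: a_minus_def minus_add a_comm)
  have *: "r \<ominus> v \<in> L" if "r \<in> carrier S" "u \<in> carrier S" "v \<in> carrier S" "r \<ominus> u \<in> L" "u \<ominus> v \<in> L" for r u v
  proof -
    have "r \<ominus> v = (r \<ominus> u) \<oplus> (u \<ominus> v)" using that by (simp add: a_minus_def a_assoc r_neg1 r_neg2)
    then show ?thesis using L_add that by simp
  qed
  show "c s = c t" unfolding quot_coset_def using *[OF _ assms _ st] *[OF _ assms(2,1) _ ts] by blast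
qed

lemma coset_zero: "x \<in> L \<Longrightarrow> c x = c \<zero>"
  by (simp add: coset_eq_iff a_minus_def)

lemma rep:
  assumes "s \<in> carrier S"
  shows "(SOME t. t \<in> carrier S \<and> c t = c s) \<in> carrier S" "c (SOME t. t \<in> carrier S \<and> c t = c s) = c s"
  using someI[of "\<lambda>t. t \<in> carrier S \<and> c t = c s" s] assms by auto

lemma Q_simps [simp]:
  "carrier Q = c ` carrier S" "\<zero>\<^bsub>Q\<^esub> = c \<zero>"
  "s \<in> carrier S \<Longrightarrow> t \<in> carrier S \<Longrightarrow> c s \<oplus>\<^bsub>Q\<^esub> c t = c (s \<oplus> t)"
  "r \<in> carrier S \<Longrightarrow> s \<in> carrier S \<Longrightarrow> r \<odot>\<^bsub>Q\<^esub> c s = c (r \<otimes> s)"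
proof -
  show "carrier Q = c ` carrier S" "\<zero>\<^bsub>Q\<^esub> = c \<zero>" by (simp_all add: quot_module_def Let_def)
next
  assume st: "s \<in> carrier S" "t \<in> carrier S"
  let ?s = "SOME u. u \<in> carrier S \<and> c u = c s" and ?t = "SOME u. u \<in> carrier S \<and> c u = c t"
  note rs = rep[OF st(1)] and rt = rep[OF st(2)]
  have "(?s \<oplus> ?t) \<ominus> (s \<oplus> t) = (?s \<ominus> s) \<oplus> (?t \<ominus> t)"
    using rs(1) rt(1) st by (simp add: a_minus_def minus_add a_ac)
  moreover have "?s \<ominus> s \<in> L" "?t \<ominus> t \<in> L"
    using rs rt st coset_eq_iff by auto
  ultimately have "c (?s \<oplus> ?t) = c (s \<oplus> t)" using rs(1) rt(1) st L_add by (simp add: coset_eq_iff)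
  then show "c s \<oplus>\<^bsub>Q\<^esub> c t = c (s \<oplus> t)" by (simp add: quot_module_def Let_def)
next
  assume st: "r \<in> carrier S" "s \<in> carrier S"
  let ?s = "SOME u. u \<in> carrier S \<and> c u = c s"
  note rs = rep[OF st(2)]
  have "r \<otimes> ?s \<ominus> r \<otimes> s = r \<otimes> (?s \<ominus> s)" using rs(1) st by (simp add: a_minus_def r_distr r_minus)
  moreover have "?s \<ominus> s \<in> L" using rs st coset_eq_iff by auto
  ultimately have "c (r \<otimes> ?s) = c (r \<otimes> s)" using rs(1) st L_mult by (simp add: coset_eq_iff)
  then show "r \<odot>\<^bsub>Q\<^esub> c s = c (r \<otimes> s)" by (simp add: quot_module_def Let_def)
qed

lemma quot_left_module: "left_module S Q"
proof -
  have "abelian_group Q"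
  proof (rule abelian_groupI)
    fix Z assume "Z \<in> carrier Q"
    then obtain s where s: "Z = c s" "s \<in> carrier S" by auto
    show "\<exists>Y\<in>carrier Q. Y \<oplus>\<^bsub>Q\<^esub> Z = \<zero>\<^bsub>Q\<^esub>"
      by (rule bexI[of _ "c (\<ominus> s)"]) (use s in \<open>auto simp: l_neg\<close>)
  qed (auto simp: a_ac)
  then show ?thesis
    using ring_axioms
    by (intro left_module.intro left_module_axioms.intro)
       (auto simp: l_distr r_distr m_assoc)
qed

lemma quot_cyclic: "cyclic_module S Q"
  unfolding cyclic_module_def
proof (intro conjI bexI)
  show "left_module S Q" by (rule quot_left_module)
  show "c \<one> \<in> carrier Q" by simp
  show "carrier Q = {s \<odot>\<^bsub>Q\<^esub> c \<one> |s. s \<in> carrier S}"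
  proof -
    have "s \<odot>\<^bsub>Q\<^esub> c \<one> = c s" if "s \<in> carrier S" for s using that by simp
    then have "{s \<odot>\<^bsub>Q\<^esub> c \<one> |s. s \<in> carrier S} = {c s |s. s \<in> carrier S}" by metis
    then show ?thesis by auto
  qed
qed

lemma mem_coset_image_iff:
  assumes "left_ideal S W" "L \<subseteq> W" "s \<in> carrier S" shows "c s \<in> c ` W \<longleftrightarrow> s \<in> W"
proof
  assume "c s \<in> c ` W"
  then obtain w where w: "w \<in> W" "c s = c w" by blast
  have wc: "w \<in> carrier S" using w assms(1) by (auto simp: left_ideal_def)
  then have "s \<ominus> w \<in> W" using w(2) coset_eq_iff[OF assms(3) wc] assms(2) by auto
  then have "(s \<ominus> w) \<oplus> w \<in> W" using assms(1) w by (auto simp: left_ideal_def)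
  then show "s \<in> W" using assms(3) wc by (simp add: a_minus_def a_assoc l_neg)
qed auto

lemma submodule_image:
  assumes "left_ideal S W" shows "submodule (c ` W) S Q"
proof -
  interpret Q: left_module S Q by (rule quot_left_module)
  have W: "W \<subseteq> carrier S" "\<zero> \<in> W" "\<And>x y. x \<in> W \<Longrightarrow> y \<in> W \<Longrightarrow> x \<oplus> y \<in> W"
    "\<And>s x. s \<in> carrier S \<Longrightarrow> x \<in> W \<Longrightarrow> s \<otimes> x \<in> W" using assms by (auto simp: left_ideal_def)
  have Wc: "\<And>x. x \<in> W \<Longrightarrow> x \<in> carrier S" using W(1) by blast
  show ?thesis unfolding Q.submodule_iff using W(2-4) Wc by auto
qed

lemma submodule_preimage:
  assumes "submodule W S Q"
  obtains V where "left_ideal S V" "L \<subseteq> V" "W = c ` V"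
proof
  interpret Q: left_module S Q by (rule quot_left_module)
  have W: "W \<subseteq> c ` carrier S" "c \<zero> \<in> W" "\<And>x y. x \<in> W \<Longrightarrow> y \<in> W \<Longrightarrow> x \<oplus>\<^bsub>Q\<^esub> y \<in> W"
    "\<And>s x. s \<in> carrier S \<Longrightarrow> x \<in> W \<Longrightarrow> s \<odot>\<^bsub>Q\<^esub> x \<in> W" using assms by (auto simp: Q.submodule_iff)
  let ?V = "{s \<in> carrier S. c s \<in> W}"
  show "left_ideal S ?V" 
  proof -
    have "c (x \<oplus> y) \<in> W" if "x \<in> carrier S" "c x \<in> W" "y \<in> carrier S" "c y \<in> W" for x y
      using W(3)[OF that(2,4)] that by simp
    moreover have "c (s \<otimes> x) \<in> W" if "s \<in> carrier S" "x \<in> carrier S" "c x \<in> W" for s x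
      using W(4)[OF that(1,3)] that by simp
    ultimately show ?thesis unfolding left_ideal_def using W(2) by simp
  qed
  show "L \<subseteq> ?V"
  proof
    fix x assume "x \<in> L"
    then show "x \<in> ?V" using coset_zero[of x] W(2) by simp
  qed
  show "W = c ` ?V" using W(1) by blast
qed

lemma image_eq_iff:
  assumes "left_ideal S V" "L \<subseteq> V" "left_ideal S W" "L \<subseteq> W"
  shows "c ` V = c ` W \<longleftrightarrow> V = W"
proof
  assume eq: "c ` V = c ` W"
  have "V \<subseteq> carrier S" "W \<subseteq> carrier S" using assms by (auto simp: left_ideal_def)
  then have "s \<in> V \<longleftrightarrow> s \<in> W" for s
    using mem_coset_image_iff[OF assms(1,2), of s] mem_coset_image_iff[OF assms(3,4), of s] eq by auto
  then show "V = W" by blast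
qed simp

lemma image_L: "c ` L = {c \<zero>}"
proof
  show "c ` L \<subseteq> {c \<zero>}" by (auto dest: coset_zero)
  show "{c \<zero>} \<subseteq> c ` L" using L_zero by blast
qed

lemma quot_essential_extension:
  assumes V: "left_ideal S V" "L \<subset> V"
    and simple: "\<And>W. left_ideal S W \<Longrightarrow> L \<subseteq> W \<Longrightarrow> W \<subseteq> V \<Longrightarrow> W = L \<or> W = V"
    and ess: "\<And>W. left_ideal S W \<Longrightarrow> L \<subseteq> W \<Longrightarrow> V \<inter> W = L \<Longrightarrow> W = L"
  shows "essential_extension_of_simple S Q"
proof -
  interpret Q: left_module S Q by (rule quot_left_module)
  have VL: "L \<subseteq> V" using V by blast
  have Vsub: "submodule (c ` V) S Q" by (rule submodule_image[OF V(1)])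
  have "simple_module S (Q\<lparr>carrier := c ` V\<rparr>)"
    unfolding Q.simple_submodule_iff[OF Vsub]
  proof (intro conjI allI impI)
    show "c ` V \<noteq> {\<zero>\<^bsub>Q\<^esub>}" using image_eq_iff[OF V(1) VL L] V(2) by (auto simp: image_L)
    fix W' assume W': "W' \<subseteq> c ` V \<and> submodule W' S Q"
    then have "submodule W' S Q" by blast
    then obtain W where W: "left_ideal S W" "L \<subseteq> W" "W' = c ` W" by (rule submodule_preimage)
    have "W \<subseteq> carrier S" using W(1) by (auto simp: left_ideal_def)
    then have "W \<subseteq> V" using mem_coset_image_iff[OF V(1) VL] W' W(3) by blast
    then have "W = L \<or> W = V" using simple W by blast
    then show "W' = {\<zero>\<^bsub>Q\<^esub>} \<or> W' = c ` V" using image_L W(3) by auto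
  qed
  moreover have "essential_submodule S Q (c ` V)"
    unfolding essential_submodule_def
  proof (intro conjI allI impI notI)
    show "submodule (c ` V) S Q" by (rule Vsub)
    fix W' assume W': "submodule W' S Q \<and> W' \<noteq> {\<zero>\<^bsub>Q\<^esub>}" "c ` V \<inter> W' = {\<zero>\<^bsub>Q\<^esub>}"
    then have "submodule W' S Q" by blast
    then obtain W where W: "left_ideal S W" "L \<subseteq> W" "W' = c ` W" by (rule submodule_preimage)
    have Wc: "W \<subseteq> carrier S" using W(1) by (auto simp: left_ideal_def)
    have "V \<inter> W \<subseteq> L"
    proof
      fix s assume s: "s \<in> V \<inter> W"
      then have "c s \<in> c ` L" using W'(2) W(3) unfolding image_L by auto
      then show "s \<in> L" using mem_coset_image_iff[OF L order.refl, of s] s Wc by blast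
    qed
    then have "W = L" using ess W VL by blast
    then show False using W'(1) W(3) image_L by simp
  qed
  ultimately show ?thesis unfolding essential_extension_of_simple_def using quot_left_module by blast
qed

lemma quot_artinian_dcc:
  assumes "artinian_module S Q"
    and W: "\<And>i::nat. left_ideal S (W i)" "\<And>i. W (Suc i) \<subseteq> W i" "\<And>i. L \<subseteq> W i"
  shows "\<exists>n. \<forall>i\<ge>n. W i = W n"
proof -
  have "(\<forall>i. submodule (c ` W i) S Q) \<and> (\<forall>i. c ` W (Suc i) \<subseteq> c ` W i)"
    using submodule_image W(1,2) by (simp add: image_mono)
  then have "\<exists>n. \<forall>i\<ge>n. c ` W i = c ` W n"
    using assms(1) unfolding artinian_module_def by (elim conjE allE[of _ "\<lambda>i. c ` W i"]) auto
  then show ?thesis using image_eq_iff[OF W(1,3) W(1,3)] by simp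
qed

end

section \<open>Left ideals of the differential operator ring\<close>

context differential_ring
begin

section \<open>Degrees and leading coefficients of differential operators\<close>

abbreviation "mono_P \<equiv> up_ring.monom P"

abbreviation "cf \<equiv> up_ring.coeff P"

abbreviation \<iota> :: "'a \<Rightarrow> nat \<Rightarrow> 'a" where "\<iota> a \<equiv> mono_P a 0"

lemma ring_derivation: "ring_derivation R \<delta>"
  by (intro ring_derivation.intro ring_derivation_axioms.intro R.is_cring)
     (auto simp: delta_add delta_mult)

text \<open>Operators of degree less than \<open>n\<close>, zero included. For \<open>p\<close> in
  \<open>below (Suc n)\<close> the value \<open>cf p n\<close> is a leading coefficient that may
  vanish, which spares case distinctions on the exact degree.\<close>

definition below :: "nat \<Rightarrow> (nat \<Rightarrow> 'a) set" where
  "below n = {p \<in> carrier P. \<forall>i\<ge>n. cf p i = \<zero>}"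

lemma below_carrier [simp]: "p \<in> below n \<Longrightarrow> p \<in> carrier P" by (simp add: below_def)

lemma below_0: "p \<in> below 0 \<Longrightarrow> p = \<zero>\<^bsub>P\<^esub>"
  by (rule up_eqI) (auto simp: below_def simp del: below_carrier)

lemma below_mono: "p \<in> below n \<Longrightarrow> n \<le> m \<Longrightarrow> p \<in> below m" by (auto simp: below_def simp del: below_carrier)

lemma below_deg: "p \<in> carrier P \<Longrightarrow> p \<in> below (Suc (deg R p))"
  by (auto simp: below_def simp del: below_carrier intro: deg_aboveD)

lemma below_add: "p \<in> below n \<Longrightarrow> q \<in> below n \<Longrightarrow> p \<oplus>\<^bsub>P\<^esub> q \<in> below n"
  by (auto simp: below_def simp del: below_carrier)

lemma below_smult: "a \<in> carrier R \<Longrightarrow> p \<in> below n \<Longrightarrow> a \<odot>\<^bsub>P\<^esub> p \<in> below n"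
  by (auto simp: below_def simp del: below_carrier)

lemma below_\<iota>: "a \<in> carrier R \<Longrightarrow> \<iota> a \<in> below (Suc 0)"
  by (auto simp: below_def simp del: below_carrier)

lemma below_minus_lead:
  assumes "p \<in> below (Suc n)" "q \<in> below (Suc n)" "cf p n = cf q n"
  shows "p \<ominus>\<^bsub>P\<^esub> q \<in> below n"
proof -
  have "cf (p \<ominus>\<^bsub>P\<^esub> q) i = \<zero>" if "i \<ge> n" for i
    using assms that by (cases "i = n") (auto simp: below_def R.r_right_minus_eq simp del: below_carrier)
  then show ?thesis using assms by (simp add: below_def del: below_carrier)
qed

lemma T_below: "p \<in> below n \<Longrightarrow> T p \<in> below (Suc n)"
  by (auto simp: below_def coeff_T simp del: below_carrier split: nat.split)

lemma Tpow_lead: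
  assumes "p \<in> below (Suc n)"
  shows "(T ^^ k) p \<in> below (Suc (n + k)) \<and> cf ((T ^^ k) p) (n + k) = cf p n"
proof (induct k)
  case 0 then show ?case using assms by simp
next
  case (Suc k)
  let ?q = "(T ^^ k) p"
  have q: "?q \<in> carrier P" using Suc below_carrier by blast
  have "cf (T ?q) (Suc (n + k)) = cf ?q (n + k) \<oplus> \<delta> (cf ?q (Suc (n + k)))"
    using q by (simp add: coeff_T)
  also have "cf ?q (Suc (n + k)) = \<zero>" using Suc by (auto simp: below_def simp del: below_carrier)
  also have "cf ?q (n + k) \<oplus> \<delta> \<zero> = cf p n" using Suc assms by simp
  finally show ?case using Suc q T_below[of ?q "Suc (n + k)"] by simp
qed

text \<open>The second term in the expansion of \<open>\<theta>^(k+1) a\<close>: each further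
  \<theta> adds one \<delta> a, coming from the leading coefficient \<open>a\<close>.\<close>

lemma Tpow_\<iota>_second:
  assumes "a \<in> carrier R"
  shows "cf ((T ^^ Suc k) (\<iota> a)) k = ([Suc k] \<cdot> \<one>) \<otimes> \<delta> a"
proof (induct k)
  case 0 then show ?case using assms by (simp add: coeff_T)
next
  case (Suc k)
  let ?q = "(T ^^ Suc k) (\<iota> a)"
  have q: "?q \<in> carrier P" using assms by (intro Tpow_closed) simp
  have lead: "cf ?q (Suc k) = a" using Tpow_lead[OF below_\<iota>[OF assms], of "Suc k"] assms by simp
  have "cf (T ?q) (Suc k) = cf ?q k \<oplus> \<delta> (cf ?q (Suc k))"
    using q by (simp add: coeff_T del: funpow.simps)
  then have eq: "cf ((T ^^ Suc (Suc k)) (\<iota> a)) (Suc k) = ([Suc k] \<cdot> \<one>) \<otimes> \<delta> a \<oplus> \<delta> a"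
    unfolding lead Suc by simp
  have "[Suc k] \<cdot> \<one> \<in> carrier R" by (rule R.add.nat_pow_closed) simp
  then have "([Suc k] \<cdot> \<one>) \<otimes> \<delta> a \<oplus> \<delta> a = ([Suc k] \<cdot> \<one> \<oplus> \<one>) \<otimes> \<delta> a"
    using assms by (simp add: R.l_distr del: R.add.nat_pow_Suc)
  also have "[Suc k] \<cdot> \<one> \<oplus> \<one> = [Suc (Suc k)] \<cdot> \<one>" by simp
  finally show ?case unfolding eq .
qed

lemma split_lead:
  assumes "t \<in> below (Suc n)"
  obtains t' where "t' \<in> below n" "t = t' \<oplus>\<^bsub>P\<^esub> mono_P (cf t n) n"
    "\<And>i. i < n \<Longrightarrow> cf t' i = cf t i"
proof
  let ?m = "mono_P (cf t n) n"
  have t: "t \<in> carrier P" using assms by simp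
  have m: "?m \<in> below (Suc n)" using t by (auto simp: below_def simp del: below_carrier)
  show "t \<ominus>\<^bsub>P\<^esub> ?m \<in> below n" using t by (intro below_minus_lead[OF assms m]) simp
  show "t = (t \<ominus>\<^bsub>P\<^esub> ?m) \<oplus>\<^bsub>P\<^esub> ?m" using t by (simp add: a_minus_def P.a_assoc P.l_neg)
  show "cf (t \<ominus>\<^bsub>P\<^esub> ?m) i = cf t i" if "i < n" for i using t that by (simp add: a_minus_def)
qed

text \<open>Moving \<theta> past a coefficient only creates terms of lower degree, so top terms
  multiply as in a polynomial ring.\<close>

lemma mult_lead:
  assumes "t \<in> below (Suc i)" "q \<in> below (Suc j)"
  shows "t \<otimes>\<^bsub>D\<^esub> q \<in> below (Suc (i + j)) \<and> cf (t \<otimes>\<^bsub>D\<^esub> q) (i + j) = cf t i \<otimes> cf q j"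
proof -
  have weak: "t \<otimes>\<^bsub>D\<^esub> q \<in> below (n + j)" if "t \<in> below n" for t n
    using that
  proof (induct n arbitrary: t)
    case 0
    then show ?case using below_0[of t] assms by (simp add: D_zero_l) (simp add: below_def del: below_carrier)
  next
    case (Suc n)
    obtain t' where t': "t' \<in> below n" "t = t' \<oplus>\<^bsub>P\<^esub> mono_P (cf t n) n" using split_lead[OF Suc.prems] by metis
    have c: "cf t n \<in> carrier R" using Suc.prems by simp
    have "t \<otimes>\<^bsub>D\<^esub> q = t' \<otimes>\<^bsub>D\<^esub> q \<oplus>\<^bsub>P\<^esub> cf t n \<odot>\<^bsub>P\<^esub> (T ^^ n) q"
      using arg_cong[OF t'(2), of "\<lambda>u. u \<otimes>\<^bsub>D\<^esub> q"] below_carrier[OF t'(1)] assms c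
      by (simp add: D_l_add D_monom)
    moreover have "t' \<otimes>\<^bsub>D\<^esub> q \<in> below (Suc n + j)" using below_mono[OF Suc.hyps[OF t'(1)]] by simp
    moreover have "cf t n \<odot>\<^bsub>P\<^esub> (T ^^ n) q \<in> below (Suc n + j)"
      using Tpow_lead[OF assms(2), of n] c by (auto intro: below_smult simp: add.commute)
    ultimately show ?case using below_add by simp
  qed
  obtain t' where t': "t' \<in> below i" "t = t' \<oplus>\<^bsub>P\<^esub> mono_P (cf t i) i" using split_lead[OF assms(1)] by metis
  have c: "cf t i \<in> carrier R" using assms by simp
  have eq: "t \<otimes>\<^bsub>D\<^esub> q = t' \<otimes>\<^bsub>D\<^esub> q \<oplus>\<^bsub>P\<^esub> cf t i \<odot>\<^bsub>P\<^esub> (T ^^ i) q"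
    using arg_cong[OF t'(2), of "\<lambda>u. u \<otimes>\<^bsub>D\<^esub> q"] below_carrier[OF t'(1)] assms c
    by (simp add: D_l_add D_monom)
  have 1: "t' \<otimes>\<^bsub>D\<^esub> q \<in> below (i + j)" by (rule weak[OF t'(1)])
  then have 2: "cf (t' \<otimes>\<^bsub>D\<^esub> q) (i + j) = \<zero>" by (simp add: below_def del: below_carrier)
  have 3: "(T ^^ i) q \<in> below (Suc (i + j))" "cf ((T ^^ i) q) (i + j) = cf q j"
    using Tpow_lead[OF assms(2), of i] by (simp_all add: add.commute)
  show ?thesis
    unfolding eq using 2 3 c assms below_carrier[OF 1]
      below_add[OF below_mono[OF 1, of "Suc (i + j)"] below_smult[OF c 3(1)]] by simp
qed

text \<open>Made for the commutator with \<open>a\<close>: subtracting \<open>a t\<close> cancels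
  the first summand, and only the one with \<delta> a remains.\<close>

lemma mult_\<iota>_second:
  assumes "t \<in> below (Suc (Suc k))" "a \<in> carrier R"
  shows "cf (t \<otimes>\<^bsub>D\<^esub> \<iota> a) k = cf t k \<otimes> a \<oplus> cf t (Suc k) \<otimes> (([Suc k] \<cdot> \<one>) \<otimes> \<delta> a)"
proof -
  obtain t' where t': "t' \<in> below (Suc k)" "t = t' \<oplus>\<^bsub>P\<^esub> mono_P (cf t (Suc k)) (Suc k)"
    "\<And>i. i < Suc k \<Longrightarrow> cf t' i = cf t i" using split_lead[OF assms(1)] by metis
  have c: "cf t (Suc k) \<in> carrier R" using assms by simp
  have Tc: "(T ^^ Suc k) (\<iota> a) \<in> carrier P" using assms by (intro Tpow_closed) simp
  have eq: "t \<otimes>\<^bsub>D\<^esub> \<iota> a = t' \<otimes>\<^bsub>D\<^esub> \<iota> a \<oplus>\<^bsub>P\<^esub> cf t (Suc k) \<odot>\<^bsub>P\<^esub> (T ^^ Suc k) (\<iota> a)"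
    using arg_cong[OF t'(2), of "\<lambda>u. u \<otimes>\<^bsub>D\<^esub> \<iota> a"] below_carrier[OF t'(1)] assms c
    by (simp add: D_l_add D_monom del: funpow.simps)
  have "cf (t' \<otimes>\<^bsub>D\<^esub> \<iota> a) k = cf t k \<otimes> a"
    using mult_lead[OF t'(1) below_\<iota>[OF assms(2)]] t'(3)[of k] assms by simp
  then show ?thesis
    unfolding eq using c Tc Tpow_\<iota>_second[OF assms(2), of k] t'(1) assms D_closed
    by (simp del: funpow.simps R.add.nat_pow_Suc)
qed

lemma finsum_mem:
  assumes "\<zero>\<^bsub>P\<^esub> \<in> L" "\<And>x y. x \<in> L \<Longrightarrow> y \<in> L \<Longrightarrow> x \<oplus>\<^bsub>P\<^esub> y \<in> L" "L \<subseteq> carrier P" "finite A" "\<And>i. i \<in> A \<Longrightarrow> f i \<in> L"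
  shows "(\<Oplus>\<^bsub>P\<^esub>i\<in>A. f i) \<in> L"
  using assms(4,5)
proof (induct A rule: finite_induct)
  case empty then show ?case using assms(1) by simp
next
  case (insert x A)
  have "f \<in> A \<rightarrow> carrier P" "f x \<in> carrier P" using insert.prems assms(3) by auto
  then show ?case using insert assms(2) by simp
qed

text \<open>Left multiplications by \<open>R\<close> and by \<theta> generate all others, because
  \<open>s x\<close> is an \<open>R\<close>-combination of the elements
  \<open>\<theta>^i x\<close>.\<close>

lemma left_ideal_D_iff:
  "left_ideal D L \<longleftrightarrow> L \<subseteq> carrier P \<and> \<zero>\<^bsub>P\<^esub> \<in> L \<and> (\<forall>x\<in>L. \<forall>y\<in>L. x \<oplus>\<^bsub>P\<^esub> y \<in> L) \<and>
     (\<forall>a\<in>carrier R. \<forall>x\<in>L. a \<odot>\<^bsub>P\<^esub> x \<in> L) \<and> (\<forall>x\<in>L. T x \<in> L)"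
proof
  assume L: "left_ideal D L"
  then have sub: "L \<subseteq> carrier P" and mult: "\<And>s x. s \<in> carrier P \<Longrightarrow> x \<in> L \<Longrightarrow> s \<otimes>\<^bsub>D\<^esub> x \<in> L"
    by (auto simp: left_ideal_def)
  have "a \<odot>\<^bsub>P\<^esub> x \<in> L" if "a \<in> carrier R" "x \<in> L" for a x
  proof -
    have "x \<in> carrier P" using that sub by blast
    then have "a \<odot>\<^bsub>P\<^esub> x = \<iota> a \<otimes>\<^bsub>D\<^esub> x" using that by (simp add: D_monom)
    then show ?thesis using mult that by simp
  qed
  moreover have "T x \<in> L" if "x \<in> L" for x
  proof -
    have x: "x \<in> carrier P" using that sub by blast
    then have "T x = mono_P \<one> (Suc 0) \<otimes>\<^bsub>D\<^esub> x" using that by (simp add: D_monom)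
    then show ?thesis using mult that by simp
  qed
  ultimately show "L \<subseteq> carrier P \<and> \<zero>\<^bsub>P\<^esub> \<in> L \<and> (\<forall>x\<in>L. \<forall>y\<in>L. x \<oplus>\<^bsub>P\<^esub> y \<in> L) \<and>
     (\<forall>a\<in>carrier R. \<forall>x\<in>L. a \<odot>\<^bsub>P\<^esub> x \<in> L) \<and> (\<forall>x\<in>L. T x \<in> L)"
    using L by (simp add: left_ideal_def)
next
  assume L: "L \<subseteq> carrier P \<and> \<zero>\<^bsub>P\<^esub> \<in> L \<and> (\<forall>x\<in>L. \<forall>y\<in>L. x \<oplus>\<^bsub>P\<^esub> y \<in> L) \<and>
     (\<forall>a\<in>carrier R. \<forall>x\<in>L. a \<odot>\<^bsub>P\<^esub> x \<in> L) \<and> (\<forall>x\<in>L. T x \<in> L)"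
  have "s \<otimes>\<^bsub>D\<^esub> x \<in> L" if s: "s \<in> carrier P" and x: "x \<in> L" for s x
  proof -
    have xc: "x \<in> carrier P" using x L by blast
    have "(T ^^ i) x \<in> L" for i using x L by (induct i) auto
    then show ?thesis
      unfolding D_mult[OF s xc order.refl] using L s by (intro finsum_mem) auto
  qed
  then show "left_ideal D L" using L by (simp add: left_ideal_def)
qed

lemma left_idealD:
  assumes "left_ideal D L"
  shows "x \<in> L \<Longrightarrow> x \<in> carrier P" "\<zero>\<^bsub>P\<^esub> \<in> L" "x \<in> L \<Longrightarrow> y \<in> L \<Longrightarrow> x \<oplus>\<^bsub>P\<^esub> y \<in> L"
    "a \<in> carrier R \<Longrightarrow> x \<in> L \<Longrightarrow> a \<odot>\<^bsub>P\<^esub> x \<in> L" "x \<in> L \<Longrightarrow> (T ^^ k) x \<in> L"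
    "x \<in> L \<Longrightarrow> y \<in> L \<Longrightarrow> x \<ominus>\<^bsub>P\<^esub> y \<in> L" "s \<in> carrier P \<Longrightarrow> x \<in> L \<Longrightarrow> s \<otimes>\<^bsub>D\<^esub> x \<in> L"
proof -
  note L = assms[unfolded left_ideal_D_iff]
  show c: "x \<in> L \<Longrightarrow> x \<in> carrier P" for x using L by blast
  show "\<zero>\<^bsub>P\<^esub> \<in> L" using L by blast
  show add: "x \<in> L \<Longrightarrow> y \<in> L \<Longrightarrow> x \<oplus>\<^bsub>P\<^esub> y \<in> L" for x y using L by blast
  show sm: "a \<in> carrier R \<Longrightarrow> x \<in> L \<Longrightarrow> a \<odot>\<^bsub>P\<^esub> x \<in> L" for a x using L by blast
  show "x \<in> L \<Longrightarrow> (T ^^ k) x \<in> L" using L by (induct k) auto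
  show "x \<in> L \<Longrightarrow> y \<in> L \<Longrightarrow> x \<ominus>\<^bsub>P\<^esub> y \<in> L"
  proof -
    assume xy: "x \<in> L" "y \<in> L"
    have "(\<ominus> \<one>) \<odot>\<^bsub>P\<^esub> y = \<ominus>\<^bsub>P\<^esub> y" using c[OF xy(2)] by (simp add: smult_l_minus)
    then show ?thesis using add[OF xy(1) sm[OF _ xy(2), of "\<ominus> \<one>"]] by (simp add: a_minus_def)
  qed
  show "s \<in> carrier P \<Longrightarrow> x \<in> L \<Longrightarrow> s \<otimes>\<^bsub>D\<^esub> x \<in> L" using assms by (simp add: left_ideal_def)
qed

end

context differential_ring
begin

section \<open>Differential simplicity implies the descending chain condition\<close>

definition lead_ideal :: "nat \<Rightarrow> (nat \<Rightarrow> 'a) set \<Rightarrow> 'a set" where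
  "lead_ideal n W = {cf p n | p. p \<in> W \<and> p \<in> below (Suc n)}"

lemma lead_ideal_ideal:
  assumes W: "left_ideal D W" shows "ideal (lead_ideal n W) R"
  unfolding R.ideal_iff
proof (intro conjI ballI)
  note W = left_idealD[OF W]
  show "lead_ideal n W \<subseteq> carrier R" using W by (auto simp: lead_ideal_def)
  have "cf \<zero>\<^bsub>P\<^esub> n = \<zero>" "\<zero>\<^bsub>P\<^esub> \<in> below (Suc n)" by (simp_all add: below_def del: below_carrier)
  then show "\<zero> \<in> lead_ideal n W" unfolding lead_ideal_def using W(2) by (metis (mono_tags, lifting) CollectI)
next
  note W = left_idealD[OF W]
  fix a b assume "a \<in> lead_ideal n W" "b \<in> lead_ideal n W"
  then obtain p q where pq: "p \<in> W" "p \<in> below (Suc n)" "a = cf p n" "q \<in> W" "q \<in> below (Suc n)" "b = cf q n"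
    by (auto simp: lead_ideal_def)
  have "a \<oplus> b = cf (p \<oplus>\<^bsub>P\<^esub> q) n" using pq by simp
  moreover have "p \<oplus>\<^bsub>P\<^esub> q \<in> W" "p \<oplus>\<^bsub>P\<^esub> q \<in> below (Suc n)" using pq W(3) below_add by auto
  ultimately show "a \<oplus> b \<in> lead_ideal n W" unfolding lead_ideal_def by blast
next
  note W = left_idealD[OF W]
  fix r b assume r: "r \<in> carrier R" and "b \<in> lead_ideal n W"
  then obtain q where q: "q \<in> W" "q \<in> below (Suc n)" "b = cf q n" by (auto simp: lead_ideal_def)
  have "r \<otimes> b = cf (r \<odot>\<^bsub>P\<^esub> q) n" using q r by simp
  moreover have "r \<odot>\<^bsub>P\<^esub> q \<in> W" "r \<odot>\<^bsub>P\<^esub> q \<in> below (Suc n)" using q r W(4) below_smult by auto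
  ultimately show "r \<otimes> b \<in> lead_ideal n W" unfolding lead_ideal_def by blast
qed

lemma lead_ideal_mono: "V \<subseteq> W \<Longrightarrow> lead_ideal n V \<subseteq> lead_ideal n W"
  by (auto simp: lead_ideal_def)

lemma lead_ideal_Suc:
  assumes W: "left_ideal D W" shows "lead_ideal n W \<subseteq> lead_ideal (Suc n) W"
proof
  fix a assume "a \<in> lead_ideal n W"
  then obtain p where p: "p \<in> W" "p \<in> below (Suc n)" "a = cf p n" by (auto simp: lead_ideal_def)
  then have "T p \<in> W" "T p \<in> below (Suc (Suc n))" "cf (T p) (Suc n) = a"
    using left_idealD(5)[OF W p(1), of 1] Tpow_lead[OF p(2), of 1] by auto
  then show "a \<in> lead_ideal (Suc n) W" unfolding lead_ideal_def by blast
qed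

lemma lead_ideal_le:
  assumes W: "left_ideal D W" and "n \<le> m" shows "lead_ideal n W \<subseteq> lead_ideal m W"
  using lift_Suc_mono_le[of "\<lambda>n. lead_ideal n W", OF lead_ideal_Suc[OF W] assms(2)] .

lemma lead_ideal_stabilizes:
  assumes "noetherian_ring R" "left_ideal D W"
  obtains N where "\<And>n. lead_ideal n W \<subseteq> lead_ideal N W"
proof -
  have "\<exists>N. \<forall>n\<ge>N. lead_ideal n W = lead_ideal N W"
    by (rule noetherian_ring.ideal_sequence_stabilizes[OF assms(1)])
      (rule lead_ideal_ideal[OF assms(2)], rule lead_ideal_Suc[OF assms(2)])
  then obtain N where N: "\<forall>n\<ge>N. lead_ideal n W = lead_ideal N W" by (elim exE)
  have "lead_ideal n W \<subseteq> lead_ideal N W" for n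
    using N[rule_format, of n] lead_ideal_le[OF assms(2), of n N] by (cases "n \<ge> N") auto
  then show thesis using that by blast
qed

text \<open>Modulo \<open>W'\<close> the module \<open>W\<close> is bounded in degree, since the leading ideals agree, and it is
  annihilated by a power of \<open>e\<close>, since the least degrees agree. So \<open>{r. rW \<subseteq> W'}\<close> is a non-zero
  \<open>\<delta>\<close>-ideal.\<close>

lemma left_ideal_eq_if_lead_eq:
  assumes dom: "domain R" and simple: "delta_simple R \<delta>"
    and W: "left_ideal D W" "left_ideal D W'" "W' \<subseteq> W"
    and lead: "\<And>n. lead_ideal n W \<subseteq> lead_ideal N W'"
    and m: "W \<inter> below m = {\<zero>\<^bsub>P\<^esub>}" "w\<^sub>0 \<in> W'" "w\<^sub>0 \<in> below (Suc m)" "cf w\<^sub>0 m \<noteq> \<zero>"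
  shows "W = W'"
proof -
  interpret R: domain R by fact
  note W1 = left_idealD[OF W(1)] and W2 = left_idealD[OF W(2)]
  define e where "e = cf w\<^sub>0 m"
  have e: "e \<in> carrier R" "e \<noteq> \<zero>" using m by (auto simp: e_def)
  \<comment> \<open>Degrees from \<open>N\<close> on can be removed modulo \<open>W'\<close>: the
    leading coefficients in \<open>W\<close> occur in \<open>W'\<close> at degree \<open>N\<close>,
    hence at each higher degree.\<close>
  have reduce: "\<exists>w'\<in>W'. w \<ominus>\<^bsub>P\<^esub> w' \<in> W \<inter> below N" if "w \<in> W" "w \<in> below n" for w n
    using that
  proof (induct n arbitrary: w)
    case 0
    then have "w = \<zero>\<^bsub>P\<^esub>" using below_0 by blast
    then show ?case using W2(2) W1(2) by (intro bexI[of _ "\<zero>\<^bsub>P\<^esub>"]) (auto simp: below_def a_minus_def simp del: below_carrier)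
  next
    case (Suc n)
    show ?case
    proof (cases "Suc n \<le> N")
      case True
      have "w \<ominus>\<^bsub>P\<^esub> \<zero>\<^bsub>P\<^esub> = w" using Suc.prems by (simp add: a_minus_def)
      then show ?thesis using below_mono[OF Suc.prems(2) True] Suc.prems(1) W2(2) by (intro bexI[of _ "\<zero>\<^bsub>P\<^esub>"]) auto
    next
      case False
      then have nN: "N \<le> n" by simp
      have "cf w n \<in> lead_ideal n W" unfolding lead_ideal_def using Suc.prems by blast
      then have "cf w n \<in> lead_ideal n W'" using lead[of n] lead_ideal_le[OF W(2) nN] by blast
      then obtain w1 where w1: "w1 \<in> W'" "w1 \<in> below (Suc n)" "cf w n = cf w1 n"
        by (auto simp: lead_ideal_def)
      have "w \<ominus>\<^bsub>P\<^esub> w1 \<in> W" using W1(6) Suc.prems(1) w1(1) W(3) by blast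
      moreover have "w \<ominus>\<^bsub>P\<^esub> w1 \<in> below n" by (rule below_minus_lead[OF Suc.prems(2) w1(2,3)])
      ultimately obtain w' where w': "w' \<in> W'" "(w \<ominus>\<^bsub>P\<^esub> w1) \<ominus>\<^bsub>P\<^esub> w' \<in> W \<inter> below N" using Suc.hyps by blast
      have "(w \<ominus>\<^bsub>P\<^esub> w1) \<ominus>\<^bsub>P\<^esub> w' = w \<ominus>\<^bsub>P\<^esub> (w1 \<oplus>\<^bsub>P\<^esub> w')"
        using Suc.prems(1) w1(1) w'(1) W1(1) W2(1) by (simp add: a_minus_def P.minus_add P.a_assoc)
      then show ?thesis using w'(2) W2(3)[OF w1(1) w'(1)] by auto
    qed
  qed
  \<comment> \<open>An element of \<open>W\<close> of degree below \<open>m\<close> is zero. Above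
    that, \<open>e w\<close> and an \<open>R\<close>-multiple of \<open>\<theta>^k w\<^sub>0\<close>
    have equal top terms, so each factor \<open>e\<close> lowers the degree by one modulo
    \<open>W'\<close>.\<close>
  have kill: "e [^] k \<odot>\<^bsub>P\<^esub> w \<in> W'" if "w \<in> W" "w \<in> below (m + k)" for w and k :: nat
    using that
  proof (induct k arbitrary: w)
    case 0
    then have "w = \<zero>\<^bsub>P\<^esub>" using m(1) by auto
    then show ?case using W2(2) by simp
  next
    case (Suc k)
    define b where "b = cf w (m + k)"
    define v where "v = e \<odot>\<^bsub>P\<^esub> w \<ominus>\<^bsub>P\<^esub> b \<odot>\<^bsub>P\<^esub> (T ^^ k) w\<^sub>0"
    have wc: "w \<in> carrier P" using Suc.prems by simp
    have b: "b \<in> carrier R" using wc by (simp add: b_def)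
    have T0: "(T ^^ k) w\<^sub>0 \<in> W'" by (rule W2(5)[OF m(2)])
    have vW: "v \<in> W" unfolding v_def using W1(6) W1(4) Suc.prems(1) e b T0 W(3) by blast
    have "v \<in> below (m + k)" unfolding v_def
    proof (rule below_minus_lead)
      show "e \<odot>\<^bsub>P\<^esub> w \<in> below (Suc (m + k))" using Suc.prems e by (intro below_smult) auto
      show "b \<odot>\<^bsub>P\<^esub> (T ^^ k) w\<^sub>0 \<in> below (Suc (m + k))" using Tpow_lead[OF m(3), of k] b by (intro below_smult) auto
      show "cf (e \<odot>\<^bsub>P\<^esub> w) (m + k) = cf (b \<odot>\<^bsub>P\<^esub> (T ^^ k) w\<^sub>0) (m + k)"
        using Tpow_lead[OF m(3), of k] b e wc T0 W2(1) by (simp add: e_def[symmetric] b_def[symmetric] R.m_comm)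
    qed
    then have "e [^] k \<odot>\<^bsub>P\<^esub> v \<in> W'" using Suc.hyps vW by blast
    moreover have "e [^] k \<odot>\<^bsub>P\<^esub> (b \<odot>\<^bsub>P\<^esub> (T ^^ k) w\<^sub>0) \<in> W'" using W2(4) e b T0 by simp
    ultimately have "e [^] k \<odot>\<^bsub>P\<^esub> v \<oplus>\<^bsub>P\<^esub> e [^] k \<odot>\<^bsub>P\<^esub> (b \<odot>\<^bsub>P\<^esub> (T ^^ k) w\<^sub>0) \<in> W'" by (rule W2(3))
    moreover have "e [^] k \<odot>\<^bsub>P\<^esub> v \<oplus>\<^bsub>P\<^esub> e [^] k \<odot>\<^bsub>P\<^esub> (b \<odot>\<^bsub>P\<^esub> (T ^^ k) w\<^sub>0) = e [^] Suc k \<odot>\<^bsub>P\<^esub> w"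
    proof -
      have "v \<oplus>\<^bsub>P\<^esub> b \<odot>\<^bsub>P\<^esub> (T ^^ k) w\<^sub>0 = e \<odot>\<^bsub>P\<^esub> w"
        unfolding v_def using wc e b W2(1)[OF T0] by (simp add: a_minus_def P.a_assoc P.l_neg)
      moreover have "v \<in> carrier P" using vW W1(1) by blast
      ultimately show ?thesis using e b W2(1)[OF T0] wc
        by (simp add: UP_smult_r_distr[symmetric] UP_smult_assoc1)
    qed
    ultimately show ?case by simp
  qed
  define A where "A = {r \<in> carrier R. \<forall>w\<in>W. r \<odot>\<^bsub>P\<^esub> w \<in> W'}"
  have "e [^] N \<in> A"
  proof -
    have "e [^] N \<odot>\<^bsub>P\<^esub> w \<in> W'" if w: "w \<in> W" for w
    proof -
      have wc: "w \<in> carrier P" using W1(1) w .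
      obtain w' where w': "w' \<in> W'" "w \<ominus>\<^bsub>P\<^esub> w' \<in> W" "w \<ominus>\<^bsub>P\<^esub> w' \<in> below N"
        using reduce[OF w below_deg[OF wc]] by blast
      \<comment> \<open>The exponent \<open>N\<close> suffices, since the reduced element lies in
        \<open>below N\<close> and hence in \<open>below (m + N)\<close>.\<close>
      have "w \<ominus>\<^bsub>P\<^esub> w' \<in> below (m + N)" by (rule below_mono[OF w'(3)]) simp
      then have "e [^] N \<odot>\<^bsub>P\<^esub> (w \<ominus>\<^bsub>P\<^esub> w') \<oplus>\<^bsub>P\<^esub> e [^] N \<odot>\<^bsub>P\<^esub> w' \<in> W'"
        using kill[OF w'(2)] W2(3) W2(4) w'(1) e by simp
      moreover have "w = (w \<ominus>\<^bsub>P\<^esub> w') \<oplus>\<^bsub>P\<^esub> w'" using wc W2(1)[OF w'(1)] by (simp add: a_minus_def P.a_assoc P.l_neg)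
      ultimately show ?thesis using e wc W2(1)[OF w'(1)] by (metis P.minus_closed UP_smult_r_distr R.nat_pow_closed)
    qed
    then show ?thesis using e by (simp add: A_def)
  qed
  moreover have "e [^] N \<noteq> \<zero>" using R.nat_pow_nonzero e by blast
  ultimately have A0: "A \<noteq> {\<zero>}" by blast
  have "delta_ideal R \<delta> A"
    unfolding delta_ideal_def R.ideal_iff
  proof (intro conjI ballI)
    show "A \<subseteq> carrier R" by (auto simp: A_def)
    show "\<zero> \<in> A" using W1(1) W2(2) by (simp add: A_def)
    show "x \<oplus> y \<in> A" if "x \<in> A" "y \<in> A" for x y
      using that W1(1) W2(3) by (auto simp: A_def UP_smult_l_distr)
    show "r \<otimes> x \<in> A" if "r \<in> carrier R" "x \<in> A" for r x
      using that W1(1) W2(4) by (auto simp: A_def UP_smult_assoc1)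
    show "\<delta> ` A \<subseteq> A"
    proof clarify
      fix r assume r: "r \<in> A"
      have rc: "r \<in> carrier R" using r by (simp add: A_def)
      have "\<delta> r \<odot>\<^bsub>P\<^esub> w \<in> W'" if w: "w \<in> W" for w
      proof -
        have wc: "w \<in> carrier P" using W1(1) w .
        \<comment> \<open>The element \<open>\<delta>(r) w\<close> is
          \<open>\<theta> (r w) - r (\<theta> w)\<close>. The first term lies in the left ideal
          \<open>W'\<close>, the second because \<open>r\<close> also carries
          \<open>\<theta> w\<close> into it.\<close>
        have "T w \<in> W" using W1(5)[OF w, of 1] by simp
        then have "r \<odot>\<^bsub>P\<^esub> T w \<in> W'" using r by (simp add: A_def)
        moreover have "r \<odot>\<^bsub>P\<^esub> w \<in> W'" using r w by (simp add: A_def)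
        then have "T (r \<odot>\<^bsub>P\<^esub> w) \<in> W'" using W2(5)[of _ 1] by simp
        ultimately have "T (r \<odot>\<^bsub>P\<^esub> w) \<ominus>\<^bsub>P\<^esub> r \<odot>\<^bsub>P\<^esub> T w \<in> W'" using W2(6) by blast
        moreover have "T (r \<odot>\<^bsub>P\<^esub> w) \<ominus>\<^bsub>P\<^esub> r \<odot>\<^bsub>P\<^esub> T w = \<delta> r \<odot>\<^bsub>P\<^esub> w"
          using rc wc by (simp add: T_smult a_minus_def P.a_ac P.r_neg P.r_neg1 P.r_neg2)
        ultimately show ?thesis by simp
      qed
      then show "\<delta> r \<in> A" using rc by (simp add: A_def)
    qed
  qed
  then have "A = carrier R" using simple A0 unfolding delta_simple_def by blast
  then have "\<one> \<in> A" by simp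
  then have "w \<in> W'" if "w \<in> W" for w
    using that W1(1)[OF that] by (auto simp: A_def)
  then show ?thesis using W(3) by blast
qed

lemma least_degree:
  assumes W: "left_ideal D W" "W \<noteq> {\<zero>\<^bsub>P\<^esub>}"
  defines "m \<equiv> LEAST n. W \<inter> below (Suc n) \<noteq> {\<zero>\<^bsub>P\<^esub>}"
  shows "W \<inter> below m = {\<zero>\<^bsub>P\<^esub>}"
    "\<exists>w\<in>W. w \<in> below (Suc m) \<and> cf w m \<noteq> \<zero>"
    "\<And>n. W \<inter> below (Suc n) \<noteq> {\<zero>\<^bsub>P\<^esub>} \<Longrightarrow> m \<le> n"
proof -
  note W1 = left_idealD[OF W(1)]
  have z: "\<zero>\<^bsub>P\<^esub> \<in> W \<inter> below n" for n using W1(2) by (simp add: below_def del: below_carrier)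
  show least: "m \<le> n" if "W \<inter> below (Suc n) \<noteq> {\<zero>\<^bsub>P\<^esub>}" for n
    unfolding m_def using that by (rule Least_le)
  show low: "W \<inter> below m = {\<zero>\<^bsub>P\<^esub>}"
  proof (cases m)
    case 0 then show ?thesis using below_0 z by blast
  next
    case (Suc k) then show ?thesis using least[of k] by auto
  qed
  obtain w where w: "w \<in> W" "w \<noteq> \<zero>\<^bsub>P\<^esub>" using W(2) W1(2) by blast
  then have "W \<inter> below (Suc (deg R w)) \<noteq> {\<zero>\<^bsub>P\<^esub>}" using below_deg[OF W1(1)[OF w(1)]] by blast
  then have "W \<inter> below (Suc m) \<noteq> {\<zero>\<^bsub>P\<^esub>}" unfolding m_def by (rule LeastI)
  then obtain v where v: "v \<in> W" "v \<in> below (Suc m)" "v \<noteq> \<zero>\<^bsub>P\<^esub>" using z[of "Suc m"] by blast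
  have "cf v m \<noteq> \<zero>"
  proof
    assume "cf v m = \<zero>"
    then have "v \<in> below m" using v(2) unfolding below_def by (auto simp: Suc_le_eq) (metis le_neq_implies_less)
    then show False using low v by blast
  qed
  then show "\<exists>w\<in>W. w \<in> below (Suc m) \<and> cf w m \<noteq> \<zero>" using v by blast
qed

text \<open>The least degrees increase along the chain, but never beyond the least degree
  \<open>d\<close> of \<open>L\<close>. The leading coefficients of each \<open>W i\<close> form one
  ideal \<open>J i\<close> above the non-zero ideal \<open>lead_ideal d L\<close>, so the chain
  condition in \<open>R\<close> applies to the \<open>J i\<close>.\<close>

theorem dcc_above_nonzero_left_ideal:
  assumes dom: "domain R" and noeth: "noetherian_ring R"
    and dim: "\<And>P. primeideal P R \<Longrightarrow> P \<noteq> {\<zero>} \<Longrightarrow> maximalideal P R"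
    and simple: "delta_simple R \<delta>"
    and L: "left_ideal D L" "L \<noteq> {\<zero>\<^bsub>P\<^esub>}"
    and W: "\<And>i::nat. left_ideal D (W i)" "\<And>i. W (Suc i) \<subseteq> W i" "\<And>i. L \<subseteq> W i"
  shows "\<exists>n. \<forall>i\<ge>n. W i = W n"
proof -
  interpret R: noetherian_domain R by (intro noetherian_domain.intro dom noeth)
  have anti: "W j \<subseteq> W i" if "i \<le> j" for i j using lift_Suc_antimono_le[of W i j, OF W(2) that] .
  have W0: "W i \<noteq> {\<zero>\<^bsub>P\<^esub>}" for i
  proof
    assume "W i = {\<zero>\<^bsub>P\<^esub>}"
    then show False using W(3)[of i] L(2) left_idealD(2)[OF L(1)] by blast
  qed
  define m where "m i = (LEAST n. W i \<inter> below (Suc n) \<noteq> {\<zero>\<^bsub>P\<^esub>})" for i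
  note least = least_degree[OF W(1) W0, folded m_def]
  define d where "d = (LEAST n. L \<inter> below (Suc n) \<noteq> {\<zero>\<^bsub>P\<^esub>})"
  note leastL = least_degree[OF L, folded d_def]
  have m_le: "m i \<le> n" if "V \<subseteq> W i" "v \<in> V" "v \<in> below (Suc n)" "cf v n \<noteq> \<zero>" for i n V v
  proof (rule least(3))
    have "v \<noteq> \<zero>\<^bsub>P\<^esub>" using that(4) by auto
    then show "W i \<inter> below (Suc n) \<noteq> {\<zero>\<^bsub>P\<^esub>}" using that by blast
  qed
  have m_mono: "m i \<le> m j" if "i \<le> j" for i j
    using least(2)[of j] m_le[OF anti[OF that]] by blast
  have m_bound: "m i \<le> d" for i
    using leastL(2) m_le[OF W(3)] by blast
  have "finite (range m)" by (rule finite_subset[of _ "{..d}"]) (use m_bound in auto)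
  then have "Max (range m) \<in> range m" by (intro Max_in) auto
  then obtain N1 where N1: "m N1 = Max (range m)" by (metis rangeE)
  have m_const: "m i = m N1" if "i \<ge> N1" for i
    using m_mono[OF that] Max_ge[OF \<open>finite (range m)\<close>, of "m i"] N1 by simp
  define J where "J i = (\<Union>n. lead_ideal n (W i))" for i
  have J_eq: "\<exists>N. J i = lead_ideal N (W i)" for i
  proof -
    obtain N where "\<And>n. lead_ideal n (W i) \<subseteq> lead_ideal N (W i)" using lead_ideal_stabilizes[OF noeth W(1)] by blast
    then have "J i = lead_ideal N (W i)" unfolding J_def by blast
    then show ?thesis by blast
  qed
  have J_ideal: "ideal (J i) R" for i using J_eq[of i] lead_ideal_ideal[OF W(1)] by auto
  have J_anti: "J (Suc i) \<subseteq> J i" for i unfolding J_def using lead_ideal_mono[OF W(2)] by blast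
  have "\<exists>n. \<forall>i\<ge>n. J i = J n"
  proof (rule R.dcc_above_nonzero_ideal[where I = "lead_ideal d L" and W = J])
    show "maximalideal P R" if "primeideal P R" "P \<noteq> {\<zero>}" for P using dim that .
    show "ideal (lead_ideal d L) R" by (rule lead_ideal_ideal[OF L(1)])
    show "ideal (J i) R" "J (Suc i) \<subseteq> J i" for i by (rule J_ideal, rule J_anti)
    show "lead_ideal d L \<noteq> {\<zero>}"
      using leastL(2) unfolding lead_ideal_def by blast
    show "lead_ideal d L \<subseteq> J i" for i unfolding J_def using lead_ideal_mono[OF W(3)] by blast
  qed
  then obtain N2 where N2: "\<forall>i\<ge>N2. J i = J N2" by (elim exE)
  let ?n = "max N1 N2"
  have stab: "W i = W ?n" if i: "i \<ge> ?n" for i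
  proof -
    have Jn: "J i = J ?n" using N2[rule_format, of i] N2[rule_format, of ?n] i by simp
    have mn: "m i = m ?n" using m_const[of i] m_const[of ?n] i by simp
    obtain N where N: "J i = lead_ideal N (W i)" using J_eq by blast
    have lead: "lead_ideal n (W ?n) \<subseteq> lead_ideal N (W i)" for n
      unfolding N[symmetric] Jn by (auto simp: J_def)
    obtain w where w: "w \<in> W i" "w \<in> below (Suc (m ?n))" "cf w (m ?n) \<noteq> \<zero>"
      using least(2)[of i] unfolding mn by blast
    show ?thesis
      using left_ideal_eq_if_lead_eq[OF dom simple W(1) W(1) anti[OF i] lead least(1) w] by simp
  qed
  show ?thesis by (intro exI[of _ ?n] allI impI) (rule stab)
qed

text \<open>Proper quotients of the ring satisfy the chain condition, so only a generator
  \<open>x\<close> with zero annihilator is left. Then \<open>M\<close> is a copy of the ring, and a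
  simple submodule of it is ruled out by degrees.\<close>

theorem diamond_if_delta_simple:
  assumes dom: "domain R" and noeth: "noetherian_ring R"
    and dim: "\<And>P. primeideal P R \<Longrightarrow> P \<noteq> {\<zero>} \<Longrightarrow> maximalideal P R"
    and simple: "delta_simple R \<delta>"
  shows "diamond D"
  unfolding diamond_def
proof (intro allI impI, elim conjE)
  fix M :: "(nat \<Rightarrow> 'a, (nat \<Rightarrow> 'a) set) module"
  assume cyc: "cyclic_module D M" and ess: "essential_extension_of_simple D M"
  interpret R: domain R by fact
  interpret M: left_module D M using cyc by (simp add: cyclic_module_def)
  obtain x where x: "x \<in> carrier M" "carrier M = {s \<odot>\<^bsub>M\<^esub> x | s. s \<in> carrier D}"
    using cyc by (auto simp: cyclic_module_def)
  define L where "L = {s \<in> carrier D. s \<odot>\<^bsub>M\<^esub> x = \<zero>\<^bsub>M\<^esub>}"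
  have L: "left_ideal D L" unfolding L_def
    using M.left_ideal_transporter[OF M.zero_submodule x(1)] by simp
  have "L \<noteq> {\<zero>\<^bsub>P\<^esub>}"
  proof
    assume L0: "L = {\<zero>\<^bsub>P\<^esub>}"
    obtain V where V: "submodule V D M" "simple_module D (M\<lparr>carrier := V\<rparr>)"
      using ess by (auto simp: essential_extension_of_simple_def essential_submodule_def)
    note V2 = V(2)[unfolded M.simple_submodule_iff[OF V(1)]]
    have VM: "V \<subseteq> carrier M" "\<zero>\<^bsub>M\<^esub> \<in> V" using V(1) by (auto simp: M.submodule_iff)
    then obtain v where v: "v \<in> V" "v \<noteq> \<zero>\<^bsub>M\<^esub>" using V2 by blast
    obtain s where s: "s \<in> carrier P" "v = s \<odot>\<^bsub>M\<^esub> x" using v(1) VM x(2) by auto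
    have s0: "s \<noteq> \<zero>\<^bsub>P\<^esub>" using s v M.smult_l_null[OF x(1)] by auto
    \<comment> \<open>With \<open>v = s x\<close> in the simple submodule \<open>V\<close>, this is
      the submodule generated by \<open>\<theta> s x\<close>. It is non-zero, hence equals
      \<open>V\<close> and contains \<open>s x\<close> again.\<close>
    let ?U = "{t \<odot>\<^bsub>M\<^esub> (T s \<odot>\<^bsub>M\<^esub> x) | t. t \<in> carrier P}"
    have Tx: "T s \<odot>\<^bsub>M\<^esub> x \<in> carrier M" using s x(1) by simp
    have U: "submodule ?U D M"
      unfolding M.submodule_iff
    proof (intro conjI ballI)
      show "?U \<subseteq> carrier M" using Tx by auto
      show "\<zero>\<^bsub>M\<^esub> \<in> ?U" using M.smult_l_null[OF Tx] P.zero_closed by (metis (mono_tags, lifting) D_simps(3) mem_Collect_eq)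
    next
      fix y z assume "y \<in> ?U" "z \<in> ?U"
      then obtain t u where "t \<in> carrier P" "u \<in> carrier P" "y = t \<odot>\<^bsub>M\<^esub> (T s \<odot>\<^bsub>M\<^esub> x)" "z = u \<odot>\<^bsub>M\<^esub> (T s \<odot>\<^bsub>M\<^esub> x)" by blast
      then have "y \<oplus>\<^bsub>M\<^esub> z = (t \<oplus>\<^bsub>P\<^esub> u) \<odot>\<^bsub>M\<^esub> (T s \<odot>\<^bsub>M\<^esub> x)" "t \<oplus>\<^bsub>P\<^esub> u \<in> carrier P"
        using M.smult_l_distr[of t u] Tx by simp_all
      then show "y \<oplus>\<^bsub>M\<^esub> z \<in> ?U" by blast
    next
      fix r y assume r: "r \<in> carrier D" and "y \<in> ?U"
      then obtain t where "t \<in> carrier P" "y = t \<odot>\<^bsub>M\<^esub> (T s \<odot>\<^bsub>M\<^esub> x)" by blast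
      then have "r \<odot>\<^bsub>M\<^esub> y = (r \<otimes>\<^bsub>D\<^esub> t) \<odot>\<^bsub>M\<^esub> (T s \<odot>\<^bsub>M\<^esub> x)" "r \<otimes>\<^bsub>D\<^esub> t \<in> carrier P"
        using M.smult_assoc[of r t] Tx r D_closed by simp_all
      then show "r \<odot>\<^bsub>M\<^esub> y \<in> ?U" by blast
    qed
    have TsV: "T s \<odot>\<^bsub>M\<^esub> x \<in> V"
    proof -
      have "T s = mono_P \<one> (Suc 0) \<otimes>\<^bsub>D\<^esub> s" using s by (simp add: D_monom)
      then have "T s \<odot>\<^bsub>M\<^esub> x = mono_P \<one> (Suc 0) \<odot>\<^bsub>M\<^esub> v" using M.smult_assoc[of "mono_P \<one> (Suc 0)" s x] s x(1) by simp
      then show ?thesis using V(1) v(1) by (simp add: M.submodule_iff)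
    qed
    then have "?U \<subseteq> V" using V(1) by (auto simp: M.submodule_iff)
    then have "?U = {\<zero>\<^bsub>M\<^esub>} \<or> ?U = V" using V2 U by blast
    moreover have Ts0: "T s \<noteq> \<zero>\<^bsub>P\<^esub>"
    proof
      assume "T s = \<zero>\<^bsub>P\<^esub>"
      moreover have "s \<in> below (Suc (deg R s))" using below_deg s by blast
      ultimately have "cf s (deg R s) = \<zero>" using Tpow_lead[of s "deg R s" 1] by simp
      then show False using lcoeff_nonzero[OF s0 s(1)] by simp
    qed
    moreover have "\<one>\<^bsub>P\<^esub> \<odot>\<^bsub>M\<^esub> (T s \<odot>\<^bsub>M\<^esub> x) \<in> ?U" by blast
    moreover have "T s \<odot>\<^bsub>M\<^esub> x \<noteq> \<zero>\<^bsub>M\<^esub>" using L0 Ts0 s(1) unfolding L_def by auto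
    ultimately have "v \<in> ?U" using v(1) M.smult_one[OF Tx] by auto
    then obtain t where t: "t \<in> carrier P" "s \<odot>\<^bsub>M\<^esub> x = t \<odot>\<^bsub>M\<^esub> (T s \<odot>\<^bsub>M\<^esub> x)" using s by blast
    have tc: "t \<otimes>\<^bsub>D\<^esub> T s \<in> carrier P" using t s D_closed by simp
    have "s \<odot>\<^bsub>M\<^esub> x = (t \<otimes>\<^bsub>D\<^esub> T s) \<odot>\<^bsub>M\<^esub> x" using M.smult_assoc[of t "T s" x] t s x(1) by simp
    moreover have "s = (s \<ominus>\<^bsub>P\<^esub> t \<otimes>\<^bsub>D\<^esub> T s) \<oplus>\<^bsub>P\<^esub> t \<otimes>\<^bsub>D\<^esub> T s" using s tc by (simp add: a_minus_def P.a_assoc P.l_neg)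
    ultimately have "(s \<ominus>\<^bsub>P\<^esub> t \<otimes>\<^bsub>D\<^esub> T s) \<odot>\<^bsub>M\<^esub> x \<oplus>\<^bsub>M\<^esub> (t \<otimes>\<^bsub>D\<^esub> T s) \<odot>\<^bsub>M\<^esub> x = (t \<otimes>\<^bsub>D\<^esub> T s) \<odot>\<^bsub>M\<^esub> x"
      using M.smult_l_distr[of "s \<ominus>\<^bsub>P\<^esub> t \<otimes>\<^bsub>D\<^esub> T s" "t \<otimes>\<^bsub>D\<^esub> T s" x] s tc x(1) by simp
    then have "(s \<ominus>\<^bsub>P\<^esub> t \<otimes>\<^bsub>D\<^esub> T s) \<odot>\<^bsub>M\<^esub> x = \<zero>\<^bsub>M\<^esub>" using s tc x(1) by simp
    then have "s \<ominus>\<^bsub>P\<^esub> t \<otimes>\<^bsub>D\<^esub> T s \<in> L" using s tc by (simp add: L_def)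
    then have eq: "s = t \<otimes>\<^bsub>D\<^esub> T s" using L0 s tc by (simp add: P.r_right_minus_eq)
    have t0: "t \<noteq> \<zero>\<^bsub>P\<^esub>" using eq s0 s D_zero_l[of "T s"] by auto
    define n where "n = deg R s"
    have n: "s \<in> below (Suc n)" "cf s n \<noteq> \<zero>" using below_deg lcoeff_nonzero[OF s0] s by (auto simp: n_def)
    have Ts: "T s \<in> below (Suc (Suc n))" "cf (T s) (Suc n) = cf s n" using Tpow_lead[OF n(1), of 1] by auto
    have tl: "t \<in> below (Suc (deg R t))" "cf t (deg R t) \<noteq> \<zero>" using below_deg lcoeff_nonzero[OF t0] t by auto
    \<comment> \<open>The equation \<open>s = t \<theta> s\<close> is impossible: the right-hand
      side has degree \<open>deg t + n + 1\<close>, more than the degree \<open>n\<close> of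
      \<open>s\<close>.\<close>
    have "cf s (deg R t + Suc n) = cf t (deg R t) \<otimes> cf s n"
      using mult_lead[OF tl(1) Ts(1)] Ts(2) eq by simp
    also have "\<dots> \<noteq> \<zero>" using tl n t s by (simp add: R.integral_iff)
    finally show False using n(1) by (simp add: below_def del: below_carrier)
  qed
  then show "artinian_module D M"
    using M.artinian_if_dcc[OF x] dcc_above_nonzero_left_ideal[OF dom noeth dim simple L] unfolding L_def by blast
qed

end

context differential_ring
begin

section \<open>A non-Artinian essential extension\<close>

lemma add_minus_cancel:
  assumes "a \<in> carrier R" "b \<in> carrier R" shows "b \<oplus> (a \<oplus> \<ominus> b) = a"
proof -
  have "b \<oplus> (a \<oplus> \<ominus> b) = a \<oplus> (b \<oplus> \<ominus> b)" using assms by (intro R.a_lcomm) auto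
  then show ?thesis using assms by (simp add: R.r_neg)
qed

text \<open>The left ideal generated by an ideal \<open>M\<close> of \<open>R\<close>, in Horner form.\<close>

inductive_set gen_by :: "'a set \<Rightarrow> (nat \<Rightarrow> 'a) set" for M where
  zero: "\<zero>\<^bsub>P\<^esub> \<in> gen_by M"
| step: "p \<in> gen_by M \<Longrightarrow> m \<in> M \<Longrightarrow> T p \<oplus>\<^bsub>P\<^esub> \<iota> m \<in> gen_by M"

text \<open>The hypothesis says that \<open>\<theta> p\<close> has no coefficient beyond index
  \<open>k\<close>. So from \<open>k\<close> on each coefficient of \<open>p\<close> is determined
  by the next one, and far out they vanish.\<close>

lemma below_if_T_zero:
  assumes "p \<in> carrier P" "\<And>i. i \<ge> k \<Longrightarrow> cf p i \<oplus> \<delta> (cf p (Suc i)) = \<zero>"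
  shows "p \<in> below k"
proof -
  have descend: "p \<in> below k" if "p \<in> below (k + j)" for j
    using that
  proof (induct j)
    case (Suc j)
    have "cf p (Suc (k + j)) = \<zero>" using Suc.prems by (auto simp: below_def simp del: below_carrier)
    then have "cf p (k + j) = \<zero>" using assms(2)[of "k + j"] assms(1) by simp
    then have "p \<in> below (k + j)" using Suc.prems unfolding below_def
      by (auto simp: Suc_le_eq) (metis le_neq_implies_less)
    then show ?case by (rule Suc.hyps)
  qed simp
  show ?thesis by (rule descend[OF below_mono[OF below_deg[OF assms(1)], of "k + Suc (deg R p)"]]) simp
qed

section \<open>The left ideal \<open>SM\<close>: leading coefficients, maximality, torsion\<close>

context
  fixes M assumes M: "maximalideal M R"
begin

interpretation M: maximalideal M R by (rule M)

abbreviation "N \<equiv> gen_by M"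

lemma N_carrier [simp]: "p \<in> N \<Longrightarrow> p \<in> carrier P"
  by (induct rule: gen_by.induct) auto

lemma N_add: "p \<in> N \<Longrightarrow> q \<in> N \<Longrightarrow> p \<oplus>\<^bsub>P\<^esub> q \<in> N"
proof (induct arbitrary: q rule: gen_by.induct)
  case zero then show ?case by simp
next
  case (step p m)
  from \<open>q \<in> N\<close> show ?case
  proof (cases rule: gen_by.cases)
    case zero then show ?thesis using step gen_by.step by simp
  next
    case (step q' m')
    have m: "m \<in> carrier R" "m' \<in> carrier R" using \<open>m \<in> M\<close> step(3) M.Icarr by auto
    have pc: "p \<in> carrier P" "q' \<in> carrier P" using \<open>p \<in> N\<close> step(2) by auto
    have "T p \<oplus>\<^bsub>P\<^esub> \<iota> m \<oplus>\<^bsub>P\<^esub> q = T (p \<oplus>\<^bsub>P\<^esub> q') \<oplus>\<^bsub>P\<^esub> \<iota> (m \<oplus> m')"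
      unfolding step(1) using m pc by (simp add: T_add P.a_ac)
    moreover have "m \<oplus> m' \<in> M" using \<open>m \<in> M\<close> step(3) M.add_mem by blast
    ultimately show ?thesis using gen_by.step \<open>\<And>q. q \<in> N \<Longrightarrow> p \<oplus>\<^bsub>P\<^esub> q \<in> N\<close> step(2) by metis
  qed
qed

text \<open>Moving \<open>a\<close> past \<theta> costs a term:
  \<open>a (\<theta> p + m) = \<theta> (a p) + a m - \<delta>(a) p\<close>. It is covered by the
  induction hypothesis for \<open>-\<delta>(a)\<close>, so \<open>a\<close> has to be
  arbitrary.\<close>

lemma N_smult: "p \<in> N \<Longrightarrow> a \<in> carrier R \<Longrightarrow> a \<odot>\<^bsub>P\<^esub> p \<in> N"
proof (induct arbitrary: a rule: gen_by.induct)
  case zero then show ?case using gen_by.zero by simp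
next
  case (step p m)
  have m: "m \<in> carrier R" using step(3) M.Icarr by auto
  have pc: "p \<in> carrier P" using step(1) by simp
  have "a \<odot>\<^bsub>P\<^esub> (T p \<oplus>\<^bsub>P\<^esub> \<iota> m) = (T (a \<odot>\<^bsub>P\<^esub> p) \<oplus>\<^bsub>P\<^esub> \<iota> (a \<otimes> m)) \<oplus>\<^bsub>P\<^esub> (\<ominus> \<delta> a) \<odot>\<^bsub>P\<^esub> p"
  proof (rule up_eqI)
    fix n
    show "cf (a \<odot>\<^bsub>P\<^esub> (T p \<oplus>\<^bsub>P\<^esub> \<iota> m)) n = cf ((T (a \<odot>\<^bsub>P\<^esub> p) \<oplus>\<^bsub>P\<^esub> \<iota> (a \<otimes> m)) \<oplus>\<^bsub>P\<^esub> (\<ominus> \<delta> a) \<odot>\<^bsub>P\<^esub> p) n"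
      using m pc step(4)
      by (auto simp: T_smult R.r_distr R.l_minus R.a_ac R.r_neg R.r_neg1 R.r_neg2 add_minus_cancel)
  qed (use m pc step(4) in auto)
  moreover have "T (a \<odot>\<^bsub>P\<^esub> p) \<oplus>\<^bsub>P\<^esub> \<iota> (a \<otimes> m) \<in> N"
    using gen_by.step[OF step(2)[OF step(4)] M.I_l_closed[OF step(3,4)]] .
  moreover have "(\<ominus> \<delta> a) \<odot>\<^bsub>P\<^esub> p \<in> N" using step(2)[of "\<ominus> \<delta> a"] step(4) by simp
  ultimately show ?case using N_add by simp
qed

lemma N_T: "p \<in> N \<Longrightarrow> T p \<in> N"
  using gen_by.step[of p M \<zero>] M.zero_closed by simp

lemma N_left_ideal: "left_ideal D N"
  unfolding left_ideal_D_iff using gen_by.zero N_add N_smult N_T by auto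

lemma N_\<iota>: "m \<in> M \<Longrightarrow> \<iota> m \<in> N"
  using gen_by.step[OF gen_by.zero, of m M] M.Icarr by (simp add: T_zero)

text \<open>In Horner form the element is a sum of terms \<open>\<theta>^i m\<^sub>i\<close>, and
  its top coefficient is the last non-zero \<open>m\<^sub>i\<close>. In particular \<open>SM\<close>
  meets \<open>R\<close> in \<open>M\<close>, so it is proper.\<close>

lemma N_lead: "p \<in> N \<Longrightarrow> p \<in> below (Suc n) \<Longrightarrow> cf p n \<in> M"
proof (induct arbitrary: n rule: gen_by.induct)
  case zero then show ?case using M.zero_closed by simp
next
  case (step p m)
  have m: "m \<in> carrier R" using step(3) M.Icarr by auto
  have pc: "p \<in> carrier P" using step(1) by simp
  have high: "cf p i \<oplus> \<delta> (cf p (Suc i)) = \<zero>" if "i \<ge> n" for i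
  proof -
    have "cf (T p \<oplus>\<^bsub>P\<^esub> \<iota> m) (Suc i) = \<zero>" using step(4) that by (auto simp: below_def simp del: below_carrier)
    then show ?thesis using m pc by (simp add: coeff_T)
  qed
  have pb: "p \<in> below n" using below_if_T_zero[OF pc high] .
  show ?case
  proof (cases n)
    case 0
    then have "p = \<zero>\<^bsub>P\<^esub>" using below_0 pb by blast
    then show ?thesis using 0 m step(3) by (simp add: T_zero)
  next
    case (Suc k)
    have "cf p n = \<zero>" using pb by (simp add: below_def del: below_carrier)
    then have "cf (T p \<oplus>\<^bsub>P\<^esub> \<iota> m) n = cf p k" using Suc m pc by (simp add: coeff_T)
    then show ?thesis using step(2)[of k] pb Suc by simp
  qed
qed

lemma N_const_iff: "r \<in> carrier R \<Longrightarrow> \<iota> r \<in> N \<longleftrightarrow> r \<in> M"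
  using N_lead[of "\<iota> r" 0] N_\<iota> below_\<iota> by auto

lemma prime_M: "a \<in> carrier R \<Longrightarrow> b \<in> carrier R \<Longrightarrow> a \<otimes> b \<in> M \<Longrightarrow> a \<in> M \<or> b \<in> M"
  using primeideal.I_prime[OF R.maximalideal_prime[OF M]] .

lemma left_ideal_full:
  assumes W: "left_ideal D W" and r: "r \<in> carrier R" "r \<notin> M" "\<iota> r \<in> W" and NW: "N \<subseteq> W"
  shows "W = carrier P"
proof -
  note W1 = left_idealD[OF W]
  have "ideal_plus R M r = carrier R"
  proof -
    have "ideal_plus R M r = M \<or> ideal_plus R M r = carrier R"
      using M.I_maximal[OF R.ideal_plus_ideal[OF M.is_ideal r(1)] R.ideal_plus_incl(1)[OF M.is_ideal r(1)]]
        ideal.Icarr[OF R.ideal_plus_ideal[OF M.is_ideal r(1)]] by blast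
    then show ?thesis using R.ideal_plus_incl(2)[OF M.is_ideal r(1)] r(2) by blast
  qed
  then have "\<one> \<in> ideal_plus R M r" by simp
  then obtain m s where ms: "m \<in> M" "s \<in> carrier R" "\<one> = m \<oplus> s \<otimes> r" by (auto simp: ideal_plus_def)
  have mc: "m \<in> carrier R" using ms M.Icarr by auto
  have "\<iota> m \<oplus>\<^bsub>P\<^esub> s \<odot>\<^bsub>P\<^esub> \<iota> r \<in> W" using W1(3,4) N_\<iota> ms NW r by blast
  moreover have "\<iota> m \<oplus>\<^bsub>P\<^esub> s \<odot>\<^bsub>P\<^esub> \<iota> r = \<iota> (m \<oplus> s \<otimes> r)"
    using mc ms(2) r(1) by (intro up_eqI) auto
  ultimately have one: "\<one>\<^bsub>P\<^esub> \<in> W" using ms(3) monom_one by simp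
  have "p \<in> W" if "p \<in> carrier P" for p using W1(7)[OF that one] that D_one_r by simp
  then show ?thesis using W1(1) by blast
qed

context
  fixes m assumes m: "m \<in> M" "\<delta> m \<notin> M" and unit: "\<And>n::nat. n > 0 \<Longrightarrow> [n] \<cdot> \<one> \<in> Units R"
begin

lemma nat_notin: "[Suc n] \<cdot> \<one> \<notin> M"
proof
  assume "[Suc n] \<cdot> \<one> \<in> M"
  then have "inv ([Suc n] \<cdot> \<one>) \<otimes> [Suc n] \<cdot> \<one> \<in> M" using unit[of "Suc n"] by (intro M.I_l_closed) auto
  then have "\<one> \<in> M" using unit[of "Suc n"] by (simp del: R.add.nat_pow_Suc)
  then show False using M.one_imp_carrier M.I_notcarr by simp
qed

text \<open>Commuting \<open>m\<close> with \<open>r\<theta>\<^sup>n + \<dots>\<close> lowers the degree and multiplies the leading coefficient by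
  \<open>-n \<delta> m\<close>, a unit modulo \<open>M\<close>.\<close>

lemma left_ideal_full_lead:
  assumes W: "left_ideal D W" "N \<subseteq> W" and w: "w \<in> W" "w \<in> below (Suc n)" "cf w n \<notin> M"
  shows "W = carrier P"
  using w
proof (induct n arbitrary: w)
  case 0
  have wc: "w \<in> carrier P" using 0 by simp
  have "w = \<iota> (cf w 0)" using 0 wc by (intro up_eqI) (auto simp: below_def simp del: below_carrier)
  then show ?case using left_ideal_full[OF W(1), of "cf w 0"] W(2) 0 wc by simp
next
  case (Suc n)
  note W1 = left_idealD[OF W(1)]
  have wc: "w \<in> carrier P" using Suc.prems by simp
  have mc: "m \<in> carrier R" using m M.Icarr by simp
  define v where "v = w \<otimes>\<^bsub>D\<^esub> \<iota> m \<ominus>\<^bsub>P\<^esub> m \<odot>\<^bsub>P\<^esub> w"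
  have wm: "w \<otimes>\<^bsub>D\<^esub> \<iota> m \<in> carrier P" using wc mc D_closed by simp
  \<comment> \<open>Right multiplication by \<open>m\<close> does not lead out of \<open>W\<close>,
    as \<open>w m\<close> already lies in \<open>SM\<close>.\<close>
  have "w \<otimes>\<^bsub>D\<^esub> \<iota> m \<in> W" using left_idealD(7)[OF N_left_ideal wc N_\<iota>[OF m(1)]] W(2) by blast
  then have vW: "v \<in> W" unfolding v_def using W1(4,6) mc Suc.prems(1) by blast
  have lead: "w \<otimes>\<^bsub>D\<^esub> \<iota> m \<in> below (Suc (Suc n))" "cf (w \<otimes>\<^bsub>D\<^esub> \<iota> m) (Suc n) = cf w (Suc n) \<otimes> m"
    using mult_lead[OF Suc.prems(2) below_\<iota>[OF mc]] mc by simp_all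
  have vb: "v \<in> below (Suc n)" unfolding v_def
    by (rule below_minus_lead[OF lead(1) below_smult[OF mc Suc.prems(2)]]) (use lead(2) mc wc in \<open>simp add: R.m_comm\<close>)
  have nc: "[Suc n] \<cdot> \<one> \<in> carrier R" by (rule R.add.nat_pow_closed) simp
  have "cf v n = cf w (Suc n) \<otimes> ([Suc n] \<cdot> \<one> \<otimes> \<delta> m)"
  proof -
    have "cf v n = cf (w \<otimes>\<^bsub>D\<^esub> \<iota> m) n \<ominus> m \<otimes> cf w n"
      unfolding v_def using wm wc mc by (simp add: a_minus_def)
    also have "\<dots> = (cf w n \<otimes> m \<oplus> cf w (Suc n) \<otimes> ([Suc n] \<cdot> \<one> \<otimes> \<delta> m)) \<ominus> m \<otimes> cf w n"
      using mult_\<iota>_second[OF Suc.prems(2) mc] by simp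
    also have "\<dots> = cf w (Suc n) \<otimes> ([Suc n] \<cdot> \<one> \<otimes> \<delta> m)"
    proof -
      have "cf w n \<in> carrier R" "cf w (Suc n) \<otimes> ([Suc n] \<cdot> \<one> \<otimes> \<delta> m) \<in> carrier R"
        using wc mc nc by (simp_all del: R.add.nat_pow_Suc)
      then show ?thesis using mc
        by (simp add: a_minus_def R.m_comm R.a_ac R.r_neg R.r_neg1 R.r_neg2 del: R.add.nat_pow_Suc)
    qed
    finally show ?thesis .
  qed
  moreover have "[Suc n] \<cdot> \<one> \<otimes> \<delta> m \<notin> M" using prime_M[OF nc] nat_notin m mc by blast
  then have "cf w (Suc n) \<otimes> ([Suc n] \<cdot> \<one> \<otimes> \<delta> m) \<notin> M"
    using prime_M[of "cf w (Suc n)" "[Suc n] \<cdot> \<one> \<otimes> \<delta> m"] wc nc mc Suc.prems(3) by (metis R.m_closed coeff_closed delta_closed)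
  ultimately show ?case using Suc.hyps[OF vW vb] by simp
qed

text \<open>A top coefficient \<open>b\<close> in \<open>M\<close> is removed by subtracting
  \<open>\<theta>^n b\<close>, an element of \<open>SM\<close>. An element of \<open>W\<close>
  outside \<open>SM\<close> thus leads to one whose top coefficient lies outside
  \<open>M\<close>.\<close>

lemma N_maximal:
  assumes W: "left_ideal D W" "N \<subseteq> W" shows "W = N \<or> W = carrier P"
proof -
  note W1 = left_idealD[OF W(1)]
  have "W = carrier P" if "w \<in> W" "w \<notin> N" "w \<in> below n" for w n
    using that
  proof (induct n arbitrary: w)
    case 0 then show ?case using below_0[of w] gen_by.zero by auto
  next
    case (Suc n)
    show ?case
    proof (cases "cf w n \<in> M")
      case False then show ?thesis using left_ideal_full_lead[OF W Suc.prems(1,3)] by blast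
    next
      case True
      have r: "cf w n \<in> carrier R" using Suc.prems by simp
      define q where "q = (T ^^ n) (\<iota> (cf w n))"
      have qN: "q \<in> N" unfolding q_def by (rule left_idealD(5)[OF N_left_ideal N_\<iota>[OF True]])
      have q: "q \<in> below (Suc n)" "cf q n = cf w n"
        unfolding q_def using Tpow_lead[OF below_\<iota>[OF r], of n] r by auto
      have wc: "w \<in> carrier P" "q \<in> carrier P" using Suc.prems q by auto
      have "w \<ominus>\<^bsub>P\<^esub> q \<in> below n" by (rule below_minus_lead[OF Suc.prems(3) q(1)]) (simp add: q(2))
      moreover have "w \<ominus>\<^bsub>P\<^esub> q \<in> W" using W1(6) Suc.prems(1) qN W(2) by blast
      moreover have "w \<ominus>\<^bsub>P\<^esub> q \<notin> N"
      proof
        assume "w \<ominus>\<^bsub>P\<^esub> q \<in> N"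
        then have "(w \<ominus>\<^bsub>P\<^esub> q) \<oplus>\<^bsub>P\<^esub> q \<in> N" using N_add qN by blast
        moreover have "(w \<ominus>\<^bsub>P\<^esub> q) \<oplus>\<^bsub>P\<^esub> q = w" using wc by (simp add: a_minus_def P.a_assoc P.l_neg)
        ultimately show False using Suc.prems(2) by simp
      qed
      ultimately show ?thesis using Suc.hyps by blast
    qed
  qed
  then show ?thesis using W(2) below_deg W1(1) by blast
qed

end

text \<open>The quotient by \<open>SM\<close> is torsion over \<open>R\<close>: the top coefficient
  of \<open>m u\<close> lies in \<open>M\<close>, so modulo \<open>SM\<close> each factor
  \<open>m\<close> lowers the degree by one.\<close>

lemma N_torsion:
  assumes "m \<in> M" "u \<in> below n" shows "m [^] n \<odot>\<^bsub>P\<^esub> u \<in> N"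
  using assms(2)
proof (induct n arbitrary: u)
  case 0 then show ?case using below_0[of u] gen_by.zero by simp
next
  case (Suc n)
  have mc: "m \<in> carrier R" using assms M.Icarr by simp
  have uc: "u \<in> carrier P" using Suc.prems by simp
  define b where "b = cf u n \<otimes> m"
  have b: "b \<in> M" "b \<in> carrier R" unfolding b_def using M.I_l_closed[OF assms(1)] uc mc by auto
  define q where "q = (T ^^ n) (\<iota> b)"
  have qN: "q \<in> N" unfolding q_def by (rule left_idealD(5)[OF N_left_ideal N_\<iota>[OF b(1)]])
  have q: "q \<in> below (Suc n)" "cf q n = b"
    unfolding q_def using Tpow_lead[OF below_\<iota>[OF b(2)], of n] b by auto
  let ?v = "m \<odot>\<^bsub>P\<^esub> u \<ominus>\<^bsub>P\<^esub> q"
  have "?v \<in> below n"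
    by (rule below_minus_lead[OF below_smult[OF mc Suc.prems] q(1)]) (use uc mc in \<open>simp add: q(2) b_def R.m_comm\<close>)
  then have "m [^] n \<odot>\<^bsub>P\<^esub> ?v \<in> N" by (rule Suc.hyps)
  moreover have "m [^] n \<odot>\<^bsub>P\<^esub> q \<in> N" using N_smult[OF qN] mc by simp
  ultimately have "m [^] n \<odot>\<^bsub>P\<^esub> ?v \<oplus>\<^bsub>P\<^esub> m [^] n \<odot>\<^bsub>P\<^esub> q \<in> N" by (rule N_add)
  moreover have "m [^] n \<odot>\<^bsub>P\<^esub> ?v \<oplus>\<^bsub>P\<^esub> m [^] n \<odot>\<^bsub>P\<^esub> q = m [^] Suc n \<odot>\<^bsub>P\<^esub> u"
  proof -
    have qc: "q \<in> carrier P" using qN by simp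
    have "?v \<oplus>\<^bsub>P\<^esub> q = m \<odot>\<^bsub>P\<^esub> u" using qc mc uc by (simp add: a_minus_def P.a_assoc P.l_neg)
    then show ?thesis using mc uc qc by (simp add: UP_smult_r_distr[symmetric] UP_smult_assoc1)
  qed
  ultimately show ?case by simp
qed

end

text \<open>Right multiplication by \<open>\<theta>\<close>.\<close>

definition shift :: "(nat \<Rightarrow> 'a) \<Rightarrow> nat \<Rightarrow> 'a" where
  "shift p = (\<lambda>n. case n of 0 \<Rightarrow> \<zero> | Suc k \<Rightarrow> p k)"

lemma shift_closed [simp]: "p \<in> carrier P \<Longrightarrow> shift p \<in> carrier P"
proof -
  assume p: "p \<in> carrier P"
  then obtain n where n: "bound \<zero> n p" by (auto simp: carrier_P)
  have "bound \<zero> (Suc n) (shift p)"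
  proof
    fix k assume "Suc n < k"
    then show "shift p k = \<zero>" using n by (cases k) (auto simp: shift_def bound_def)
  qed
  moreover have "shift p k \<in> carrier R" for k using p by (cases k) (auto simp: shift_def)
  ultimately show ?thesis by (auto simp: carrier_P)
qed

lemma cf_shift: "p \<in> carrier P \<Longrightarrow> cf (shift p) n = (case n of 0 \<Rightarrow> \<zero> | Suc k \<Rightarrow> cf p k)"
  by (simp only: coeff_P[OF shift_closed] coeff_P, simp add: shift_def)

lemma shift_add: "p \<in> carrier P \<Longrightarrow> q \<in> carrier P \<Longrightarrow> shift (p \<oplus>\<^bsub>P\<^esub> q) = shift p \<oplus>\<^bsub>P\<^esub> shift q"
  by (rule up_eqI) (auto simp: cf_shift split: nat.split)

lemma shift_smult: "a \<in> carrier R \<Longrightarrow> p \<in> carrier P \<Longrightarrow> shift (a \<odot>\<^bsub>P\<^esub> p) = a \<odot>\<^bsub>P\<^esub> shift p"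
  by (rule up_eqI) (auto simp: cf_shift split: nat.split)

lemma shift_T: "p \<in> carrier P \<Longrightarrow> shift (T p) = T (shift p)"
  by (rule up_eqI) (auto simp: cf_shift coeff_T split: nat.split)

lemma shift_zero: "shift \<zero>\<^bsub>P\<^esub> = \<zero>\<^bsub>P\<^esub>"
  by (rule up_eqI) (auto simp: cf_shift split: nat.split)

lemma shift_inj:
  assumes "p \<in> carrier P" "q \<in> carrier P" "shift p = shift q" shows "p = q"
proof (rule up_eqI)
  fix n
  have "cf (shift p) (Suc n) = cf (shift q) (Suc n)" using assms(3) by simp
  then show "cf p n = cf q n" using assms(1,2) by (simp add: cf_shift)
qed (use assms in auto)

lemma shift_decomp:
  assumes "p \<in> carrier P" obtains u where "u \<in> carrier P" "p = \<iota> (cf p 0) \<oplus>\<^bsub>P\<^esub> shift u"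
proof
  let ?u = "\<lambda>n. p (Suc n)"
  obtain n where n: "bound \<zero> n p" using assms by (auto simp: carrier_P)
  have "bound \<zero> n ?u" using n by (auto simp: bound_def)
  then show u: "?u \<in> carrier P" using assms by (auto simp: carrier_P)
  show "p = \<iota> (cf p 0) \<oplus>\<^bsub>P\<^esub> shift ?u"
  proof (rule up_eqI)
    fix k
    show "cf p k = cf (\<iota> (cf p 0) \<oplus>\<^bsub>P\<^esub> shift ?u) k"
      using u assms by (cases k) (simp_all add: cf_shift[OF u] coeff_P[OF u] coeff_P[OF assms])
  qed (use u assms in auto)
qed

section \<open>Left ideals under right multiplication by \<theta>\<close>

lemma shift_left_ideal:
  assumes "left_ideal D L" shows "left_ideal D (shift ` L)"
proof -
  note L = left_idealD[OF assms]
  have T: "T x \<in> L" if "x \<in> L" for x using L(5)[OF that, of 1] by simp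
  show ?thesis
    unfolding left_ideal_D_iff
  proof (intro conjI ballI)
    show "shift ` L \<subseteq> carrier P" using L(1) by auto
    show "\<zero>\<^bsub>P\<^esub> \<in> shift ` L" using L(2) shift_zero by (metis imageI)
    show "x \<oplus>\<^bsub>P\<^esub> y \<in> shift ` L" if xy: "x \<in> shift ` L" "y \<in> shift ` L" for x y
    proof -
      obtain p q where pq: "p \<in> L" "q \<in> L" "x = shift p" "y = shift q" using xy by blast
      then have "x \<oplus>\<^bsub>P\<^esub> y = shift (p \<oplus>\<^bsub>P\<^esub> q)" using shift_add L(1) by simp
      then show ?thesis using L(3)[OF pq(1,2)] by blast
    qed
    show "a \<odot>\<^bsub>P\<^esub> x \<in> shift ` L" if ax: "a \<in> carrier R" "x \<in> shift ` L" for a x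
    proof -
      obtain p where p: "p \<in> L" "x = shift p" using ax(2) by blast
      then have "a \<odot>\<^bsub>P\<^esub> x = shift (a \<odot>\<^bsub>P\<^esub> p)" using shift_smult ax(1) L(1) by simp
      then show ?thesis using L(4)[OF ax(1) p(1)] by blast
    qed
    show "T x \<in> shift ` L" if xL: "x \<in> shift ` L" for x
    proof -
      obtain p where p: "p \<in> L" "x = shift p" using xL by blast
      then have "T x = shift (T p)" using shift_T L(1) by simp
      then show ?thesis using T[OF p(1)] by blast
    qed
  qed
qed

lemma shift_preimage_left_ideal:
  assumes "left_ideal D W" shows "left_ideal D {p \<in> carrier P. shift p \<in> W}"
proof -
  note L = left_idealD[OF assms]
  have "T x \<in> W" if "x \<in> W" for x using L(5)[OF that, of 1] by simp
  then show ?thesis unfolding left_ideal_D_iff using L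
    by (auto simp: shift_zero shift_add shift_smult shift_T)
qed

text \<open>First the contraction of \<open>W\<close> to \<open>R\<close> is zero, being a
  \<delta>-ideal inside \<open>M\<close>. Then \<open>w = r + u \<theta>\<close> in \<open>W\<close>
  is multiplied by a power of \<open>m\<close> that carries \<open>u\<close> into \<open>SM\<close>;
  this leaves a non-zero multiple of \<open>r\<close> in the contraction unless
  \<open>r = 0\<close>, so \<open>w\<close> lies in \<open>S\<theta>\<close>.\<close>

lemma shift_N_essential:
  assumes dom: "domain R" and M: "maximalideal M R" "M \<noteq> {\<zero>}"
    and prim: "\<And>I. delta_ideal R \<delta> I \<Longrightarrow> I \<subseteq> M \<Longrightarrow> I = {\<zero>}"
    and W: "left_ideal D W" "shift ` gen_by M \<subseteq> W" "shift ` carrier P \<inter> W = shift ` gen_by M"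
  shows "W = shift ` gen_by M"
proof -
  interpret R: domain R by fact
  interpret M: maximalideal M R by fact
  note W1 = left_idealD[OF W(1)]
  have TW: "T x \<in> W" if "x \<in> W" for x using W1(5)[OF that, of 1] by simp
  have \<iota>_add: "\<iota> (a \<oplus> b) = \<iota> a \<oplus>\<^bsub>P\<^esub> \<iota> b" if "a \<in> carrier R" "b \<in> carrier R" for a b
    using that by (intro up_eqI) auto
  have \<iota>_mult: "\<iota> (a \<otimes> b) = a \<odot>\<^bsub>P\<^esub> \<iota> b" if "a \<in> carrier R" "b \<in> carrier R" for a b
    using that by (intro up_eqI) auto
  have mem_N: "u \<in> gen_by M" if "shift u \<in> W" "u \<in> carrier P" for u
  proof -
    have "shift u \<in> shift ` gen_by M" using that W(3) by blast
    then obtain u' where "u' \<in> gen_by M" "shift u = shift u'" by blast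
    then show ?thesis using shift_inj[of u u'] that N_carrier[OF M(1)] by blast
  qed
  define I where "I = {r \<in> carrier R. \<iota> r \<in> W}"
  have T_\<iota>: "T (\<iota> r) = shift (\<iota> r) \<oplus>\<^bsub>P\<^esub> \<iota> (\<delta> r)" if "r \<in> carrier R" for r
    using that by (intro up_eqI) (auto simp: coeff_T cf_shift split: nat.split)
  have IM: "r \<in> M" if r: "r \<in> I" for r
  proof -
    have rc: "r \<in> carrier R" "\<iota> r \<in> W" using r by (auto simp: I_def)
    \<comment> \<open>The combination \<open>r \<theta> r - \<delta>(r) r\<close> equals
      \<open>r^2 \<theta>\<close>, an element of \<open>W\<close> in \<open>S\<theta>\<close>; so
      \<open>r^2\<close> lies in \<open>M\<close>.\<close>
    have "r \<odot>\<^bsub>P\<^esub> T (\<iota> r) \<ominus>\<^bsub>P\<^esub> \<delta> r \<odot>\<^bsub>P\<^esub> \<iota> r \<in> W" using rc TW W1(4,6) by simp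
    moreover have "r \<odot>\<^bsub>P\<^esub> T (\<iota> r) \<ominus>\<^bsub>P\<^esub> \<delta> r \<odot>\<^bsub>P\<^esub> \<iota> r = shift (\<iota> (r \<otimes> r))"
    proof -
      have "\<delta> r \<odot>\<^bsub>P\<^esub> \<iota> r = r \<odot>\<^bsub>P\<^esub> \<iota> (\<delta> r)" using rc by (simp add: \<iota>_mult[symmetric] R.m_comm)
      then show ?thesis
        using rc by (simp add: T_\<iota> \<iota>_mult shift_smult UP_smult_r_distr a_minus_def P.a_assoc P.r_neg)
    qed
    ultimately have "\<iota> (r \<otimes> r) \<in> gen_by M" using mem_N rc by simp
    then have "r \<otimes> r \<in> M" using N_const_iff[OF M(1), of "r \<otimes> r"] rc by simp
    then show ?thesis using prime_M[OF M(1) rc(1) rc(1)] by blast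
  qed
  have "delta_ideal R \<delta> I"
    unfolding delta_ideal_def R.ideal_iff
  proof (intro conjI ballI)
    show "I \<subseteq> carrier R" by (auto simp: I_def)
    show "\<zero> \<in> I" using W1(2) by (simp add: I_def)
    show "x \<oplus> y \<in> I" if "x \<in> I" "y \<in> I" for x y using that W1(3) by (auto simp: I_def \<iota>_add)
    show "r \<otimes> x \<in> I" if "r \<in> carrier R" "x \<in> I" for r x using that W1(4) by (auto simp: I_def \<iota>_mult)
    show "\<delta> ` I \<subseteq> I"
    proof clarify
      fix r assume r: "r \<in> I"
      have rc: "r \<in> carrier R" "\<iota> r \<in> W" using r by (auto simp: I_def)
      \<comment> \<open>Since \<open>r\<close> lies in \<open>M\<close>, the element
        \<open>r \<theta>\<close> is in \<open>W\<close>, and then so is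
        \<open>\<delta>(r) = \<theta> r - r \<theta>\<close>.\<close>
      have "shift (\<iota> r) \<in> W" using N_\<iota>[OF M(1) IM[OF r]] W(2) by blast
      then have "T (\<iota> r) \<ominus>\<^bsub>P\<^esub> shift (\<iota> r) \<in> W" using TW rc W1(6) by blast
      moreover have "T (\<iota> r) \<ominus>\<^bsub>P\<^esub> shift (\<iota> r) = \<iota> (\<delta> r)"
        using rc by (simp add: T_\<iota> a_minus_def P.a_ac P.r_neg P.r_neg1 P.r_neg2)
      ultimately show "\<delta> r \<in> I" using rc by (simp add: I_def)
    qed
  qed
  then have I0: "I = {\<zero>}" using prim IM by blast
  obtain m where m: "m \<in> M" "m \<noteq> \<zero>" using M(2) M.zero_closed by blast
  have mc: "m \<in> carrier R" using m M.Icarr by simp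
  have "w \<in> shift ` gen_by M" if w: "w \<in> W" for w
  proof -
    have wc: "w \<in> carrier P" using W1(1) w .
    define r where "r = cf w 0"
    have rc: "r \<in> carrier R" using wc by (simp add: r_def)
    obtain u where u: "u \<in> carrier P" "w = \<iota> r \<oplus>\<^bsub>P\<^esub> shift u" using shift_decomp[OF wc] unfolding r_def .
    define n where "n = Suc (deg R u)"
    have mn: "m [^] n \<in> carrier R" "m [^] n \<noteq> \<zero>" using mc m(2) R.nat_pow_nonzero by auto
    have "m [^] n \<odot>\<^bsub>P\<^esub> u \<in> gen_by M" using N_torsion[OF M(1) m(1) below_deg[OF u(1)]] by (simp add: n_def)
    then have "shift (m [^] n \<odot>\<^bsub>P\<^esub> u) \<in> W" using W(2) by blast
    then have "m [^] n \<odot>\<^bsub>P\<^esub> w \<ominus>\<^bsub>P\<^esub> shift (m [^] n \<odot>\<^bsub>P\<^esub> u) \<in> W" using W1(4,6) w mn by blast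
    moreover have "m [^] n \<odot>\<^bsub>P\<^esub> w \<ominus>\<^bsub>P\<^esub> shift (m [^] n \<odot>\<^bsub>P\<^esub> u) = \<iota> (m [^] n \<otimes> r)"
      unfolding u(2) using mn(1) rc u(1)
      by (simp add: shift_smult UP_smult_r_distr \<iota>_mult a_minus_def P.a_assoc P.r_neg)
    ultimately have "m [^] n \<otimes> r \<in> I" using mn rc by (simp add: I_def)
    then have "r = \<zero>" using I0 mn rc R.integral by blast
    then have "w = shift u" using u by simp
    then show ?thesis using w u(1) mem_N by blast
  qed
  then show ?thesis using W(2) by blast
qed

lemma delta_ideal_prod:
  assumes "delta_ideal R \<delta> I" "delta_ideal R \<delta> J" shows "delta_ideal R \<delta> (I \<cdot> J)"
proof -
  have I: "ideal I R" "\<And>x. x \<in> I \<Longrightarrow> \<delta> x \<in> I" and J: "ideal J R" "\<And>x. x \<in> J \<Longrightarrow> \<delta> x \<in> J"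
    using assms by (auto simp: delta_ideal_def)
  have "\<delta> x \<in> I \<cdot> J" if "x \<in> I \<cdot> J" for x
    using that
  proof (induct x rule: ideal_prod.induct)
    case (prod i j)
    have "i \<in> carrier R" "j \<in> carrier R" using prod ideal.Icarr I(1) J(1) by metis+
    then show ?case
      using ideal_prod.sum[OF ideal_prod.prod[OF I(2)[OF prod(1)] prod(2)] ideal_prod.prod[OF prod(1) J(2)[OF prod(2)]]]
      by (simp add: delta_mult)
  next
    case (sum s t)
    have "s \<in> carrier R" "t \<in> carrier R" using sum R.ideal_prod_in_carrier[OF I(1) J(1)] by auto
    then show ?case using ideal_prod.sum sum by (simp add: delta_add)
  qed
  then show ?thesis using R.ideal_prod_is_ideal[OF I(1) J(1)] by (auto simp: delta_ideal_def)
qed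

theorem delta_simple_if_diamond:
  assumes dom: "domain R" and noeth: "noetherian_ring R"
    and unit: "\<And>n::nat. n > 0 \<Longrightarrow> [n] \<cdot> \<one> \<in> Units R"
    and M: "maximalideal M R" "M \<noteq> {\<zero>}"
    and prim: "\<And>I. delta_ideal R \<delta> I \<Longrightarrow> I \<subseteq> M \<Longrightarrow> I = {\<zero>}"
    and diamond: "diamond D"
  shows "delta_simple R \<delta>"
proof (rule ccontr)
  interpret R: noetherian_domain R by (intro noetherian_domain.intro dom noeth)
  interpret M: maximalideal M R by fact
  assume "\<not> delta_simple R \<delta>"
  then obtain J where J: "delta_ideal R \<delta> J" "J \<noteq> {\<zero>}" "J \<noteq> carrier R" by (auto simp: delta_simple_def)
  \<comment> \<open>A non-zero \<open>M\<close> cannot itself be a \<delta>-ideal. The resulting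
    \<open>m\<close> drives the maximality of \<open>SM\<close>.\<close>
  have "\<not> \<delta> ` M \<subseteq> M" using prim[of M] M(2) M.is_ideal by (auto simp: delta_ideal_def)
  then obtain m where m: "m \<in> M" "\<delta> m \<notin> M" by blast
  let ?N = "gen_by M"
  define V where "V = shift ` carrier P"
  define L where "L = shift ` ?N"
  have all: "left_ideal D (carrier P)" unfolding left_ideal_D_iff by auto
  have V: "left_ideal D V" unfolding V_def by (rule shift_left_ideal[OF all])
  have L: "left_ideal D L" unfolding L_def by (rule shift_left_ideal[OF N_left_ideal[OF M(1)]])
  have one: "\<iota> \<one> \<notin> ?N" using N_const_iff[OF M(1), of \<one>] M.one_imp_carrier M.I_notcarr by auto
  interpret Q: left_quotient D L
    by (intro left_quotient.intro left_quotient_axioms.intro diff_op_ring_is_ring L)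
  have ess: "essential_extension_of_simple D (quot_module D L)"
  proof (rule Q.quot_essential_extension[OF V])
    have sub: "L \<subseteq> V" unfolding L_def V_def using N_carrier[OF M(1)] by auto
    moreover have "shift (\<iota> \<one>) \<notin> L"
    proof
      assume "shift (\<iota> \<one>) \<in> L"
      then obtain u where "u \<in> ?N" "shift (\<iota> \<one>) = shift u" unfolding L_def by blast
      then show False using shift_inj[of "\<iota> \<one>" u] N_carrier[OF M(1)] one by auto
    qed
    moreover have "shift (\<iota> \<one>) \<in> V" by (auto simp: V_def)
    ultimately show "L \<subset> V" by blast
    fix W assume W: "left_ideal D W" "L \<subseteq> W" "W \<subseteq> V"
    let ?W = "{p \<in> carrier P. shift p \<in> W}"
    have eq: "W = shift ` ?W" using W(3) by (auto simp: V_def)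
    have "?N \<subseteq> ?W" using W(2) N_carrier[OF M(1)] by (auto simp: L_def)
    then have "?W = ?N \<or> ?W = carrier P"
      using N_maximal[OF M(1) m unit shift_preimage_left_ideal[OF W(1)]] by blast
    then show "W = L \<or> W = V"
    proof
      assume N: "?W = ?N"
      have "W = L" by (rule trans[OF eq]) (simp only: N L_def)
      then show ?thesis ..
    next
      assume N: "?W = carrier P"
      have "W = V" by (rule trans[OF eq]) (simp only: N V_def)
      then show ?thesis ..
    qed
  next
    fix W assume W: "left_ideal D W" "L \<subseteq> W" "V \<inter> W = L"
    show "W = L"
      using shift_N_essential[OF dom M prim W(1)] W(2,3) unfolding L_def V_def by blast
  qed
  have art: "artinian_module D (quot_module D L)"
    using diamond Q.quot_cyclic ess unfolding diamond_def by blast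
  define J' where "J' i = ((\<lambda>I. I \<cdot> J) ^^ i) (carrier R)" for i
  have J'_Suc: "J' (Suc i) = J' i \<cdot> J" for i by (simp add: J'_def)
  have J'_delta: "delta_ideal R \<delta> (J' i)" for i
  proof (induct i)
    case 0 show ?case using R.oneideal by (auto simp: J'_def delta_ideal_def)
  next
    case (Suc i) show ?case unfolding J'_Suc by (rule delta_ideal_prod[OF Suc J(1)])
  qed
  have J'_ideal: "ideal (J' i) R" and J'_d: "\<And>x. x \<in> J' i \<Longrightarrow> \<delta> x \<in> J' i" for i
    using J'_delta[of i] by (auto simp: delta_ideal_def)
  have J_ideal: "ideal J R" using J(1) by (simp add: delta_ideal_def)
  have J'_anti: "J' (Suc i) \<subseteq> J' i" for i
    unfolding J'_Suc using R.ideal_prod_inter[OF J'_ideal J_ideal] by blast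
  \<comment> \<open>The preimage of \<open>J^i\<close> in the quotient \<open>S/S\<theta>\<close>,
    which is \<open>R\<close> with \<theta> acting as \<delta>. It is a left ideal because
    \<open>J^i\<close> is a \<delta>-ideal.\<close>
  define W where "W i = {p \<in> carrier P. cf p 0 \<in> J' i}" for i
  have "\<exists>n. \<forall>i\<ge>n. W i = W n"
  proof (rule Q.quot_artinian_dcc[OF art])
    fix i
    interpret J': ideal "J' i" R by (rule J'_ideal)
    show "left_ideal D (W i)"
      unfolding left_ideal_D_iff W_def using J'.zero_closed J'.add_mem J'.I_l_closed J'_d
      by (auto simp: coeff_T)
    show "W (Suc i) \<subseteq> W i" using J'_anti by (auto simp: W_def)
    show "L \<subseteq> W i" using J'.zero_closed N_carrier[OF M(1)] by (auto simp: L_def W_def cf_shift)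
  qed
  then obtain n where n: "\<forall>i\<ge>n. W i = W n" by (elim exE)
  have Wn: "W (Suc n) = W n" using n[rule_format, of "Suc n"] by simp
  have "J' n \<subseteq> J' (Suc n)"
  proof
    fix x assume x: "x \<in> J' n"
    then have xc: "x \<in> carrier R" using ideal.Icarr[OF J'_ideal] by metis
    then have "\<iota> x \<in> W n" using x by (simp add: W_def)
    then have "\<iota> x \<in> W (Suc n)" using Wn by simp
    then show "x \<in> J' (Suc n)" using xc by (simp add: W_def)
  qed
  \<comment> \<open>A stable chain means \<open>J^n = J^n J\<close>, so \<open>J^n\<close> vanishes
    by Nakayama, whereas it contains the non-zero \<open>c^n\<close>.\<close>
  then have "J' n = {\<zero>}" using R.nakayama[OF J'_ideal J_ideal J(3)] unfolding J'_Suc by blast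
  moreover obtain c where c: "c \<in> J" "c \<noteq> \<zero>" using J(2) additive_subgroup.zero_closed[OF ideal.axioms(1)[OF J_ideal]] by blast
  have cc: "c \<in> carrier R" using ideal.Icarr[OF J_ideal c(1)] .
  have "c [^] i \<in> J' i" for i :: nat
  proof (induct i)
    case 0 show ?case by (simp add: J'_def)
  next
    case (Suc i) show ?case unfolding J'_Suc using ideal_prod.prod[OF Suc c(1)] by simp
  qed
  ultimately have "c [^] n = \<zero>" by blast
  then show False using R.nat_pow_nonzero[OF cc c(2)] by blast
qed

end

section \<open>Affine domains of Krull dimension one\<close>

lemma maximalideal_if_krull_dim_one:
  fixes R (structure)
  assumes "domain R" "noetherian_ring R" and dim: "krull_dim R = 1"
    and P: "primeideal P R" "P \<noteq> {\<zero>}"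
  shows "maximalideal P R"
proof -
  interpret R: domain R by fact
  interpret N: noetherian_ring R by fact
  interpret P: primeideal P R by fact
  have "\<one> \<notin> P" using P.one_imp_carrier P.I_notcarr by blast
  then obtain M where M: "ideal M R" "P \<subseteq> M \<and> \<one> \<notin> M"
    and max: "\<And>J. ideal J R \<Longrightarrow> P \<subseteq> J \<and> \<one> \<notin> J \<Longrightarrow> M \<subseteq> J \<Longrightarrow> J = M"
    using N.maximal_ideal_with_property[of P "\<lambda>J. P \<subseteq> J \<and> \<one> \<notin> J", OF P.is_ideal] by auto
  have maxM: "maximalideal M R"
  proof (rule maximalidealI[OF M(1)])
    show "carrier R \<noteq> M" using M(2) by auto
    fix J assume J: "ideal J R" "M \<subseteq> J" "J \<subseteq> carrier R"
    show "J = M \<or> J = carrier R"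
      using max[OF J(1)] J(2) M(2) ideal.one_imp_carrier[OF J(1)] by blast
  qed
  have "M = P"
  proof (rule ccontr)
    assume "M \<noteq> P"
    then have PM: "P \<subset> M" using M(2) by blast
    have zP: "{\<zero>} \<subset> P" using P(2) P.zero_closed by blast
    \<comment> \<open>A second prime above \<open>P\<close> would give a chain of length 2 starting
      at the zero ideal, which is prime in a domain.\<close>
    define C where "C i = (if i = 0 then {\<zero>} else if i = 1 then P else M)" for i :: nat
    have "\<forall>i\<le>2. primeideal (C i) R"
      using R.zeroprimeideal P(1) R.maximalideal_prime[OF maxM] by (auto simp: C_def)
    moreover have "\<forall>i<2. C i \<subset> C (Suc i)" using zP PM by (auto simp: C_def less_2_cases_iff)
    ultimately have "enat 2 \<le> krull_dim R"
      unfolding krull_dim_def by (intro Sup_upper) blast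
    then show False using dim by (simp add: one_enat_def)
  qed
  then show ?thesis using maxM by simp
qed

section \<open>Integers as units over a field of characteristic zero, and the final assembly\<close>

lemma (in algebra) unit_hom: "ring_hom_ring R M (\<lambda>k. k \<odot>\<^bsub>M\<^esub> \<one>\<^bsub>M\<^esub>)"
proof (rule ring_hom_ringI2[OF cring.axioms(1)[OF R_cring] cring.axioms(1)[OF M_cring] ring_hom_memI])
  fix k l assume kl: "k \<in> carrier R" "l \<in> carrier R"
  show "(k \<otimes> l) \<odot>\<^bsub>M\<^esub> \<one>\<^bsub>M\<^esub> = (k \<odot>\<^bsub>M\<^esub> \<one>\<^bsub>M\<^esub>) \<otimes>\<^bsub>M\<^esub> (l \<odot>\<^bsub>M\<^esub> \<one>\<^bsub>M\<^esub>)"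
    using kl by (simp add: smult_assoc1 smult_assoc2)
qed (simp_all add: smult_l_distr)

lemma (in ring_hom_ring) hom_nat: "h ([n] \<cdot>\<^bsub>R\<^esub> \<one>\<^bsub>R\<^esub>) = [n] \<cdot>\<^bsub>S\<^esub> \<one>\<^bsub>S\<^esub>" for n :: nat
proof (induct n)
  case (Suc n)
  have "[n] \<cdot>\<^bsub>R\<^esub> \<one>\<^bsub>R\<^esub> \<in> carrier R" by simp
  then show ?case using Suc by simp
qed simp

lemma (in algebra) nat_Units_if_char_zero:
  assumes "field R" "char_zero R" "(n::nat) > 0"
  shows "[n] \<cdot>\<^bsub>M\<^esub> \<one>\<^bsub>M\<^esub> \<in> Units M"
proof -
  interpret F: field R by fact
  interpret h: ring_hom_ring R M "\<lambda>k. k \<odot>\<^bsub>M\<^esub> \<one>\<^bsub>M\<^esub>" by (rule unit_hom)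
  have "[n] \<cdot> \<one> \<in> Units R" using assms(2,3) by (simp add: char_zero_def F.field_Units)
  then obtain k where k: "k \<in> carrier R" "k \<otimes> [n] \<cdot> \<one> = \<one>" "[n] \<cdot> \<one> \<in> carrier R"
    by (auto simp: Units_def)
  have "(k \<odot>\<^bsub>M\<^esub> \<one>\<^bsub>M\<^esub>) \<otimes>\<^bsub>M\<^esub> ([n] \<cdot>\<^bsub>M\<^esub> \<one>\<^bsub>M\<^esub>) = \<one>\<^bsub>M\<^esub>"
    using h.hom_mult[OF k(1,3)] h.hom_one k(2) h.hom_nat[of n] by simp
  then show ?thesis
    using k(1) comm_monoid.m_comm[OF cring.axioms(2)[OF M_cring]] unfolding Units_def by (auto intro!: bexI[of _ "k \<odot>\<^bsub>M\<^esub> \<one>\<^bsub>M\<^esub>"])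
qed

theorem theorem3p9:
  fixes K :: "('k, 'c) ring_scheme"
    and R :: "('k, 'a, 'd) module_scheme"
    and \<delta> :: "'a \<Rightarrow> 'a"
  assumes "field K" and "char_zero K"
    and "affine_algebra K R"
    and "domain R"
    and "krull_dim R = 1"
    and "derivation K R \<delta>"
    and "\<exists>a\<in>carrier R. \<delta> a \<noteq> \<zero>\<^bsub>R\<^esub>"
  shows "delta_primitive R \<delta> \<and> (diamond (diff_op_ring R \<delta>) \<longleftrightarrow> delta_simple R \<delta>)"
proof -
  interpret K: field K by fact
  interpret domain R by fact
  interpret A: algebra K R using assms(3) by (simp add: affine_algebra_def)
  interpret differential_ring R "UP R" K \<delta>
    by (intro differential_ring.intro differential_ring_axioms.intro UP_cring.intro is_cring assms(6))
  interpret h: ring_hom_ring K R "\<lambda>k. k \<odot>\<^bsub>R\<^esub> \<one>\<^bsub>R\<^esub>" by (rule A.unit_hom)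
  obtain a where a: "a \<in> carrier R" "\<delta> a \<noteq> \<zero>\<^bsub>R\<^esub>" using assms(7) by blast
  obtain G where G: "finite G" "G \<subseteq> carrier R"
    "\<And>B. subring B R \<Longrightarrow> submodule B K R \<Longrightarrow> G \<subseteq> B \<Longrightarrow> B = carrier R"
    using assms(3) unfolding affine_algebra_def by blast
  \<comment> \<open>The image of \<open>K\<close>, a field of constants because \<delta> is
    \<open>K\<close>-linear and kills 1.\<close>
  define B0 where "B0 = (\<lambda>k. k \<odot>\<^bsub>R\<^esub> \<one>\<^bsub>R\<^esub>) ` carrier K"
  have B0: "subfield B0 R"
    unfolding B0_def using h.img_is_subfield(2)[OF K.carrier_is_subfield] by simp
  have \<delta>_B0: "\<delta> b = \<zero>\<^bsub>R\<^esub>" if bB: "b \<in> B0" for b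
  proof -
    obtain k where k: "k \<in> carrier K" "b = k \<odot>\<^bsub>R\<^esub> \<one>\<^bsub>R\<^esub>" using bB by (auto simp: B0_def)
    then have "\<delta> b = k \<odot>\<^bsub>R\<^esub> \<delta> \<one>\<^bsub>R\<^esub>" using assms(6) by (simp add: derivation_def)
    then show ?thesis using k by simp
  qed
  have unit: "[n] \<cdot>\<^bsub>R\<^esub> \<one>\<^bsub>R\<^esub> \<in> Units R" if "n > 0" for n :: nat
    by (rule A.nat_Units_if_char_zero[OF assms(1,2) that])
  have char0: "[n] \<cdot>\<^bsub>R\<^esub> \<one>\<^bsub>R\<^esub> \<noteq> \<zero>\<^bsub>R\<^esub>" if "n > 0" for n :: nat
    using unit[OF that] by (auto simp: Units_def)
  obtain B where B: "subring B R" "B0 \<subseteq> B" "G \<subseteq> B" "noetherian_ring (R\<lparr>carrier := B\<rparr>)"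
    and fin: "\<And>c. c \<in> B \<Longrightarrow> c \<noteq> \<zero>\<^bsub>R\<^esub> \<Longrightarrow>
      finite {n::nat. \<exists>k::nat. \<exists>v\<in>B. (a \<ominus>\<^bsub>R\<^esub> [n] \<cdot>\<^bsub>R\<^esub> \<one>\<^bsub>R\<^esub>) \<otimes>\<^bsub>R\<^esub> v = c [^]\<^bsub>R\<^esub> k}"
    using finitely_generated_tower[OF assms(4) ring_derivation B0 \<delta>_B0 char0 a G(1,2)] by auto
  \<comment> \<open>As \<open>B\<close> contains the image of \<open>K\<close>, it is a subalgebra;
    containing the generators, it is all of \<open>R\<close>.\<close>
  have "submodule B K R"
  proof (rule A.submoduleI)
    show "B \<subseteq> carrier R" by (rule subringE(1)[OF B(1)])
    fix k b assume kb: "k \<in> carrier K" "b \<in> B"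
    have bc: "b \<in> carrier R" using subringE(1)[OF B(1)] kb(2) by blast
    have "k \<odot>\<^bsub>R\<^esub> \<one>\<^bsub>R\<^esub> \<in> B" using kb(1) B(2) by (auto simp: B0_def)
    then have "(k \<odot>\<^bsub>R\<^esub> \<one>\<^bsub>R\<^esub>) \<otimes>\<^bsub>R\<^esub> b \<in> B" using subringE(6)[OF B(1)] kb(2) by blast
    then show "k \<odot>\<^bsub>R\<^esub> b \<in> B" using kb(1) bc by (simp add: A.smult_assoc2)
  qed (use subringE[OF B(1)] in auto)
  then have BR: "B = carrier R" using G(3) B by blast
  have noeth: "noetherian_ring R" using B(4) BR by simp
  note dim = maximalideal_if_krull_dim_one[OF assms(4) noeth assms(5)]
  have "finite {n::nat. \<exists>k::nat. \<exists>v\<in>carrier R. (a \<ominus>\<^bsub>R\<^esub> [n] \<cdot>\<^bsub>R\<^esub> \<one>\<^bsub>R\<^esub>) \<otimes>\<^bsub>R\<^esub> v = \<delta> a [^]\<^bsub>R\<^esub> k}"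
    using fin[of "\<delta> a"] a unfolding BR by simp
  then obtain M where M: "maximalideal M R" "M \<noteq> {\<zero>\<^bsub>R\<^esub>}"
    "\<And>I. delta_ideal R \<delta> I \<Longrightarrow> I \<subseteq> M \<Longrightarrow> I = {\<zero>\<^bsub>R\<^esub>}"
    using delta_primitive_if_finite[OF assms(4) noeth ring_derivation dim unit a] by blast
  have "delta_primitive R \<delta>" unfolding delta_primitive_def using M(1,3) by blast
  moreover have "diamond (diff_op_ring R \<delta>) \<longleftrightarrow> delta_simple R \<delta>"
    using delta_simple_if_diamond[OF assms(4) noeth unit M] diamond_if_delta_simple[OF assms(4) noeth dim] by blast
  ultimately show ?thesis by blast
qed

end
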